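(* Let $(X,Y,Z)=\{(X(t),Y(t),Z(t))\}_{t\ge0}$ be an orthogonal standard random motion (OSM) in $\mathbb{R}^3$ with speed $c>0$ and constant rate function $\lambda(t)=\lambda>0$ for all $t$. The transition density $p=p(t,x,y,z)$ of the random vector $(X,Y,Z)$ satisfies the sixth-order equation $$\begin{aligned} &\Bigl[\Bigl(\frac{\partial}{\partial t}+\lambda\Bigr)^6-\frac{3\lambda^2}{4}\Bigl(\frac{\partial}{\partial t}+\lambda\Bigr)^4-\frac{\lambda^3}{4}\Bigl(\frac{\partial}{\partial t}+\lambda\Bigr)^3\Bigr]p = c^6\frac{\partial^6 p}{\partial x^2\partial y^2\partial z^2}\\ &\quad-c^4\Bigl(\frac{\partial}{\partial t}+\lambda\Bigr)^2\Bigl(\frac{\partial^4}{\partial x^2\partial y^2}+\frac{\partial^4}{\partial x^2\partial z^2}+\frac{\partial^4}{\partial y^2\partial z^2}\Bigr)p +c^2\Bigl[\Bigl(\frac{\partial}{\partial t}+\lambda\Bigr)^4-\frac{\lambda^2}{4}\Bigl(\frac{\partial}{\partial t}+\lambda\Bigr)^2\Bigr]\Delta p, \end{aligned}$$ where $\Delta=\frac{\partial^2}{\partial x^2}+\frac{\partial^2}{\partial y^2}+\frac{\partial^2}{\partial z^2}$ is the Laplace operator.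
   Context: Let $d_0=(1,0,0)$, $d_1=(0,1,0)$, $d_2=(0,0,1)$, $d_3=(-1,0,0)$, $d_4=(0,-1,0)$, $d_5=(0,0,-1)$. The orthogonal standard motion (OSM) with speed $c>0$ and constant rate $\lambda>0$ is the process $(X(t),Y(t),Z(t))=c\int_0^t D(s)\,ds$, where $D(s)\in\{d_0,\dots,d_5\}$ is the current direction. The initial direction $D(0)$ is uniform on the six directions, and $D$ changes at the events of a homogeneous Poisson process with rate $\lambda$, independent of the choices of direction. At each event the new direction is chosen, given the current one and independently of the rest of the past, uniformly among the four directions orthogonal to the current one. At time $t$ the position lies in the octahedron $S_{ct}=\{(x,y,z)\in\mathbb{R}^3:|x|+|y|+|z|\le ct\}$. For $t>0$ and $(x,y,z)$ in the interior of $S_{ct}$, the transition density $p$ is defined by $p(t,x,y,z)\,dx\,dy\,dz=P\{X(t)\in dx,\ Y(t)\in dy,\ Z(t)\in dz\}$ (the absolutely continuous component of the law of the position), and the equation refers to this region.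
   Formalization: The equation is asserted in the interior of S_ct off the planes x=0, y=0, z=0, for the version of p continuous there; on these planes p has kinks (the λ^4 term of e^{λt}p is a multiple of 45ct−18(|x|+|y|+|z|)), so its derivatives do not exist there. *)

theory Defs
  imports "HOL-Probability.Probability"
begin

section \<open>The orthogonal standard motion\<close>

definition osm_directions :: "(real ^ 3) set" where
  "osm_directions =
     {vector [1, 0, 0], vector [0, 1, 0], vector [0, 0, 1],
      vector [- 1, 0, 0], vector [0, - 1, 0], vector [0, 0, - 1]}"

text \<open>
  \<open>W k\<close> is the waiting time between the \<open>k\<close>-th and the \<open>(k + 1)\<close>-st event of the Poisson process
  (the zeroth event being time 0), and \<open>V n\<close> is the direction in force after the \<open>n\<close>-th event.
\<close>

definition event_time :: "(nat \<Rightarrow> 'a \<Rightarrow> real) \<Rightarrow> nat \<Rightarrow> 'a \<Rightarrow> real" where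
  "event_time W n \<omega> = (\<Sum>k<n. W k \<omega>)"

definition event_count :: "(nat \<Rightarrow> 'a \<Rightarrow> real) \<Rightarrow> real \<Rightarrow> 'a \<Rightarrow> nat" where
  "event_count W t \<omega> = card {n. 1 \<le> n \<and> event_time W n \<omega> \<le> t}"

definition osm_direction ::
  "(nat \<Rightarrow> 'a \<Rightarrow> real) \<Rightarrow> (nat \<Rightarrow> 'a \<Rightarrow> real ^ 3) \<Rightarrow> real \<Rightarrow> 'a \<Rightarrow> real ^ 3" where
  "osm_direction W V t \<omega> = V (event_count W t \<omega>) \<omega>"

definition osm_position ::
  "real \<Rightarrow> (nat \<Rightarrow> 'a \<Rightarrow> real) \<Rightarrow> (nat \<Rightarrow> 'a \<Rightarrow> real ^ 3) \<Rightarrow> real \<Rightarrow> 'a \<Rightarrow> real ^ 3" where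
  "osm_position c W V t \<omega> = c *\<^sub>R integral {0..t} (\<lambda>s. osm_direction W V s \<omega>)"

text \<open>
  The Poisson process of rate \<open>l\<close> is given by independent exponential waiting times. The
  direction chain is independent of it, so conditioning on the past directions amounts to
  conditioning on the whole past.
\<close>

locale orthogonal_standard_motion = prob_space M
  for M :: "'a measure" +
  fixes c l :: real
    and W :: "nat \<Rightarrow> 'a \<Rightarrow> real"
    and V :: "nat \<Rightarrow> 'a \<Rightarrow> real ^ 3"
  assumes speed_pos: "c > 0"
    and rate_pos: "l > 0"
    and waiting_indep: "indep_vars (\<lambda>_. borel) W UNIV"
    and waiting_exponential:
      "\<And>k. distributed M lborel (W k) (\<lambda>x. ennreal (exponential_density l x))"
    and direction_measurable: "\<And>n. V n \<in> M \<rightarrow>\<^sub>M count_space osm_directions"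
    and initial_direction:
      "\<And>u. \<P>(\<omega> in M. V 0 \<omega> = u) = pmf (pmf_of_set osm_directions) u"
    and next_direction:
      "\<And>n h u. \<P>(\<omega> in M. \<forall>i\<le>n. V i \<omega> = h i) \<noteq> 0 \<Longrightarrow>
         \<P>(\<omega> in M. V (Suc n) \<omega> = u \<bar> \<forall>i\<le>n. V i \<omega> = h i) =
         pmf (pmf_of_set {v \<in> osm_directions. orthogonal (h n) v}) u"
    and waiting_indep_directions:
      "indep_set
         (sets (vimage_algebra (space M) (\<lambda>\<omega> k. W k \<omega>) (\<Pi>\<^sub>M k\<in>UNIV. borel)))
         (sets (vimage_algebra (space M) (\<lambda>\<omega> n. V n \<omega>)
                  (\<Pi>\<^sub>M n\<in>UNIV. count_space osm_directions)))"

section \<open>The transition density\<close>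

definition octahedron :: "real \<Rightarrow> (real ^ 3) set" where
  "octahedron r = {v. \<bar>v $ 1\<bar> + \<bar>v $ 2\<bar> + \<bar>v $ 3\<bar> \<le> r}"

text \<open>
  \<open>f\<close> is a version on \<open>S\<close> of the density of the absolutely continuous component of \<open>\<mu>\<close>: by
  Lebesgue's decomposition theorem the singular component is carried by some null set \<open>N\<close>, outside
  of which \<open>\<mu>\<close> has density \<open>f\<close>.
\<close>

definition ac_density_on :: "'a::euclidean_space measure \<Rightarrow> 'a set \<Rightarrow> ('a \<Rightarrow> real) \<Rightarrow> bool" where
  "ac_density_on \<mu> S f \<longleftrightarrow>
     set_borel_measurable borel S f \<and> (\<forall>x\<in>S. 0 \<le> f x) \<and>
     (\<exists>N\<in>null_sets lborel. \<forall>A\<in>sets borel. A \<subseteq> S - N \<longrightarrow>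
        emeasure \<mu> A = (\<integral>\<^sup>+x\<in>A. ennreal (f x) \<partial>lborel))"

definition osm_transition_density ::
  "'a measure \<Rightarrow> real \<Rightarrow> (nat \<Rightarrow> 'a \<Rightarrow> real) \<Rightarrow> (nat \<Rightarrow> 'a \<Rightarrow> real ^ 3) \<Rightarrow>
   (real \<Rightarrow> real ^ 3 \<Rightarrow> real) \<Rightarrow> bool" where
  "osm_transition_density M c W V p \<longleftrightarrow>
     (\<forall>t>0. ac_density_on (distr M borel (osm_position c W V t)) (interior (octahedron (c * t))) (p t))"

text \<open>
  Paths that use only four coplanar directions have positive probability and stay in a coordinate
  plane, so the law of the position has a singular component on the (Lebesgue-null) coordinate
  planes, across which the normal derivatives of the density jump in general. Away from these planes
  the law is absolutely continuous in the interior of the octahedron; pointwise derivatives of the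
  density make sense there.
\<close>

definition osm_region :: "real \<Rightarrow> (real \<times> (real ^ 3)) set" where
  "osm_region c =
     {(t, v). t > 0 \<and> v \<in> interior (octahedron (c * t)) \<and> (\<forall>i. v $ i \<noteq> 0)}"

section \<open>Partial derivatives\<close>

type_synonym field = "real \<Rightarrow> real ^ 3 \<Rightarrow> real"

definition pdt :: "field \<Rightarrow> field" where
  "pdt u t v = deriv (\<lambda>s. u s v) t"

definition pdx :: "3 \<Rightarrow> field \<Rightarrow> field" where
  "pdx i u t v = deriv (\<lambda>h. u t (v + h *\<^sub>R axis i 1)) 0"

text \<open>All iterated partial derivatives of order at most \<open>k\<close> exist and are continuous on \<open>U\<close>.\<close>

fun Ck_on :: "nat \<Rightarrow> (real \<times> (real ^ 3)) set \<Rightarrow> field \<Rightarrow> bool" where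
  "Ck_on 0 U u \<longleftrightarrow> continuous_on U (\<lambda>(t, v). u t v)"
| "Ck_on (Suc k) U u \<longleftrightarrow>
     continuous_on U (\<lambda>(t, v). u t v) \<and>
     (\<forall>(t, v)\<in>U. (\<lambda>s. u s v) differentiable (at t)) \<and>
     (\<forall>i. \<forall>(t, v)\<in>U. (\<lambda>h. u t (v + h *\<^sub>R axis i 1)) differentiable (at 0)) \<and>
     Ck_on k U (pdt u) \<and> (\<forall>i. Ck_on k U (pdx i u))"

definition laplacian :: "field \<Rightarrow> field" where
  "laplacian u t v = (\<Sum>i\<in>UNIV. (pdx i ^^ 2) u t v)"

definition mixed_fourth :: "field \<Rightarrow> field" where
  "mixed_fourth u t v =
     (pdx 1 ^^ 2) ((pdx 2 ^^ 2) u) t v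
   + (pdx 1 ^^ 2) ((pdx 3 ^^ 2) u) t v
   + (pdx 2 ^^ 2) ((pdx 3 ^^ 2) u) t v"

definition mixed_sixth :: "field \<Rightarrow> field" where
  "mixed_sixth u = (pdx 1 ^^ 2) ((pdx 2 ^^ 2) ((pdx 3 ^^ 2) u))"

text \<open>The operator \<open>\<partial>/\<partial>t + l\<close>.\<close>

definition damped_dt :: "real \<Rightarrow> field \<Rightarrow> field" where
  "damped_dt l u t v = pdt u t v + l * u t v"

end

theory Submission
  imports Defs
begin

text \<open>
  Write \<open>I\<^sub>z f y = \<integral>\<^sub>0\<^sup>\<infinity> f (y + s z) ds\<close>. Conditioning on the successive directions turns
  \<open>\<integral>\<^sub>0\<^sup>\<infinity> E f (t, X t) dt\<close> into a sum, over direction paths, of products of the operators \<open>I\<^sub>z\<close> with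
  \<open>z = (1, c d)\<close>, applied to \<open>exp (- l t) f\<close> at the origin. These operators commute and satisfy the
  resolvent identity \<open>I\<^sub>z I\<^sub>w = I\<^bsub>z+w\<^esub> (I\<^sub>z + I\<^sub>w)\<close>. Since opposite directions add up to \<open>(2, 0)\<close>, powers
  of \<open>Z\<^sub>i = I\<^bsub>(1, c e\<^sub>i)\<^esub> + I\<^bsub>(1, -c e\<^sub>i)\<^esub>\<close> can be expanded into single powers of one-sided operators, with
  binomial coefficients. Paths matter only through their numbers of steps along each axis, and the
  number of axis words with given letter counts and no two equal adjacent letters (Carlitz words)
  obeys \<open>N (k + (1,1,1)) = N (k + e\<^sub>1) + N (k + e\<^sub>2) + N (k + e\<^sub>3) + 2 N k\<close>.

  On every open octant the density is therefore \<open>exp (- l t)\<close> times an exponential power series in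
  \<open>\<bar>v\<^sub>i\<bar> / c\<close> and \<open>(t - \<bar>v\<bar>\<^sub>1 / c) / 2\<close>. There \<open>\<partial>\<^sub>t + l\<close> and \<open>\<partial>\<^sub>i\<close> act by shifting coefficients, and the
  differential equation becomes the recurrence for \<open>N\<close>. Continuity in \<open>t\<close> of both the law of the
  position and the series identifies the density at every time, not only at almost every time.
\<close>

section \<open>Exponential power series\<close>

text \<open>Eliminating the direction-wise densities from the Kolmogorov system would presuppose a
  smooth density. An explicit series yields smoothness and equation together.

  The equation has an algebraic source. Write T for d/dt + l. Formally (T^2 - c^2 d_i^2) Z_i = 2 T,
  so on a sum of terms w(k) Z^k the operator c^2 d_i^2 acts as T^2 - 2 T s_i, where s_i shifts the
  weight w in its i-th index. Inserted into the sixth-order equation, the terms with T^5 s_i and T^4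
  s_i s_j cancel, and what is left is 8 s_1 s_2 s_3 = (l^2 / 2) (s_1 + s_2 + s_3) + l^3 / 4. This is
  the recurrence of the word counts with every letter weighted by l / 4.

  The singular part of the law is kept away by test functions supported in the open region: a path
  that misses an axis stays in a coordinate plane, and expanded terms without a factor
  \<open>Bop\<close> sit on the boundary of the octahedron. Up to the identification of the density
  all sums and integrals are nonnegative, so their order may be exchanged freely.\<close>

definition ser :: "(nat \<Rightarrow> real) \<Rightarrow> real \<Rightarrow> real" where
  "ser a x = (\<Sum>n. a n * x ^ n / fact n)"

lemma exp_sums_real: "(\<lambda>n. K * (y ^ n / fact n)) sums (K * exp (y::real))"
  using sums_mult[OF exp_converges[of y], of K] by (simp add: field_simps scaleR_conv_of_real)

lemma summable_exp_majorant: "summable (\<lambda>n. K * ((y::real) ^ n / fact n))"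
  using exp_sums_real sums_summable by blast

lemma ser_term_bound:
  fixes a K B R x :: real
  assumes "\<bar>a\<bar> \<le> K * B ^ n" "\<bar>x\<bar> \<le> R" "0 \<le> K" "0 \<le> B"
  shows "norm (a * x ^ n / fact n) \<le> K * ((B * R) ^ n / fact n)"
proof -
  have "\<bar>a\<bar> * \<bar>x\<bar> ^ n \<le> (K * B ^ n) * R ^ n"
    by (intro mult_mono power_mono assms) (use assms in auto)
  then show ?thesis
    by (simp add: abs_mult power_abs power_mult_distrib divide_right_mono mult.assoc)
qed

lemma ser_summable:
  fixes a :: "nat \<Rightarrow> real"
  assumes "\<And>n. \<bar>a n\<bar> \<le> K * B ^ n" "0 \<le> K" "0 \<le> B"
  shows "summable (\<lambda>n. a n * x ^ n / fact n)" "summable (\<lambda>n. \<bar>a n * x ^ n / fact n\<bar>)"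
proof -
  have *: "norm (a n * x ^ n / fact n) \<le> K * ((B * \<bar>x\<bar>) ^ n / fact n)" for n
    by (rule ser_term_bound) (use assms in auto)
  show "summable (\<lambda>n. a n * x ^ n / fact n)"
    by (rule summable_comparison_test'[OF summable_exp_majorant *])
  show "summable (\<lambda>n. \<bar>a n * x ^ n / fact n\<bar>)"
    using * by (intro summable_comparison_test'[OF summable_exp_majorant, where N = 0]) auto
qed

lemma ser_bound:
  assumes "\<And>n. \<bar>a n\<bar> \<le> K * B ^ n" "0 \<le> K" "0 \<le> B"
  shows "\<bar>ser a x\<bar> \<le> K * exp (B * \<bar>x\<bar>)"
proof -
  have *: "norm (a n * x ^ n / fact n) \<le> K * ((B * \<bar>x\<bar>) ^ n / fact n)" for n
    by (rule ser_term_bound) (use assms in auto)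
  have "norm (ser a x) \<le> (\<Sum>n. K * ((B * \<bar>x\<bar>) ^ n / fact n))"
    unfolding ser_def by (rule norm_suminf_le[OF * summable_exp_majorant])
  also have "\<dots> = K * exp (B * \<bar>x\<bar>)"
    using exp_sums_real sums_unique by metis
  finally show ?thesis by simp
qed

lemma ser_linear:
  assumes "\<And>n. \<bar>a n\<bar> \<le> K * B ^ n" "0 \<le> K" "0 \<le> B"
    and "\<And>n. \<bar>b n\<bar> \<le> K' * B' ^ n" "0 \<le> K'" "0 \<le> B'"
  shows "ser (\<lambda>n. r * a n + r' * b n) x = r * ser a x + r' * ser b x"
proof -
  have 1: "(\<lambda>n. a n * x ^ n / fact n) sums ser a x"
    unfolding ser_def using ser_summable(1)[OF assms(1-3)] by (rule summable_sums)
  have 2: "(\<lambda>n. b n * x ^ n / fact n) sums ser b x"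
    unfolding ser_def using ser_summable(1)[OF assms(4-6)] by (rule summable_sums)
  show ?thesis
    unfolding ser_def
    using sums_unique[OF sums_add[OF sums_mult[OF 1, of r] sums_mult[OF 2, of r']]]
    by (simp add: ser_def field_simps)
qed

lemma ser_continuous_on:
  assumes "\<And>n. continuous_on U (g n)" "continuous_on U h"
    and "\<And>n z. z \<in> U \<Longrightarrow> \<bar>g n z\<bar> \<le> K * B ^ n" "\<And>z. z \<in> U \<Longrightarrow> \<bar>h z\<bar> \<le> R" "0 \<le> K" "0 \<le> B"
  shows "continuous_on U (\<lambda>z. ser (\<lambda>n. g n z) (h z))"
proof -
  have "uniform_limit U (\<lambda>n z. \<Sum>i<n. g i z * h z ^ i / fact i)
     (\<lambda>z. \<Sum>i. g i z * h z ^ i / fact i) sequentially"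
    by (rule Weierstrass_m_test[OF _ summable_exp_majorant[of K "B * R"]])
       (intro ser_term_bound assms; simp)
  then show ?thesis
    unfolding ser_def
    by (rule uniform_limit_theorem[rotated]) (auto intro!: always_eventually continuous_intros assms)
qed

text \<open>In the induction over several coordinates the coefficients of the outer series are
  themselves series in moving coordinates, so they have to depend on s. The product rule gives the
  derivative of the coefficients plus an index shift scaled by the speed d; bounds uniform on S
  permit termwise differentiation.\<close>

lemma ser_curve:
  assumes S: "open S" "convex S"
    and g: "\<And>n s. s \<in> S \<Longrightarrow> (g n has_real_derivative g' n s) (at s)"
    and gb: "\<And>n s. s \<in> S \<Longrightarrow> \<bar>g n s\<bar> \<le> K * B ^ n" "\<And>n s. s \<in> S \<Longrightarrow> \<bar>g' n s\<bar> \<le> K * B ^ n"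
    and R: "\<And>s. s \<in> S \<Longrightarrow> \<bar>x + s * d\<bar> \<le> R" and KB: "0 \<le> K" "0 \<le> B" and s: "s \<in> S"
  shows "((\<lambda>s. ser (\<lambda>n. g n s) (x + s * d)) has_real_derivative
     ser (\<lambda>n. g' n s + d * g (Suc n) s) (x + s * d)) (at s)"
proof -
  \<comment> \<open>The power rule turns \<open>1 / fact n\<close> into
    \<open>1 / fact (n - 1)\<close>, so this half of the derivative is a shifted series that starts
    at n = 1.\<close>
  define h where "h n s = (case n of 0 \<Rightarrow> 0 | Suc m \<Rightarrow> d * g (Suc m) s * (x + s * d) ^ m / fact m)"
    for n s
  define f' where "f' n s = g' n s * (x + s * d) ^ n / fact n + h n s" for n s
  have deriv: "((\<lambda>s. g n s * (x + s * d) ^ n / fact n) has_real_derivative f' n s) (at s within S)"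
    if "s \<in> S" for n s
  proof (cases n)
    case 0
    then show ?thesis
      using g[OF that, of 0] by (auto simp: f'_def h_def intro: has_field_derivative_at_within)
  next
    case (Suc m)
    have "((\<lambda>s. g n s * (x + s * d) ^ n / fact n) has_real_derivative
       (g' n s * (x + s * d) ^ n + (real n * (x + s * d) ^ (n - 1) * d) * g n s) / fact n) (at s)"
      by (rule DERIV_cdivide) (rule derivative_eq_intros g[OF that] refl | simp)+
    also have "(g' n s * (x + s * d) ^ n + (real n * (x + s * d) ^ (n - 1) * d) * g n s) / fact n = f' n s"
      unfolding f'_def h_def by (simp add: Suc field_simps del: of_nat_Suc)
    finally show ?thesis by (rule has_field_derivative_at_within)
  qed
  have gS: "\<bar>d * g (Suc m) s\<bar> \<le> (\<bar>d\<bar> * K * B) * B ^ m" if "s \<in> S" for m s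
    using mult_left_mono[OF gb(1)[OF that, of "Suc m"], of "\<bar>d\<bar>"] by (simp add: abs_mult mult_ac)
  define M where "M n = K * ((B * R) ^ n / fact n) +
     (case n of 0 \<Rightarrow> 0 | Suc m \<Rightarrow> (\<bar>d\<bar> * K * B) * ((B * R) ^ m / fact m))" for n
  have "norm (f' n s) \<le> M n" if "s \<in> S" for n s
  proof -
    have "norm (g' n s * (x + s * d) ^ n / fact n) \<le> K * ((B * R) ^ n / fact n)"
      by (intro ser_term_bound gb R that KB)
    moreover have "norm (h n s) \<le> (case n of 0 \<Rightarrow> 0 | Suc m \<Rightarrow> (\<bar>d\<bar> * K * B) * ((B * R) ^ m / fact m))"
      using ser_term_bound[OF gS[OF that] R[OF that]] KB by (cases n) (auto simp: h_def)
    ultimately show ?thesis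
      unfolding f'_def M_def by (intro order_trans[OF norm_triangle_ineq] add_mono)
  qed
  moreover have "summable (\<lambda>n. case n of 0 \<Rightarrow> 0 | Suc m \<Rightarrow> (\<bar>d\<bar> * K * B) * ((B * R) ^ m / fact m))"
    using summable_exp_majorant[of "\<bar>d\<bar> * K * B" "B * R"]
    by (subst summable_Suc_iff[symmetric]) simp
  then have "summable M"
    unfolding M_def by (intro summable_add summable_exp_majorant)
  ultimately have unif: "uniformly_convergent_on S (\<lambda>n x. \<Sum>i<n. f' i x)"
    by (rule Weierstrass_m_test')
  have gsum: "summable (\<lambda>n. g n s * (x + s * d) ^ n / fact n)"
    by (rule ser_summable[OF gb(1)[OF s] KB])
  have "((\<lambda>s. ser (\<lambda>n. g n s) (x + s * d)) has_real_derivative (\<Sum>n. f' n s)) (at s)"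
    unfolding ser_def
    by (rule has_field_derivative_series'(2)[OF S(2) deriv unif s gsum])
       (use S s in \<open>auto simp: interior_open\<close>)
  also have "(\<Sum>n. f' n s) = ser (\<lambda>n. g' n s + d * g (Suc n) s) (x + s * d)"
  proof -
    have h: "(\<lambda>m. d * g (Suc m) s * (x + s * d) ^ m / fact m) sums ser (\<lambda>n. d * g (Suc n) s) (x + s * d)"
      unfolding ser_def by (intro summable_sums ser_summable(1)[OF gS[OF s]]) (use KB in auto)
    then have "(\<lambda>n. h (Suc n) s) sums ser (\<lambda>n. d * g (Suc n) s) (x + s * d)"
      by (simp add: h_def)
    then have "(\<lambda>n. h n s) sums ser (\<lambda>n. d * g (Suc n) s) (x + s * d)"
      by (subst (asm) sums_Suc_iff) (simp add: h_def)
    moreover have "(\<lambda>n. g' n s * (x + s * d) ^ n / fact n) sums ser (\<lambda>n. g' n s) (x + s * d)"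
      unfolding ser_def by (intro summable_sums ser_summable(1)[OF gb(2)[OF s]] KB)
    ultimately have "(\<lambda>n. f' n s) sums (ser (\<lambda>n. g' n s) (x + s * d) + ser (\<lambda>n. d * g (Suc n) s) (x + s * d))"
      unfolding f'_def by (intro sums_add)
    moreover have "ser (\<lambda>n. g' n s + d * g (Suc n) s) (x + s * d)
       = ser (\<lambda>n. g' n s) (x + s * d) + ser (\<lambda>n. d * g (Suc n) s) (x + s * d)"
      using ser_linear[OF gb(2)[OF s] KB gS[OF s], of 1 1] KB by simp
    ultimately show ?thesis using sums_unique by metis
  qed
  finally show ?thesis .
qed

section \<open>Exponential power series in several variables\<close>

fun mser :: "real list \<Rightarrow> (nat list \<Rightarrow> real) \<Rightarrow> real" where
  "mser [] A = A []"
| "mser (x # xs) A = ser (\<lambda>n. mser xs (\<lambda>\<alpha>. A (n # \<alpha>))) x"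

text \<open>Geometric growth in the total index survives fixing the first index, at the cost of a
  factor \<open>B ^ i\<close> in K. Hence the inner series are again geometrically bounded in the
  outer index.\<close>

definition geo_bound :: "nat \<Rightarrow> real \<Rightarrow> real \<Rightarrow> (nat list \<Rightarrow> real) \<Rightarrow> bool" where
  "geo_bound n K B A \<longleftrightarrow> 0 \<le> K \<and> 0 \<le> B \<and> (\<forall>\<alpha>. length \<alpha> = n \<longrightarrow> \<bar>A \<alpha>\<bar> \<le> K * B ^ sum_list \<alpha>)"

definition geo :: "nat \<Rightarrow> (nat list \<Rightarrow> real) \<Rightarrow> bool" where
  "geo n A \<longleftrightarrow> (\<exists>K B. geo_bound n K B A)"

lemma geo_bound_Cons:
  "geo_bound (Suc n) K B A \<Longrightarrow> geo_bound n (K * B ^ i) B (\<lambda>\<alpha>. A (i # \<alpha>))"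
  unfolding geo_bound_def
proof (intro conjI allI impI)
  fix \<alpha> :: "nat list"
  assume *: "0 \<le> K \<and> 0 \<le> B \<and> (\<forall>\<alpha>. length \<alpha> = Suc n \<longrightarrow> \<bar>A \<alpha>\<bar> \<le> K * B ^ sum_list \<alpha>)" and "length \<alpha> = n"
  then have "\<bar>A (i # \<alpha>)\<bar> \<le> K * B ^ sum_list (i # \<alpha>)" by (metis length_Cons)
  then show "\<bar>A (i # \<alpha>)\<bar> \<le> K * B ^ i * B ^ sum_list \<alpha>" by (simp add: power_add mult_ac)
qed auto

lemma geo_bound_mono:
  assumes "geo_bound n K B A" "B \<le> B'" "K \<le> K'"
  shows "geo_bound n K' B' A"
  unfolding geo_bound_def
proof (intro conjI allI impI)
  fix \<alpha> :: "nat list" assume "length \<alpha> = n"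
  then have "\<bar>A \<alpha>\<bar> \<le> K * B ^ sum_list \<alpha>" using assms by (auto simp: geo_bound_def)
  also have "\<dots> \<le> K' * B' ^ sum_list \<alpha>"
    using assms by (intro mult_mono power_mono) (auto simp: geo_bound_def)
  finally show "\<bar>A \<alpha>\<bar> \<le> K' * B' ^ sum_list \<alpha>" .
qed (use assms in \<open>auto simp: geo_bound_def\<close>)

lemma geo_linear:
  assumes "geo n A" "geo n C"
  shows "geo n (\<lambda>\<alpha>. r * A \<alpha> + r' * C \<alpha>)"
proof -
  obtain K B K' B' where *: "geo_bound n K B A" "geo_bound n K' B' C"
    using assms by (auto simp: geo_def)
  define L where "L = max B B'"
  have A: "geo_bound n K L A" and C: "geo_bound n K' L C"
    using *[THEN geo_bound_mono] by (auto simp: L_def)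
  have "geo_bound n (\<bar>r\<bar> * K + \<bar>r'\<bar> * K') L (\<lambda>\<alpha>. r * A \<alpha> + r' * C \<alpha>)"
    unfolding geo_bound_def
  proof (intro conjI allI impI)
    fix \<alpha> :: "nat list" assume "length \<alpha> = n"
    then have "\<bar>r\<bar> * \<bar>A \<alpha>\<bar> \<le> \<bar>r\<bar> * (K * L ^ sum_list \<alpha>)" "\<bar>r'\<bar> * \<bar>C \<alpha>\<bar> \<le> \<bar>r'\<bar> * (K' * L ^ sum_list \<alpha>)"
      using A C by (auto simp: geo_bound_def intro!: mult_left_mono)
    moreover have "\<bar>r * A \<alpha> + r' * C \<alpha>\<bar> \<le> \<bar>r\<bar> * \<bar>A \<alpha>\<bar> + \<bar>r'\<bar> * \<bar>C \<alpha>\<bar>"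
      by (metis abs_mult abs_triangle_ineq)
    ultimately show "\<bar>r * A \<alpha> + r' * C \<alpha>\<bar> \<le> (\<bar>r\<bar> * K + \<bar>r'\<bar> * K') * L ^ sum_list \<alpha>"
      by (simp add: algebra_simps)
  qed (use A C in \<open>auto simp: geo_bound_def\<close>)
  then show ?thesis by (auto simp: geo_def)
qed

lemma mser_bound:
  "geo_bound (length xs) K B A \<Longrightarrow> \<bar>mser xs A\<bar> \<le> K * exp (B * sum_list (map abs xs))"
proof (induction xs arbitrary: A K)
  case Nil
  then show ?case by (auto simp: geo_bound_def)
next
  case (Cons x xs)
  have KB: "0 \<le> K" "0 \<le> B" using Cons.prems by (auto simp: geo_bound_def)
  have "\<bar>mser xs (\<lambda>\<alpha>. A (n # \<alpha>))\<bar> \<le> (K * exp (B * sum_list (map abs xs))) * B ^ n" for n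
    using Cons.IH[of "K * B ^ n" "\<lambda>\<alpha>. A (n # \<alpha>)"] geo_bound_Cons[of "length xs" K B A n] Cons.prems
    by (simp add: mult_ac)
  from ser_bound[OF this, of x] KB show ?case
    by (simp add: exp_add distrib_left mult_ac)
qed

lemma mser_coeff_bound:
  assumes "geo_bound (Suc (length xs)) K B A" "sum_list (map abs xs) \<le> R"
  shows "\<bar>mser xs (\<lambda>\<alpha>. A (n # \<alpha>))\<bar> \<le> (K * exp (B * R)) * B ^ n"
proof -
  have KB: "0 \<le> K" "0 \<le> B" using assms by (auto simp: geo_bound_def)
  have "\<bar>mser xs (\<lambda>\<alpha>. A (n # \<alpha>))\<bar> \<le> K * B ^ n * exp (B * sum_list (map abs xs))"
    using mser_bound[OF geo_bound_Cons[OF assms(1)]] .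
  also have "\<dots> \<le> K * B ^ n * exp (B * R)"
    using KB assms(2) by (intro mult_left_mono) (auto intro!: mult_left_mono)
  finally show ?thesis by (simp add: mult_ac)
qed

lemma mser_linear:
  "geo (length xs) A \<Longrightarrow> geo (length xs) C \<Longrightarrow>
    mser xs (\<lambda>\<alpha>. r * A \<alpha> + r' * C \<alpha>) = r * mser xs A + r' * mser xs C"
proof (induction xs arbitrary: A C)
  case Nil
  then show ?case by simp
next
  case (Cons x xs)
  obtain K B K' B' where *: "geo_bound (Suc (length xs)) K B A" "geo_bound (Suc (length xs)) K' B' C"
    using Cons.prems by (auto simp: geo_def)
  have "mser xs (\<lambda>\<alpha>. r * A (n # \<alpha>) + r' * C (n # \<alpha>))
     = r * mser xs (\<lambda>\<alpha>. A (n # \<alpha>)) + r' * mser xs (\<lambda>\<alpha>. C (n # \<alpha>))" for n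
    by (rule Cons.IH) (use *[THEN geo_bound_Cons] in \<open>auto simp: geo_def\<close>)
  then show ?case
    using ser_linear[OF mser_coeff_bound[OF *(1) order_refl] _ _ mser_coeff_bound[OF *(2) order_refl]]
      * by (simp add: geo_bound_def)
qed

text \<open>Compactness supplies bounds on the outer variable and on the inner series that are
  uniform on U, as the Weierstrass test demands.\<close>

lemma mser_continuous_on:
  assumes "compact U"
  shows "geo (length hs) A \<Longrightarrow> (\<And>h. h \<in> set hs \<Longrightarrow> continuous_on U h) \<Longrightarrow>
    continuous_on U (\<lambda>z. mser (map (\<lambda>h. h z) hs) A)"
proof (induction hs arbitrary: A)
  case Nil
  then show ?case by simp
next
  case (Cons h hs)
  obtain K B where *: "geo_bound (Suc (length hs)) K B A"
    using Cons.prems by (auto simp: geo_def)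
  have bdd: "\<exists>R. \<forall>z\<in>U. \<bar>f z\<bar> \<le> R" if "continuous_on U f" for f :: "'a \<Rightarrow> real"
    using compact_imp_bounded[OF compact_continuous_image[OF that assms]]
    by (auto simp: bounded_iff)
  have "continuous_on U (\<lambda>z. sum_list (map (\<lambda>h. \<bar>h z\<bar>) hs))"
    using Cons.prems(2) by (induction hs) (auto intro!: continuous_intros)
  then obtain R where R: "\<And>z. z \<in> U \<Longrightarrow> \<bar>sum_list (map (\<lambda>h. \<bar>h z\<bar>) hs)\<bar> \<le> R"
    using bdd by meson
  obtain R' where R': "\<And>z. z \<in> U \<Longrightarrow> \<bar>h z\<bar> \<le> R'"
    using bdd[of h] Cons.prems(2) by (meson list.set_intros(1))
  have "continuous_on U (\<lambda>z. ser (\<lambda>n. mser (map (\<lambda>h. h z) hs) (\<lambda>\<alpha>. A (n # \<alpha>))) (h z))"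
  proof (rule ser_continuous_on)
    show "continuous_on U (\<lambda>z. mser (map (\<lambda>h. h z) hs) (\<lambda>\<alpha>. A (n # \<alpha>)))" for n
      using * by (intro Cons.IH) (auto simp: geo_def dest: geo_bound_Cons intro: Cons.prems(2))
    show "\<bar>mser (map (\<lambda>h. h z) hs) (\<lambda>\<alpha>. A (n # \<alpha>))\<bar> \<le> (K * exp (B * R)) * B ^ n" if "z \<in> U" for n z
      using * R[OF that] by (intro mser_coeff_bound) (auto simp: comp_def)
    show "\<bar>h z\<bar> \<le> R'" if "z \<in> U" for z
      by (rule R') fact
  qed (use Cons.prems(2) * in \<open>auto simp: geo_bound_def\<close>)
  then show ?case by simp
qed

text \<open>The derivative in direction \<open>ds\<close> on the level of coefficients: a sum over
  the coordinates of speed times index shift. The second equation ends this sum with 0.\<close>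

fun mderiv :: "real list \<Rightarrow> (nat list \<Rightarrow> real) \<Rightarrow> nat list \<Rightarrow> real" where
  "mderiv (d # ds) A (n # \<alpha>) = mderiv ds (\<lambda>\<beta>. A (n # \<beta>)) \<alpha> + d * A (Suc n # \<alpha>)"
| "mderiv _ A _ = 0"

lemma geo_bound_mderiv:
  "geo_bound (length ds) K B A \<Longrightarrow> geo_bound (length ds) (K * B * sum_list (map abs ds)) B (mderiv ds A)"
proof (induction ds arbitrary: A K)
  case Nil
  then show ?case by (auto simp: geo_bound_def)
next
  case (Cons d ds)
  have KB: "0 \<le> K" "0 \<le> B" using Cons.prems by (auto simp: geo_bound_def)
  have sn: "0 \<le> sum_list (map abs ds)" by (induction ds) auto
  show ?case
    unfolding geo_bound_def
  proof (intro conjI allI impI)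
    fix \<alpha> :: "nat list" assume "length \<alpha> = length (d # ds)"
    then obtain n \<beta> where \<alpha>: "\<alpha> = n # \<beta>" "length \<beta> = length ds" by (cases \<alpha>) auto
    have "geo_bound (length ds) (K * B ^ n * B * sum_list (map abs ds)) B (mderiv ds (\<lambda>\<beta>. A (n # \<beta>)))"
      using Cons.IH[OF geo_bound_Cons] Cons.prems by simp
    then have "\<bar>mderiv ds (\<lambda>\<beta>. A (n # \<beta>)) \<beta>\<bar> \<le> K * B ^ n * B * sum_list (map abs ds) * B ^ sum_list \<beta>"
      using \<alpha> by (auto simp: geo_bound_def)
    moreover have "\<bar>A (Suc n # \<beta>)\<bar> \<le> K * B ^ sum_list (Suc n # \<beta>)"
      using Cons.prems \<alpha> unfolding geo_bound_def by (metis length_Cons)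
    then have "\<bar>d * A (Suc n # \<beta>)\<bar> \<le> \<bar>d\<bar> * (K * B ^ sum_list (Suc n # \<beta>))"
      by (simp add: abs_mult mult_left_mono)
    ultimately show "\<bar>mderiv (d # ds) A \<alpha>\<bar> \<le> K * B * sum_list (map abs (d # ds)) * B ^ sum_list \<alpha>"
      unfolding \<alpha> by (simp add: power_add algebra_simps)
  qed (use KB sn in auto)
qed

lemma geo_mderiv: "geo (length ds) A \<Longrightarrow> geo (length ds) (mderiv ds A)"
  using geo_bound_mderiv unfolding geo_def by blast

definition line :: "real list \<Rightarrow> real list \<Rightarrow> real \<Rightarrow> real list" where
  "line xs ds s = map2 (\<lambda>x d. x + s * d) xs ds"

text \<open>Induction over the coordinates, with the inner series as moving coefficients in
  \<open>ser_curve\<close>. The bounded interval of parameters gives the uniform bounds.\<close>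

lemma mser_line_deriv:
  assumes "length xs = length ds" "s \<in> {-r<..<r}"
  shows "geo (length xs) A \<Longrightarrow>
    ((\<lambda>s. mser (line xs ds s) A) has_real_derivative mser (line xs ds s) (mderiv ds A)) (at s)"
  using assms
proof (induction xs ds arbitrary: A s rule: list_induct2)
  case Nil
  then show ?case by (simp add: line_def)
next
  case (Cons x xs d ds)
  have line: "line (x # xs) (d # ds) s = (x + s * d) # line xs ds s" for s
    by (simp add: line_def)
  obtain K0 B where *: "geo_bound (Suc (length xs)) K0 B A"
    using Cons.prems by (auto simp: geo_def)
  have KB: "0 \<le> K0" "0 \<le> B" using * by (auto simp: geo_bound_def)
  define R where "R = sum_list (map abs xs) + r * sum_list (map abs ds)"
  have R: "sum_list (map abs (line xs ds s)) \<le> R" if "s \<in> {-r<..<r}" for s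
    using \<open>length xs = length ds\<close> unfolding R_def line_def
  proof (induction xs ds rule: list_induct2)
    case (Cons x xs d ds)
    have "\<bar>x + s * d\<bar> \<le> \<bar>x\<bar> + \<bar>s * d\<bar>" by (rule abs_triangle_ineq)
    also have "\<bar>s * d\<bar> \<le> r * \<bar>d\<bar>" unfolding abs_mult using that by (intro mult_right_mono) auto
    finally show ?case using Cons by (simp add: algebra_simps)
  qed auto
  \<comment> \<open>\<open>ser_curve\<close> asks for one constant that serves both the coefficients
    and their derivatives.\<close>
  define K where "K = max (K0 * exp (B * R)) (K0 * B * sum_list (map abs ds) * exp (B * R))"
  have len: "length (line xs ds s) = length xs" "length (line xs ds s) = length ds" for s
    using \<open>length xs = length ds\<close> by (auto simp: line_def)
  have geoC: "geo (length xs) (\<lambda>\<alpha>. A (n # \<alpha>))" for n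
    using geo_bound_Cons[OF *] by (auto simp: geo_def)
  have b1: "\<bar>mser (line xs ds s) (\<lambda>\<alpha>. A (n # \<alpha>))\<bar> \<le> K * B ^ n" if "s \<in> {-r<..<r}" for n s
  proof -
    have "\<bar>mser (line xs ds s) (\<lambda>\<alpha>. A (n # \<alpha>))\<bar> \<le> (K0 * exp (B * R)) * B ^ n"
      by (rule mser_coeff_bound) (use * R[OF that] len in auto)
    also have "\<dots> \<le> K * B ^ n" unfolding K_def using KB by (intro mult_right_mono) auto
    finally show ?thesis .
  qed
  have b2: "\<bar>mser (line xs ds s) (mderiv ds (\<lambda>\<alpha>. A (n # \<alpha>)))\<bar> \<le> K * B ^ n" if "s \<in> {-r<..<r}" for n s
  proof -
    have nn: "0 \<le> sum_list (map abs ds)" by (induction ds) auto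
    have "geo_bound (length ds) (K0 * B ^ n * B * sum_list (map abs ds)) B (mderiv ds (\<lambda>\<alpha>. A (n # \<alpha>)))"
      using * \<open>length xs = length ds\<close> by (intro geo_bound_mderiv geo_bound_Cons) simp
    then have "\<bar>mser (line xs ds s) (mderiv ds (\<lambda>\<alpha>. A (n # \<alpha>)))\<bar>
        \<le> (K0 * B ^ n * B * sum_list (map abs ds)) * exp (B * sum_list (map abs (line xs ds s)))"
      by (intro mser_bound) (use len in auto)
    also have "\<dots> \<le> (K0 * B ^ n * B * sum_list (map abs ds)) * exp (B * R)"
      using KB R[OF that] nn by (intro mult_left_mono) (auto intro!: mult_left_mono)
    also have "\<dots> = (K0 * B * sum_list (map abs ds) * exp (B * R)) * B ^ n"
      by (simp add: mult_ac)
    also have "\<dots> \<le> K * B ^ n" unfolding K_def using KB by (intro mult_right_mono) auto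
    finally show ?thesis .
  qed
  have "((\<lambda>s. ser (\<lambda>n. mser (line xs ds s) (\<lambda>\<alpha>. A (n # \<alpha>))) (x + s * d)) has_real_derivative
      ser (\<lambda>n. mser (line xs ds s) (mderiv ds (\<lambda>\<alpha>. A (n # \<alpha>)))
        + d * mser (line xs ds s) (\<lambda>\<alpha>. A (Suc n # \<alpha>))) (x + s * d)) (at s)"
  proof (rule ser_curve[where S = "{-r<..<r}" and K = K and B = B and R = "\<bar>x\<bar> + r * \<bar>d\<bar>"])
    show "((\<lambda>s. mser (line xs ds s) (\<lambda>\<alpha>. A (n # \<alpha>))) has_real_derivative
        mser (line xs ds s) (mderiv ds (\<lambda>\<alpha>. A (n # \<alpha>)))) (at s)" if "s \<in> {-r<..<r}" for n s
      by (rule Cons.IH[OF geoC that])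
    fix s assume "s \<in> {-r<..<r}"
    have "\<bar>x + s * d\<bar> \<le> \<bar>x\<bar> + \<bar>s * d\<bar>" by (rule abs_triangle_ineq)
    also have "\<bar>s * d\<bar> \<le> r * \<bar>d\<bar>" unfolding abs_mult using \<open>s \<in> {-r<..<r}\<close> by (intro mult_right_mono) auto
    finally show "\<bar>x + s * d\<bar> \<le> \<bar>x\<bar> + r * \<bar>d\<bar>" by simp
  qed (use Cons.prems b1 b2 KB in \<open>auto simp: K_def le_max_iff_disj\<close>)
  moreover have "mser (line xs ds s) (mderiv ds (\<lambda>\<alpha>. A (n # \<alpha>)))
        + d * mser (line xs ds s) (\<lambda>\<alpha>. A (Suc n # \<alpha>))
      = mser (line xs ds s) (\<lambda>\<alpha>. mderiv (d # ds) A (n # \<alpha>))" for n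
    using mser_linear[of "line xs ds s" "mderiv ds (\<lambda>\<alpha>. A (n # \<alpha>))" "\<lambda>\<alpha>. A (Suc n # \<alpha>)" 1 d]
      geoC geo_mderiv[of ds "\<lambda>\<alpha>. A (n # \<alpha>)"] \<open>length xs = length ds\<close> len
    by simp
  ultimately show ?case by (simp add: line)
qed

lemma mser_cong:
  "(\<And>\<alpha>. length \<alpha> = length xs \<Longrightarrow> A \<alpha> = C \<alpha>) \<Longrightarrow> mser xs A = mser xs C"
proof (induction xs arbitrary: A C)
  case (Cons x xs)
  then have "mser xs (\<lambda>\<alpha>. A (n # \<alpha>)) = mser xs (\<lambda>\<alpha>. C (n # \<alpha>))" for n
    by (intro Cons.IH) auto
  then show ?case by simp
qed auto

lemma geo_cong:
  "geo n A \<Longrightarrow> (\<And>\<alpha>. length \<alpha> = n \<Longrightarrow> A \<alpha> = C \<alpha>) \<Longrightarrow> geo n C"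
  unfolding geo_def geo_bound_def by metis

section \<open>Series in octant coordinates\<close>

type_synonym coeffs = "nat \<Rightarrow> nat \<Rightarrow> nat \<Rightarrow> nat \<Rightarrow> real"

definition on_list :: "coeffs \<Rightarrow> nat list \<Rightarrow> real" where
  "on_list A \<alpha> = A (\<alpha> ! 0) (\<alpha> ! 1) (\<alpha> ! 2) (\<alpha> ! 3)"

text \<open>For \<open>e\<close> the sign vector of \<open>v\<close> these are \<open>\<bar>v\<^sub>i\<bar> / c\<close> and \<open>(t - \<bar>v\<bar>\<^sub>1 / c) / 2\<close>.\<close>

definition wcoord :: "real \<Rightarrow> real ^ 3 \<Rightarrow> real \<Rightarrow> real ^ 3 \<Rightarrow> real list" where
  "wcoord c e t v = [e $ 1 * v $ 1 / c, e $ 2 * v $ 2 / c, e $ 3 * v $ 3 / c,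
     (t - (e $ 1 * v $ 1 + e $ 2 * v $ 2 + e $ 3 * v $ 3) / c) / 2]"

text \<open>The exponential factor absorbs l: its derivative cancels the term \<open>l * u\<close>
  of \<open>damped_dt\<close>, which then acts on the series alone.\<close>

definition kfield :: "real \<Rightarrow> real \<Rightarrow> real ^ 3 \<Rightarrow> coeffs \<Rightarrow> field" where
  "kfield l c e A t v = exp (- l * t) * mser (wcoord c e t v) (on_list A)"

text \<open>\<open>Tc\<close> and \<open>Xc\<close> are the actions of \<open>\<partial>\<^sub>t + l\<close> and \<open>\<partial>\<^sub>i\<close> on the coefficients.\<close>

definition Tc :: "coeffs \<Rightarrow> coeffs" where
  "Tc A i j k m = A i j k (Suc m) / 2"

definition Sc :: "3 \<Rightarrow> coeffs \<Rightarrow> coeffs" where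
  "Sc n A i j k m = (if n = 1 then A (Suc i) j k m else if n = 2 then A i (Suc j) k m else A i j (Suc k) m)"

definition Xc :: "real \<Rightarrow> real ^ 3 \<Rightarrow> 3 \<Rightarrow> coeffs \<Rightarrow> coeffs" where
  "Xc c e n A i j k m = e $ n / c * (Sc n A i j k m - A i j k (Suc m) / 2)"

lemma length_wcoord [simp]: "length (wcoord c e t v) = 4"
  by (simp add: wcoord_def)

lemma length_4_ex: "length \<alpha> = 4 \<Longrightarrow> \<exists>i j k m. \<alpha> = [i, j, k, m]"
  by (auto simp: numeral_eq_Suc length_Suc_conv)

lemma on_list_4 [simp]: "on_list A [i, j, k, m] = A i j k m"
  by (simp add: on_list_def)

text \<open>The rates of change of the entries of \<open>wcoord\<close> when v moves along axis n.
  The last entry contains half of the scaled l1-norm with a minus sign.\<close>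

definition xdir :: "real \<Rightarrow> real ^ 3 \<Rightarrow> 3 \<Rightarrow> real list" where
  "xdir c e n = [if n = 1 then e $ 1 / c else 0, if n = 2 then e $ 2 / c else 0,
     if n = 3 then e $ 3 / c else 0, - (e $ n / c) / 2]"

lemma mderiv_tdir:
  "length \<alpha> = 4 \<Longrightarrow> mderiv [0, 0, 0, 1/2] (on_list A) \<alpha> = on_list (Tc A) \<alpha>"
  by (auto dest!: length_4_ex simp: Tc_def)

lemma mderiv_xdir:
  "length \<alpha> = 4 \<Longrightarrow> mderiv (xdir c e n) (on_list A) \<alpha> = on_list (Xc c e n A) \<alpha>"
  using exhaust_3[of n] by (auto dest!: length_4_ex simp: Xc_def Sc_def xdir_def algebra_simps)

lemma geo_Tc: "geo 4 (on_list A) \<Longrightarrow> geo 4 (on_list (Tc A))"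
  by (rule geo_cong[OF _ mderiv_tdir]) (use geo_mderiv[of "[0, 0, 0, 1/2]" "on_list A"] in \<open>auto simp: numeral_eq_Suc\<close>)

lemma length_xdir [simp]: "length (xdir c e n) = 4"
  by (simp add: xdir_def)

lemma geo_Xc: "geo 4 (on_list A) \<Longrightarrow> geo 4 (on_list (Xc c e n A))"
  by (rule geo_cong[OF _ mderiv_xdir]) (use geo_mderiv[of "xdir c e n" "on_list A"] in auto)

lemma on_list_linear: "on_list (\<lambda>i j k m. r * A i j k m + r' * C i j k m) = (\<lambda>\<alpha>. r * on_list A \<alpha> + r' * on_list C \<alpha>)"
  by (auto simp: on_list_def)

lemma geo_lin: "geo 4 (on_list A) \<Longrightarrow> geo 4 (on_list C) \<Longrightarrow>
    geo 4 (on_list (\<lambda>i j k m. r * A i j k m + r' * C i j k m))"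
  by (simp add: on_list_linear geo_linear)

lemma kfield_linear:
  assumes "geo 4 (on_list A)" "geo 4 (on_list C)"
  shows "kfield l c e (\<lambda>i j k m. r * A i j k m + r' * C i j k m) t v
     = r * kfield l c e A t v + r' * kfield l c e C t v"
  using mser_linear[of "wcoord c e t v" "on_list A" "on_list C" r r'] assms
  by (simp add: kfield_def on_list_linear algebra_simps)

text \<open>The term with - l stems from the exponential factor. The factors 1 and - l are written
  out to match the shape of \<open>kfield_linear\<close> and \<open>geo_lin\<close>.\<close>

lemma kfield_deriv_t:
  assumes "geo 4 (on_list A)"
  shows "((\<lambda>s. kfield l c e A s v) has_real_derivative
     kfield l c e (\<lambda>i j k m. 1 * Tc A i j k m + (- l) * A i j k m) t v) (at t)"
proof -
  define x0 where "x0 = wcoord c e 0 v"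
  have w: "wcoord c e s v = line x0 [0, 0, 0, 1/2] s" for s
    by (simp add: x0_def wcoord_def line_def diff_divide_distrib)
  have *: "((\<lambda>s. mser (wcoord c e s v) (on_list A)) has_real_derivative
      mser (wcoord c e t v) (mderiv [0, 0, 0, 1/2] (on_list A))) (at t)"
    unfolding w by (rule mser_line_deriv[where r = "\<bar>t\<bar> + 1"]) (use assms in \<open>auto simp: x0_def\<close>)
  have eq: "mser (wcoord c e t v) (mderiv [0, 0, 0, 1/2] (on_list A)) = mser (wcoord c e t v) (on_list (Tc A))"
    by (rule mser_cong) (simp add: mderiv_tdir)
  have "((\<lambda>s. exp (- l * s)) has_real_derivative exp (- l * t) * (- l)) (at t)"
    by (auto intro!: derivative_eq_intros)
  from DERIV_mult[OF this *[unfolded eq]] show ?thesis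
    unfolding kfield_linear[OF geo_Tc[OF assms] assms]
    by (simp add: kfield_def algebra_simps)
qed

lemma kfield_deriv_x:
  assumes "geo 4 (on_list A)"
  shows "((\<lambda>h. kfield l c e A t (v + h *\<^sub>R axis n 1)) has_real_derivative
     kfield l c e (Xc c e n A) t v) (at 0)"
proof -
  have w: "wcoord c e t (v + h *\<^sub>R axis n 1) = line (wcoord c e t v) (xdir c e n) h" for h
    using exhaust_3[of n] by (auto simp: wcoord_def line_def xdir_def axis_def divide_simps algebra_simps)
  have l0: "line (wcoord c e t v) (xdir c e n) 0 = wcoord c e t v"
    using w[of 0] by simp
  have *: "((\<lambda>h. mser (wcoord c e t (v + h *\<^sub>R axis n 1)) (on_list A)) has_real_derivative
      mser (line (wcoord c e t v) (xdir c e n) 0) (mderiv (xdir c e n) (on_list A))) (at 0)"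
    unfolding w by (rule mser_line_deriv[where r = 1]) (use assms in \<open>auto simp: xdir_def\<close>)
  have eq: "mser (wcoord c e t v) (mderiv (xdir c e n) (on_list A)) = mser (wcoord c e t v) (on_list (Xc c e n A))"
    by (rule mser_cong) (simp add: mderiv_xdir)
  show ?thesis
    unfolding kfield_def by (rule DERIV_cmult[OF *[unfolded l0 eq]])
qed

lemma pdt_kfield:
  "geo 4 (on_list A) \<Longrightarrow> pdt (kfield l c e A) = kfield l c e (\<lambda>i j k m. 1 * Tc A i j k m + (- l) * A i j k m)"
  unfolding pdt_def by (intro ext DERIV_imp_deriv kfield_deriv_t)

lemma pdx_kfield: "geo 4 (on_list A) \<Longrightarrow> pdx n (kfield l c e A) = kfield l c e (Xc c e n A)"
  unfolding pdx_def by (intro ext DERIV_imp_deriv kfield_deriv_x)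

lemma damped_kfield: "geo 4 (on_list A) \<Longrightarrow> damped_dt l (kfield l c e A) = kfield l c e (Tc A)"
  by (intro ext, subst damped_dt_def, subst pdt_kfield, assumption,
      subst kfield_linear[OF geo_Tc]) auto

lemma geo_Tc_funpow: "geo 4 (on_list A) \<Longrightarrow> geo 4 (on_list ((Tc ^^ n) A))"
  by (induction n) (auto intro: geo_Tc)

text \<open>The series converges everywhere, so no octant enters. Uniform bounds exist on compact
  balls, and continuity at every centre suffices.\<close>

lemma kfield_continuous:
  assumes "geo 4 (on_list A)"
  shows "continuous_on U (\<lambda>(t, v). kfield l c e A t v)"
proof -
  define hs :: "(real \<times> (real ^ 3) \<Rightarrow> real) list" where
    "hs = [\<lambda>p. e $ 1 * snd p $ 1 / c, \<lambda>p. e $ 2 * snd p $ 2 / c, \<lambda>p. e $ 3 * snd p $ 3 / c,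
     \<lambda>p. (fst p - (e $ 1 * snd p $ 1 + e $ 2 * snd p $ 2 + e $ 3 * snd p $ 3) / c) / 2]"
  have eq: "(\<lambda>(t, v). kfield l c e A t v) = (\<lambda>p. exp (- l * fst p) * mser (map (\<lambda>h. h p) hs) (on_list A))"
    by (auto simp: kfield_def hs_def wcoord_def)
  have len: "length hs = 4" by (simp add: hs_def)
  have hs: "continuous_on S h" if "h \<in> set hs" for h S
    using that unfolding hs_def divide_inverse list.set
    by (elim insertE emptyE; hypsubst; intro continuous_intros)
  have m: "continuous_on (cball p 1) (\<lambda>z. mser (map (\<lambda>h. h z) hs) (on_list A))" for p
    by (rule mser_continuous_on[OF compact_cball _ hs]) (use assms in \<open>auto simp: len\<close>)
  have *: "continuous_on (cball p 1) (\<lambda>(t, v). kfield l c e A t v)" for p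
    unfolding eq by (rule continuous_on_mult[OF _ m]) (intro continuous_intros)
  have "isCont (\<lambda>(t, v). kfield l c e A t v) p" for p
    by (rule continuous_on_interior[OF *[of p]]) simp
  then show ?thesis by (simp add: continuous_at_imp_continuous_on)
qed

text \<open>Both kinds of partial derivative lead to fields of the same form with geometrically
  bounded coefficients, so the induction closes at every order.\<close>

lemma Ck_on_kfield: "geo 4 (on_list A) \<Longrightarrow> Ck_on k U (kfield l c e A)"
proof (induction k arbitrary: A)
  case 0
  then show ?case by (simp add: kfield_continuous)
next
  case (Suc k)
  have "(\<lambda>s. kfield l c e A s v) differentiable (at t)"
    "(\<lambda>h. kfield l c e A t (v + h *\<^sub>R axis i 1)) differentiable (at 0)" for t v i
    using kfield_deriv_t[OF Suc.prems] kfield_deriv_x[OF Suc.prems]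
    unfolding has_field_derivative_def differentiable_def by blast+
  then show ?case
    using Suc.IH[OF geo_lin[OF geo_Tc[OF Suc.prems] Suc.prems]] Suc.IH[OF geo_Xc[OF Suc.prems]]
      kfield_continuous[OF Suc.prems]
    unfolding Ck_on.simps pdt_kfield[OF Suc.prems] pdx_kfield[OF Suc.prems] split_beta
    by (intro conjI allI ballI)
qed

section \<open>Locality of the differential operators and gluing over open covers\<close>

lemma open_slice_t:
  fixes U :: "(real \<times> (real ^ 3)) set"
  assumes "open U" "(t, v) \<in> U"
  shows "eventually (\<lambda>s. (s, v) \<in> U) (nhds t)"
proof -
  have "((\<lambda>s. (s, v)) \<longlongrightarrow> (t, v)) (nhds t)" by (intro tendsto_intros filterlim_ident)
  then show ?thesis using assms by (simp add: tendsto_def)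
qed

lemma open_slice_x:
  fixes U :: "(real \<times> (real ^ 3)) set"
  assumes "open U" "(t, v) \<in> U"
  shows "eventually (\<lambda>h. (t, v + h *\<^sub>R w) \<in> U) (nhds 0)"
proof -
  have "((\<lambda>h. (t, v + h *\<^sub>R w)) \<longlongrightarrow> (t, v + 0 *\<^sub>R w)) (nhds 0)"
    by (intro tendsto_intros filterlim_ident)
  then show ?thesis using assms by (simp add: tendsto_def)
qed

definition agree_on :: "(real \<times> (real ^ 3)) set \<Rightarrow> field \<Rightarrow> field \<Rightarrow> bool" where
  "agree_on U u w \<longleftrightarrow> (\<forall>t v. (t, v) \<in> U \<longrightarrow> u t v = w t v)"

lemma agree_onI: "(\<And>t v. (t, v) \<in> U \<Longrightarrow> u t v = w t v) \<Longrightarrow> agree_on U u w"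
  and agree_onD: "agree_on U u w \<Longrightarrow> (t, v) \<in> U \<Longrightarrow> u t v = w t v"
  by (auto simp: agree_on_def)

lemma agree_slices:
  assumes "open U" "agree_on U u w" "(t, v) \<in> U"
  shows "eventually (\<lambda>s. u s v = w s v) (nhds t)"
    "eventually (\<lambda>h. u t (v + h *\<^sub>R z) = w t (v + h *\<^sub>R z)) (nhds 0)"
  using open_slice_t[OF assms(1,3)] open_slice_x[OF assms(1,3), of z]
  by (auto elim!: eventually_mono intro: agree_onD[OF assms(2)])

lemma agree_pdt: "open U \<Longrightarrow> agree_on U u w \<Longrightarrow> agree_on U (pdt u) (pdt w)"
  unfolding pdt_def by (rule agree_onI, rule deriv_cong_ev, rule agree_slices(1)) auto

lemma agree_pdx: "open U \<Longrightarrow> agree_on U u w \<Longrightarrow> agree_on U (pdx i u) (pdx i w)"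
  unfolding pdx_def by (rule agree_onI, rule deriv_cong_ev, rule agree_slices(2)) auto

lemma agree_funpow:
  assumes "\<And>u w. agree_on U u w \<Longrightarrow> agree_on U (F u) (F w)"
  shows "agree_on U u w \<Longrightarrow> agree_on U ((F ^^ n) u) ((F ^^ n) w)"
  by (induction n) (auto intro: assms)

lemma agree_damped: "open U \<Longrightarrow> agree_on U u w \<Longrightarrow> agree_on U (damped_dt l u) (damped_dt l w)"
  by (rule agree_onI) (simp add: damped_dt_def agree_onD[OF agree_pdt] agree_onD)

lemma agree_pdx2: "open U \<Longrightarrow> agree_on U u w \<Longrightarrow> agree_on U ((pdx i ^^ 2) u) ((pdx i ^^ 2) w)"
  by (intro agree_funpow agree_pdx)

lemma agree_laplacian: "open U \<Longrightarrow> agree_on U u w \<Longrightarrow> agree_on U (laplacian u) (laplacian w)"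
  unfolding laplacian_def
  by (rule agree_onI, rule sum.cong[OF refl], rule agree_onD[OF agree_pdx2])

lemma agree_mixed_fourth: "open U \<Longrightarrow> agree_on U u w \<Longrightarrow> agree_on U (mixed_fourth u) (mixed_fourth w)"
  unfolding mixed_fourth_def
  by (rule agree_onI) (simp add: agree_onD[OF agree_pdx2[OF _ agree_pdx2]])

lemma agree_mixed_sixth: "open U \<Longrightarrow> agree_on U u w \<Longrightarrow> agree_on U (mixed_sixth u) (mixed_sixth w)"
  unfolding mixed_sixth_def by (intro agree_pdx2)

lemma agree_continuous_on:
  assumes "agree_on U u w" "continuous_on U (\<lambda>(t, v). u t v)"
  shows "continuous_on U (\<lambda>(t, v). w t v)"
  by (rule continuous_on_eq[OF assms(2)]) (use assms(1) in \<open>auto intro: agree_onD\<close>)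

lemma eventually_nhds_x_imp_at_x: "eventually P (nhds x) \<Longrightarrow> eventually P (at x)"
  unfolding eventually_at_filter by (erule eventually_mono) simp

lemma differentiable_cong_ev:
  fixes f g :: "real \<Rightarrow> real"
  assumes "eventually (\<lambda>s. f s = g s) (nhds x)" "f differentiable (at x)"
  shows "g differentiable (at x)"
proof -
  obtain D where "(f has_derivative D) (at x)" using assms by (auto simp: differentiable_def)
  then have "(g has_derivative D) (at x)"
    using has_derivative_transform_eventually[OF _ eventually_nhds_x_imp_at_x[OF assms(1)]
        eventually_nhds_x_imp_x[OF assms(1)]] by blast
  then show ?thesis by (auto simp: differentiable_def)
qed

lemma Ck_on_cong:
  assumes "open U"
  shows "agree_on U u w \<Longrightarrow> Ck_on k U u \<Longrightarrow> Ck_on k U w"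
proof (induction k arbitrary: u w)
  case 0
  then show ?case using agree_continuous_on[of U u w] by simp
next
  case (Suc k)
  have "continuous_on U (\<lambda>(t, v). w t v)"
    using Suc.prems agree_continuous_on[of U u w] by simp
  moreover have "(\<lambda>s. w s v) differentiable (at t)" if "(t, v) \<in> U" for t v
  proof -
    have "(\<lambda>s. u s v) differentiable (at t)" using Suc.prems that by auto
    then show ?thesis
      by (rule differentiable_cong_ev[OF agree_slices(1)[OF assms Suc.prems(1) that]])
  qed
  moreover have "(\<lambda>h. w t (v + h *\<^sub>R axis i 1)) differentiable (at 0)" if "(t, v) \<in> U" for t v i
  proof -
    have "(\<lambda>h. u t (v + h *\<^sub>R axis i 1)) differentiable (at 0)" using Suc.prems that by auto
    then show ?thesis
      by (rule differentiable_cong_ev[OF agree_slices(2)[OF assms Suc.prems(1) that, of "axis i 1"]])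
  qed
  moreover have "Ck_on k U (pdt w)"
    by (rule Suc.IH[OF agree_pdt[OF assms Suc.prems(1)]]) (use Suc.prems in auto)
  moreover have "Ck_on k U (pdx i w)" for i
    by (rule Suc.IH[OF agree_pdx[OF assms Suc.prems(1)]]) (use Suc.prems in auto)
  ultimately show ?case by auto
qed

lemma Ck_on_UN:
  assumes "\<And>i. i \<in> I \<Longrightarrow> open (U i)"
  shows "(\<And>i. i \<in> I \<Longrightarrow> Ck_on k (U i) u) \<Longrightarrow> Ck_on k (\<Union>i\<in>I. U i) u"
proof (induction k arbitrary: u)
  case 0
  then show ?case using continuous_on_open_UN[of I U "\<lambda>(t, v). u t v"] assms by simp
next
  case (Suc k)
  have *: "continuous_on (U i) (\<lambda>(t, v). u t v)" "Ck_on k (U i) (pdt u)" "Ck_on k (U i) (pdx j u)"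
    "(t, v) \<in> U i \<Longrightarrow> (\<lambda>s. u s v) differentiable (at t)"
    "(t, v) \<in> U i \<Longrightarrow> (\<lambda>h. u t (v + h *\<^sub>R axis j 1)) differentiable (at 0)" if "i \<in> I" for i j t v
    using Suc.prems[OF that] unfolding Ck_on.simps by (simp_all add: Ball_def split_beta)
  have "continuous_on (\<Union>i\<in>I. U i) (\<lambda>(t, v). u t v)"
    using continuous_on_open_UN[of I U "\<lambda>(t, v). u t v"] assms *(1) by simp
  moreover have "Ck_on k (\<Union>i\<in>I. U i) (pdt u)" "Ck_on k (\<Union>i\<in>I. U i) (pdx j u)" for j
    by (rule Suc.IH, erule *(2), rule Suc.IH, erule *(3))
  ultimately show ?case
    unfolding Ck_on.simps split_beta
    by (intro conjI allI ballI) (auto simp only: UN_iff prod.collapse intro: *(4,5)[of _ "fst _" "snd _"])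
qed

section \<open>Carlitz words and the coefficients of the density\<close>

text \<open>The number of words with \<open>a\<close>, \<open>b\<close>, \<open>c\<close> letters of three kinds, no two adjacent letters equal, ending in the first kind.\<close>

function carlitz :: "nat \<Rightarrow> nat \<Rightarrow> nat \<Rightarrow> nat" where
  "carlitz 0 b c = 0"
| "carlitz (Suc a) b c = (if a = 0 \<and> b = 0 \<and> c = 0 then 1 else carlitz b a c + carlitz c a b)"
  by pat_completeness auto
termination by (relation "Wellfounded.measure (\<lambda>(a, b, c). a + b + c)") auto

lemma carlitz_commute: "carlitz a b c = carlitz a c b"
  by (cases a) auto

lemma carlitz_le: "carlitz a b c \<le> 2 ^ (a + b + c)"
proof (induction a b c rule: carlitz.induct)
  case (2 a b c)
  show ?case
  proof (cases "a = 0 \<and> b = 0 \<and> c = 0")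
    case False
    then show ?thesis using 2[OF False] by (simp add: add_ac)
  qed simp
qed simp

definition words :: "nat \<Rightarrow> nat \<Rightarrow> nat \<Rightarrow> nat" where
  "words a b c = carlitz a b c + carlitz b a c + carlitz c a b"

lemma words_le: "words a b c \<le> 3 * 2 ^ (a + b + c)"
  using carlitz_le[of a b c] carlitz_le[of b a c] carlitz_le[of c a b]
  by (simp add: words_def add_ac)

text \<open>Carlitz words have the generating function 1 / (1 - x/(1+x) - y/(1+y) - z/(1+z)) =
  (1+x)(1+y)(1+z) / (1 - xy - xz - yz - 2xyz), and the denominator is the recurrence. Among
  monomials divisible by xyz the numerator contributes only at xyz itself; this is the excluded case
  a = b = c = 0, where moreover the empty word would have to be counted, while
  \<open>words 0 0 0\<close> is 0.\<close>

lemma words_rec: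
  assumes "a + b + c > 0"
  shows "words (Suc a) (Suc b) (Suc c) = words (Suc a) b c + words a (Suc b) c + words a b (Suc c) + 2 * words a b c"
  using assms carlitz_commute[of a c b] carlitz_commute[of b c a] carlitz_commute[of c b a]
    carlitz_commute[of a b c] carlitz_commute[of b a c] carlitz_commute[of c a b]
    carlitz_commute[of a c "Suc b"] carlitz_commute[of b c "Suc a"] carlitz_commute[of c b "Suc a"]
  by (auto simp: words_def)

section \<open>Coefficient arrays built from a weight\<close>

type_synonym weight = "nat \<Rightarrow> nat \<Rightarrow> nat \<Rightarrow> real"

text \<open>The coefficient with which \<open>Wop z w i\<close> and p factors
  \<open>Iop (z + w)\<close> occur in the power \<open>Suc (i + p)\<close> of
  \<open>Zop z w\<close>: put k = i + p and s = p into the binomial of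
  \<open>Zop_funpow_Suc\<close>.\<close>

definition ballot :: "nat \<Rightarrow> nat \<Rightarrow> real" where
  "ballot i p = real ((i + 2 * p) choose p)"

lemma ballot_0 [simp]: "ballot i 0 = 1"
  by (simp add: ballot_def)

lemma ballot_rec: "ballot (Suc i) (Suc p) = ballot i (Suc p) + ballot (Suc (Suc i)) p"
  by (simp add: ballot_def)

lemma ballot_nonneg [simp]: "0 \<le> ballot i p"
  by (simp add: ballot_def)

lemma ballot_le: "ballot i p \<le> 2 ^ (i + 2 * p)"
  unfolding ballot_def using binomial_le_pow2[of "i + 2 * p" p] by (metis of_nat_le_iff of_nat_numeral of_nat_power)

definition comp3 :: "nat \<Rightarrow> (nat \<times> nat \<times> nat) set" where
  "comp3 M = {(p, q, r). p + q + r = M}"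

lemma comp3_subset: "comp3 M \<subseteq> {..M} \<times> {..M} \<times> {..M}"
  by (auto simp: comp3_def)

lemma finite_comp3 [simp]: "finite (comp3 M)"
  by (rule finite_subset[OF comp3_subset]) auto

lemma card_comp3: "card (comp3 M) \<le> (M + 1) ^ 3"
  using card_mono[OF _ comp3_subset, of M] by (simp add: card_cartesian_product power3_eq_cube algebra_simps)

definition cterm :: "weight \<Rightarrow> nat \<Rightarrow> nat \<Rightarrow> nat \<Rightarrow> nat \<times> nat \<times> nat \<Rightarrow> real" where
  "cterm a i j k = (\<lambda>(p, q, r). a (i + p) (j + q) (k + r) * (ballot i p * ballot j q * ballot k r))"

definition comps :: "weight \<Rightarrow> nat \<Rightarrow> nat \<Rightarrow> nat \<Rightarrow> nat \<Rightarrow> real" where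
  "comps a i j k M = sum (cterm a i j k) (comp3 M)"

definition sh :: "3 \<Rightarrow> weight \<Rightarrow> weight" where
  "sh n a i j k = (if n = 1 then a (Suc i) j k else if n = 2 then a i (Suc j) k else a i j (Suc k))"

text \<open>Split the compositions by whether the part p of the axis concerned is 0. Terms with p =
  0 agree because \<open>ballot _ 0\<close> is 1. For p > 0 the subtracted sum, reindexed by one, is
  removed by Pascal's rule in the form \<open>ballot_rec\<close>.\<close>

lemma comps_step:
  "comps a (Suc i) j k (Suc M) - comps a (Suc (Suc i)) j k M = comps (sh 1 a) i j k (Suc M)"
  "comps a i (Suc j) k (Suc M) - comps a i (Suc (Suc j)) k M = comps (sh 2 a) i j k (Suc M)"
  "comps a i j (Suc k) (Suc M) - comps a i j (Suc (Suc k)) M = comps (sh 3 a) i j k (Suc M)"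
proof -
  have split: "sum f (comp3 (Suc M)) = sum f (comp3 (Suc M) \<inter> {x. P x = 0}) + sum f (comp3 (Suc M) \<inter> {x. P x \<noteq> 0})"
    for f :: "nat \<times> nat \<times> nat \<Rightarrow> real" and P :: "nat \<times> nat \<times> nat \<Rightarrow> nat"
    by (subst sum.union_disjoint[symmetric]) (auto intro: sum.cong)
  have 1: "sum f (comp3 (Suc M) \<inter> {x. fst x \<noteq> 0}) = sum (\<lambda>(p, q, r). f (Suc p, q, r)) (comp3 M)" for f :: "_ \<Rightarrow> real"
    by (rule sum.reindex_bij_witness[of _ "\<lambda>(p, q, r). (Suc p, q, r)" "\<lambda>(p, q, r). (p - 1, q, r)"])
       (auto simp: comp3_def)
  have 2: "sum f (comp3 (Suc M) \<inter> {x. fst (snd x) \<noteq> 0}) = sum (\<lambda>(p, q, r). f (p, Suc q, r)) (comp3 M)" for f :: "_ \<Rightarrow> real"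
    by (rule sum.reindex_bij_witness[of _ "\<lambda>(p, q, r). (p, Suc q, r)" "\<lambda>(p, q, r). (p, q - 1, r)"])
       (auto simp: comp3_def)
  have 3: "sum f (comp3 (Suc M) \<inter> {x. snd (snd x) \<noteq> 0}) = sum (\<lambda>(p, q, r). f (p, q, Suc r)) (comp3 M)" for f :: "_ \<Rightarrow> real"
    by (rule sum.reindex_bij_witness[of _ "\<lambda>(p, q, r). (p, q, Suc r)" "\<lambda>(p, q, r). (p, q, r - 1)"])
       (auto simp: comp3_def)
  show "comps a (Suc i) j k (Suc M) - comps a (Suc (Suc i)) j k M = comps (sh 1 a) i j k (Suc M)"
    unfolding comps_def split[where P = fst] 1 add_diff_eq[symmetric] sum_subtractf[symmetric]
    by (intro arg_cong2[where f = "(+)"] sum.cong refl)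
       (auto simp: cterm_def sh_def ballot_rec algebra_simps)
  show "comps a i (Suc j) k (Suc M) - comps a i (Suc (Suc j)) k M = comps (sh 2 a) i j k (Suc M)"
    unfolding comps_def split[where P = "\<lambda>x. fst (snd x)"] 2 add_diff_eq[symmetric] sum_subtractf[symmetric]
    by (intro arg_cong2[where f = "(+)"] sum.cong refl)
       (auto simp: cterm_def sh_def ballot_rec algebra_simps)
  show "comps a i j (Suc k) (Suc M) - comps a i j (Suc (Suc k)) M = comps (sh 3 a) i j k (Suc M)"
    unfolding comps_def split[where P = "\<lambda>x. snd (snd x)"] 3 add_diff_eq[symmetric] sum_subtractf[symmetric]
    by (intro arg_cong2[where f = "(+)"] sum.cong refl)
       (auto simp: cterm_def sh_def ballot_rec algebra_simps)
qed

text \<open>Level n is the n-th damped time derivative of level 0, see \<open>Tc_cf\<close>. The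
  \<open>Suc\<close> reflects that the power m of the time coordinate stems from m + 1 factors
  \<open>Bop\<close>.\<close>

definition cf :: "nat \<Rightarrow> weight \<Rightarrow> coeffs" where
  "cf n a i j k m = (1/2) ^ n * comps a i j k (Suc (m + n))"

lemma Tc_cf: "Tc (cf n a) = cf (Suc n) a"
  by (intro ext) (simp add: Tc_def cf_def)

text \<open>The coefficient form of c^2 d_i^2 = T^2 - 2 T s_i. The sign of the octant enters only
  through its square, so all octants obey the same formula.\<close>

lemma Xc_Xc_cf:
  assumes "e $ d * e $ d = 1"
  shows "Xc c e d (Xc c e d (cf n a)) i j k m
    = 1 / c\<^sup>2 * cf (n + 2) a i j k m + (- 2 / c\<^sup>2) * cf (n + 1) (sh d a) i j k m"
proof -
  have *: "e $ d / c * (e $ d / c * y) = y / c\<^sup>2" for y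
    using assms by (simp add: power2_eq_square)
  \<comment> \<open>The twice raised index is traded for a once raised one, which then cancels
    against the mixed term, and for a shifted weight.\<close>
  have 1: "comps a (Suc (Suc i)) j k (Suc (m + n)) = comps a (Suc i) j k (Suc (Suc (m + n))) - comps (sh 1 a) i j k (Suc (Suc (m + n)))"
    and 2: "comps a i (Suc (Suc j)) k (Suc (m + n)) = comps a i (Suc j) k (Suc (Suc (m + n))) - comps (sh 2 a) i j k (Suc (Suc (m + n)))"
    and 3: "comps a i j (Suc (Suc k)) (Suc (m + n)) = comps a i j (Suc k) (Suc (Suc (m + n))) - comps (sh 3 a) i j k (Suc (Suc (m + n)))"
    using comps_step[where M = "Suc (m + n)"] by (simp_all add: algebra_simps)
  have "Xc c e d (Xc c e d (cf n a)) i j k m = e $ d / c * (e $ d / c *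
      (Sc d (Sc d (cf n a)) i j k m - Sc d (cf n a) i j k (Suc m) + cf n a i j k (Suc (Suc m)) / 4))"
    by (simp add: Xc_def Sc_def algebra_simps diff_divide_distrib add_divide_distrib)
  also have "Sc d (Sc d (cf n a)) i j k m - Sc d (cf n a) i j k (Suc m) + cf n a i j k (Suc (Suc m)) / 4
     = cf (n + 2) a i j k m - 2 * cf (n + 1) (sh d a) i j k m"
    using exhaust_3[of d] by (auto simp: Sc_def cf_def 1 2 3 algebra_simps power2_eq_square)
  finally show ?thesis unfolding * by (simp add: diff_divide_distrib)
qed

lemma geo_cf:
  assumes a: "\<And>i j k. \<bar>a i j k\<bar> \<le> K * B ^ (i + j + k)" and KB: "0 \<le> K" "1 \<le> B"
  shows "geo 4 (on_list (cf n a))"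
proof -
  \<comment> \<open>Per unit of the total index: 8 for the number of compositions, 4 for the product
    of the three ballot factors, B for the weight.\<close>
  define L where "L = 32 * B"
  have L: "1 \<le> L" "32 \<le> L" using KB by (auto simp: L_def)
  \<comment> \<open>The exponent N below exceeds the total coefficient index by
    \<open>Suc n\<close>; this surplus goes into the constant.\<close>
  have "geo_bound 4 (K * L ^ (Suc n)) L (on_list (cf n a))"
    unfolding geo_bound_def
  proof (intro conjI allI impI)
    fix \<alpha> :: "nat list" assume "length \<alpha> = 4"
    then obtain i j k m where \<alpha>: "\<alpha> = [i, j, k, m]" using length_4_ex by blast
    define N where "N = i + j + k + Suc (m + n)"
    have t: "\<bar>cterm a i j k x\<bar> \<le> K * (4 * B) ^ N" if x: "x \<in> comp3 (Suc (m + n))" for x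
    proof -
      obtain p q r where xx: "x = (p, q, r)" "p + q + r = Suc (m + n)" using x by (auto simp: comp3_def)
      have "\<bar>a (i + p) (j + q) (k + r)\<bar> \<le> K * B ^ N"
        using a[of "i + p" "j + q" "k + r"] xx by (simp add: N_def add_ac)
      moreover have "ballot i p * ballot j q * ballot k r
          \<le> 2 ^ (i + 2 * p) * 2 ^ (j + 2 * q) * 2 ^ (k + 2 * r)"
        by (intro mult_mono ballot_le) auto
      then have "ballot i p * ballot j q * ballot k r \<le> 2 ^ (i + 2 * p + (j + 2 * q) + (k + 2 * r))"
        by (simp add: power_add)
      then have "ballot i p * ballot j q * ballot k r \<le> 2 ^ (2 * N)"
        by (rule order_trans, intro power_increasing) (use xx in \<open>auto simp: N_def\<close>)
      then have "ballot i p * ballot j q * ballot k r \<le> 4 ^ N"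
        by (simp add: power_mult)
      ultimately have "\<bar>a (i + p) (j + q) (k + r)\<bar> * \<bar>ballot i p * ballot j q * ballot k r\<bar> \<le> (K * B ^ N) * 4 ^ N"
        using KB by (intro mult_mono) auto
      then show ?thesis
        by (simp add: xx cterm_def abs_mult power_mult_distrib mult_ac)
    qed
    have "\<bar>comps a i j k (Suc (m + n))\<bar> \<le> (\<Sum>x\<in>comp3 (Suc (m + n)). \<bar>cterm a i j k x\<bar>)"
      unfolding comps_def by (rule sum_abs)
    also have "\<dots> \<le> real (card (comp3 (Suc (m + n)))) * (K * (4 * B) ^ N)"
      using t by (rule sum_bounded_above)
    also have "\<dots> \<le> 8 ^ N * (K * (4 * B) ^ N)"
    proof (rule mult_right_mono)
      have "Suc (Suc (m + n)) \<le> 2 ^ N"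
        using less_exp[of N] unfolding N_def by linarith
      then have "(Suc (m + n) + 1) ^ 3 \<le> (2 ^ N) ^ 3"
        by (intro power_mono) auto
      also have "(2 ^ N) ^ 3 = (8::nat) ^ N"
        using power_mult[of "2::nat" N 3] power_mult[of "2::nat" 3 N] by (simp add: mult.commute)
      finally show "real (card (comp3 (Suc (m + n)))) \<le> 8 ^ N"
        using card_comp3[of "Suc (m + n)"]
        using of_nat_mono[of "card (comp3 (Suc (m + n)))" "8 ^ N"] by fastforce
    qed (use KB in auto)
    also have "\<dots> = K * L ^ N"
      using power_mult_distrib[of "8::real" 4 N] by (simp add: L_def mult_ac power_mult_distrib)
    finally have "\<bar>comps a i j k (Suc (m + n))\<bar> \<le> K * L ^ N" .
    moreover have "(1/2::real) ^ n \<le> 1" by (simp add: power_le_one)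
    ultimately have "(1/2) ^ n * \<bar>comps a i j k (Suc (m + n))\<bar> \<le> 1 * (K * L ^ N)"
      by (intro mult_mono) auto
    then show "\<bar>on_list (cf n a) \<alpha>\<bar> \<le> K * L ^ Suc n * L ^ sum_list \<alpha>"
      by (simp add: \<alpha> cf_def abs_mult N_def power_add mult_ac)
  qed (use KB L in auto)
  then show ?thesis by (auto simp: geo_def)
qed

section \<open>The differential equation\<close>

definition tame :: "weight \<Rightarrow> bool" where
  "tame a \<longleftrightarrow> (\<exists>K B. 0 \<le> K \<and> 1 \<le> B \<and> (\<forall>i j k. \<bar>a i j k\<bar> \<le> K * B ^ (i + j + k)))"

lemma tame_sh:
  assumes "tame a"
  shows "tame (sh d a)"
proof -
  obtain K B where *: "0 \<le> K" "1 \<le> B" "\<And>i j k. \<bar>a i j k\<bar> \<le> K * B ^ (i + j + k)"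
    using assms by (auto simp: tame_def)
  have "\<bar>sh d a i j k\<bar> \<le> (K * B) * B ^ (i + j + k)" for i j k
    using *(3)[of "Suc i" j k] *(3)[of i "Suc j" k] *(3)[of i j "Suc k"]
    by (auto simp: sh_def mult_ac)
  then show ?thesis
    unfolding tame_def using *(1,2) by (intro exI[of _ "K * B"] exI[of _ B]) auto
qed

lemma geo_cf_tame: "tame a \<Longrightarrow> geo 4 (on_list (cf n a))"
  unfolding tame_def using geo_cf by metis

section \<open>Formal combinations of time derivatives and shifted weights\<close>

type_synonym combo = "(real \<times> nat \<times> weight) list"

text \<open>An entry (r, n, a) stands for r T^n applied to the field with weight a. Each side of the
  equation becomes such a list, so that only real multiples of finitely many fields remain to be
  compared.\<close>

definition lc :: "combo \<Rightarrow> coeffs" where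
  "lc xs i j k m = (\<Sum>(r, n, a)\<leftarrow>xs. r * cf n a i j k m)"

definition tames :: "combo \<Rightarrow> bool" where
  "tames xs \<longleftrightarrow> (\<forall>(r, n, a)\<in>set xs. tame a)"

lemma geo_lc: "tames xs \<Longrightarrow> geo 4 (on_list (lc xs))"
proof (induction xs)
  case Nil
  then show ?case by (auto simp: geo_def geo_bound_def on_list_def lc_def intro!: exI[of _ 0])
next
  case (Cons x xs)
  obtain r n a where x: "x = (r, n, a)" by (cases x)
  have "lc (x # xs) = (\<lambda>i j k m. r * cf n a i j k m + 1 * lc xs i j k m)"
    by (intro ext) (simp add: lc_def x)
  moreover have "tame a" "tames xs" using Cons.prems by (auto simp: tames_def x)
  ultimately show ?case using geo_lin[OF geo_cf_tame[of a n] Cons.IH, of r 1] by simp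
qed

lemma kfield_lc: "tames xs \<Longrightarrow> kfield l c e (lc xs) t v = (\<Sum>(r, n, a)\<leftarrow>xs. r * kfield l c e (cf n a) t v)"
proof (induction xs)
  case Nil
  have "lc [] = (\<lambda>i j k m. 0 * lc [] i j k m + 0 * lc [] i j k m)" by (intro ext) (simp add: lc_def)
  then show ?case
    using kfield_linear[of "lc []" "lc []" l c e 0 0 t v] geo_lc[OF Nil] by simp
next
  case (Cons x xs)
  obtain r n a where x: "x = (r, n, a)" by (cases x)
  have "lc (x # xs) = (\<lambda>i j k m. r * cf n a i j k m + 1 * lc xs i j k m)"
    by (intro ext) (simp add: lc_def x)
  then show ?case
    using Cons kfield_linear[of "cf n a" "lc xs" l c e r 1 t v] geo_lc[of xs]
    by (simp add: tames_def x geo_cf_tame)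
qed

text \<open>The operator T^2 - 2 T s_d on formal combinations; the factor 1 / c^2 is kept
  outside.\<close>

fun lc_step :: "3 \<Rightarrow> combo \<Rightarrow> combo" where
  "lc_step d [] = []"
| "lc_step d ((r, n, a) # xs) = (r, n + 2, a) # (- 2 * r, n + 1, sh d a) # lc_step d xs"

lemma tames_Cons [simp]: "tames ((r, n, a) # xs) \<longleftrightarrow> tame a \<and> tames xs" "tames []"
  "tames (xs @ ys) \<longleftrightarrow> tames xs \<and> tames ys"
  by (simp_all add: tames_def ball_Un)

lemma tames_lc_step: "tames xs \<Longrightarrow> tames (lc_step d xs)"
  by (induction d xs rule: lc_step.induct) (auto intro: tame_sh)

lemma Xc_linear:
  "Xc c e d (\<lambda>i j k m. r * A i j k m + r' * C i j k m) = (\<lambda>i j k m. r * Xc c e d A i j k m + r' * Xc c e d C i j k m)"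
  by (intro ext) (auto simp: Xc_def Sc_def algebra_simps diff_divide_distrib add_divide_distrib)

lemma Xc_Xc_lc:
  assumes "e $ d * e $ d = 1"
  shows "Xc c e d (Xc c e d (lc xs)) = (\<lambda>i j k m. 1 / c\<^sup>2 * lc (lc_step d xs) i j k m + 0 * lc [] i j k m)"
proof (induction xs)
  case Nil
  show ?case by (intro ext) (simp add: lc_def Xc_def Sc_def)
next
  case (Cons x xs)
  obtain r n a where x: "x = (r, n, a)" by (cases x)
  have "lc (x # xs) = (\<lambda>i j k m. r * cf n a i j k m + 1 * lc xs i j k m)"
    by (intro ext) (simp add: lc_def x)
  then show ?case
    by (simp only: Xc_linear Xc_Xc_cf[OF assms] Cons) (intro ext, simp add: lc_def x algebra_simps diff_divide_distrib add_divide_distrib)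
qed

lemma Xc_Xc_scaled_lc:
  assumes "e $ d * e $ d = 1"
  shows "Xc c e d (Xc c e d (\<lambda>i j k m. s * lc xs i j k m)) = (\<lambda>i j k m. (1 / c\<^sup>2 * s) * lc (lc_step d xs) i j k m)"
proof -
  have "(\<lambda>i j k m. s * lc xs i j k m) = (\<lambda>i j k m. s * lc xs i j k m + 0 * lc xs i j k m)" by simp
  then show ?thesis
    by (simp only: Xc_linear Xc_Xc_lc[OF assms]) simp
qed

text \<open>The scalar s collects the powers of 1 / c^2 and the constant of the density, so that the
  lists stay free of c.\<close>

definition klc :: "real \<Rightarrow> real \<Rightarrow> real ^ 3 \<Rightarrow> real \<Rightarrow> combo \<Rightarrow> field" where
  "klc l c e s xs = kfield l c e (\<lambda>i j k m. s * lc xs i j k m)"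

lemma geo_scaled_lc: "tames xs \<Longrightarrow> geo 4 (on_list (\<lambda>i j k m. s * lc xs i j k m))"
  using geo_lin[OF geo_lc geo_lc, of xs xs s 0] by simp

lemma klc_eq: "tames xs \<Longrightarrow> klc l c e s xs t v = s * (\<Sum>(r, n, a)\<leftarrow>xs. r * kfield l c e (cf n a) t v)"
  using kfield_linear[OF geo_lc geo_lc, of xs xs l c e s 0 t v] by (simp add: klc_def kfield_lc)

lemma pdx2_klc:
  assumes "e $ d * e $ d = 1" "tames xs"
  shows "(pdx d ^^ 2) (klc l c e s xs) = klc l c e (1 / c\<^sup>2 * s) (lc_step d xs)"
  by (simp add: numeral_2_eq_2 klc_def pdx_kfield geo_scaled_lc[OF assms(2)] geo_Xc
      Xc_Xc_scaled_lc[OF assms(1)])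

definition lc_dt :: "nat \<Rightarrow> combo \<Rightarrow> combo" where
  "lc_dt n xs = map (\<lambda>(r, m, a). (r, m + n, a)) xs"

lemma tames_lc_dt: "tames xs \<Longrightarrow> tames (lc_dt n xs)"
  by (auto simp: tames_def lc_dt_def)

lemma Tc_scaled_lc: "Tc (\<lambda>i j k m. s * lc xs i j k m) = (\<lambda>i j k m. s * lc (lc_dt 1 xs) i j k m)"
proof -
  have *: "lc xs i j k (Suc m) / 2 = lc (lc_dt 1 xs) i j k m" for i j k m
    by (induction xs) (auto simp: lc_def lc_dt_def cf_def add_divide_distrib)
  show ?thesis
    by (intro ext) (simp only: Tc_def times_divide_eq_right[symmetric] *)
qed

lemma lc_dt_lc_dt: "lc_dt m (lc_dt n xs) = lc_dt (n + m) xs"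
  by (auto simp: lc_dt_def)

lemma damped_klc:
  "tames xs \<Longrightarrow> (damped_dt l ^^ n) (klc l c e s xs) = klc l c e s (lc_dt n xs)"
proof (induction n)
  case 0
  have "lc_dt 0 xs = xs" by (simp add: lc_dt_def map_idI)
  then show ?case by simp
next
  case (Suc n)
  have "damped_dt l (klc l c e s (lc_dt n xs)) = klc l c e s (lc_dt (n + 1) xs)"
    unfolding klc_def
    by (subst damped_kfield[OF geo_scaled_lc[OF tames_lc_dt[OF Suc.prems]]])
       (simp only: Tc_scaled_lc lc_dt_lc_dt)
  then show ?case using Suc by simp
qed

text \<open>Indices are raised by one because only words with all three axes contribute off the
  coordinate planes, and index i belongs to powers of the axis operator from i + 1 on. The factor l
  / 4 per letter is the rate times the probability of each of the four orthogonal
  directions.\<close>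

definition osm_weight :: "real \<Rightarrow> weight" where
  "osm_weight l i j k = real (words (Suc i) (Suc j) (Suc k)) * (l / 4) ^ (i + j + k)"

lemma tame_osm_weight:
  assumes "0 < l"
  shows "tame (osm_weight l)"
proof -
  \<comment> \<open>24 = 3 * 2^3 is \<open>words_le\<close> at three raised indices. Adding 1 makes
    the base at least 1, as \<open>tame\<close> requires.\<close>
  have "\<bar>osm_weight l i j k\<bar> \<le> 24 * (2 * (l / 4) + 1) ^ (i + j + k)" for i j k
  proof -
    have "real (words (Suc i) (Suc j) (Suc k)) \<le> real (3 * 2 ^ (Suc i + Suc j + Suc k))"
      using words_le[of "Suc i" "Suc j" "Suc k"] by (rule of_nat_mono)
    also have "\<dots> = 24 * 2 ^ (i + j + k)" by (simp add: power_add)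
    finally have "real (words (Suc i) (Suc j) (Suc k)) * (l / 4) ^ (i + j + k) \<le> (24 * 2 ^ (i + j + k)) * (l / 4) ^ (i + j + k)"
      using assms by (intro mult_right_mono) auto
    also have "\<dots> = 24 * (2 * (l / 4)) ^ (i + j + k)" by (simp only: power_mult_distrib mult.assoc)
    also have "\<dots> \<le> 24 * (2 * (l / 4) + 1) ^ (i + j + k)"
      using assms by (intro mult_left_mono power_mono) auto
    finally show ?thesis using assms by (simp add: osm_weight_def)
  qed
  then show ?thesis
    unfolding tame_def using assms by (intro exI[of _ 24] exI[of _ "2 * (l / 4) + 1"]) auto
qed

text \<open>This is \<open>words_rec\<close> times 8 with every letter weighted by l / 4: two
  missing letters cost 8 (l / 4)^2 = l^2 / 2, three cost 8 * 2 (l / 4)^3 = l^3 / 4.\<close>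

lemma osm_weight_rec:
  "8 * sh 1 (sh 2 (sh 3 (osm_weight l))) i j k
    = l\<^sup>2 / 2 * (sh 1 (osm_weight l) i j k + sh 2 (osm_weight l) i j k + sh 3 (osm_weight l) i j k)
      + l ^ 3 / 4 * osm_weight l i j k"
proof -
  have *: "real (words (Suc (Suc i)) (Suc (Suc j)) (Suc (Suc k))) =
      real (words (Suc (Suc i)) (Suc j) (Suc k)) + real (words (Suc i) (Suc (Suc j)) (Suc k))
       + real (words (Suc i) (Suc j) (Suc (Suc k))) + 2 * real (words (Suc i) (Suc j) (Suc k))"
    using words_rec[of "Suc i" "Suc j" "Suc k"] by simp
  define X where "X = (l / 4) ^ (i + j + k)"
  have X: "(l / 4) ^ (Suc i + Suc j + Suc k) = l ^ 3 / 64 * X" "(l / 4) ^ (Suc i + j + k) = l / 4 * X"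
    "(l / 4) ^ (i + Suc j + k) = l / 4 * X" "(l / 4) ^ (i + j + Suc k) = l / 4 * X"
    by (simp_all add: X_def power3_eq_cube)
  show ?thesis
    unfolding sh_def osm_weight_def by (simp add: * X flip: X_def) (simp add: algebra_simps power2_eq_square power3_eq_cube)
qed

lemma sum_linear_relation:
  fixes P Q :: real
  assumes "\<And>x. 8 * f x = P * g x + P * h x + P * h' x + Q * h'' x"
  shows "8 * sum f S = P * sum g S + P * sum h S + P * sum h' S + Q * sum h'' S"
proof -
  have "8 * sum f S = (\<Sum>x\<in>S. P * g x + P * h x + P * h' x + Q * h'' x)"
    unfolding sum_distrib_left assms ..
  then show ?thesis
    by (simp only: sum.distrib sum_distrib_left)
qed

lemma scale_relation:
  fixes b :: real
  assumes "8 * w = P * (x + y + z) + Q * v"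
  shows "8 * (w * b) = P * (x * b) + P * (y * b) + P * (z * b) + Q * (v * b)"
proof -
  have "8 * (w * b) = (8 * w) * b" by (rule mult.assoc[symmetric])
  also have "\<dots> = P * (x * b) + P * (y * b) + P * (z * b) + Q * (v * b)"
    unfolding assms by (simp add: algebra_simps)
  finally show ?thesis .
qed

lemma lc_relation:
  assumes *: "\<And>i j k M. 8 * comps a0 i j k M = P * comps a1 i j k M + P * comps a2 i j k M + P * comps a3 i j k M + Q * comps a4 i j k M"
  shows "lc [(8, n, a0), (- P, n, a1), (- P, n, a2), (- P, n, a3), (- Q, n, a4)] i j k m = 0"
proof -
  define y where "y = (1 / 2 :: real) ^ n"
  have "lc [(8, n, a0), (- P, n, a1), (- P, n, a2), (- P, n, a3), (- Q, n, a4)] i j k m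
    = y * (8 * comps a0 i j k (Suc (m + n)) - (P * comps a1 i j k (Suc (m + n)) + P * comps a2 i j k (Suc (m + n)) + P * comps a3 i j k (Suc (m + n)) + Q * comps a4 i j k (Suc (m + n))))"
    by (simp add: lc_def cf_def algebra_simps flip: y_def)
  then show ?thesis by (simp only: * diff_self mult_zero_right)
qed

text \<open>The five arrays carry the same ballot factors in each term of \<open>comps\<close>, so
  the recurrence of the weights passes through the sum.\<close>

lemma lc_osm_relation:
  "lc [(8, n, sh 1 (sh 2 (sh 3 (osm_weight l)))), (- (l\<^sup>2 / 2), n, sh 1 (osm_weight l)),
     (- (l\<^sup>2 / 2), n, sh 2 (osm_weight l)), (- (l\<^sup>2 / 2), n, sh 3 (osm_weight l)),
     (- (l ^ 3 / 4), n, osm_weight l)] = (\<lambda>i j k m. 0)"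
proof -
  have t: "8 * cterm (sh 1 (sh 2 (sh 3 (osm_weight l)))) i j k x
    = l\<^sup>2 / 2 * cterm (sh 1 (osm_weight l)) i j k x + l\<^sup>2 / 2 * cterm (sh 2 (osm_weight l)) i j k x
      + l\<^sup>2 / 2 * cterm (sh 3 (osm_weight l)) i j k x + l ^ 3 / 4 * cterm (osm_weight l) i j k x" for i j k x
  proof -
    obtain p q r where x: "x = (p, q, r)" by (cases x)
    show ?thesis
      unfolding cterm_def x prod.case by (rule scale_relation[OF osm_weight_rec])
  qed
  have *: "8 * comps (sh 1 (sh 2 (sh 3 (osm_weight l)))) i j k M
    = l\<^sup>2 / 2 * comps (sh 1 (osm_weight l)) i j k M + l\<^sup>2 / 2 * comps (sh 2 (osm_weight l)) i j k M
      + l\<^sup>2 / 2 * comps (sh 3 (osm_weight l)) i j k M + l ^ 3 / 4 * comps (osm_weight l) i j k M" for i j k M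
    unfolding comps_def by (rule sum_linear_relation) (rule t)
  show ?thesis
    by (intro ext) (rule lc_relation, rule *)
qed

text \<open>In its application the letters a, b, d stand for powers of T (given by the number) times
  the elementary symmetric polynomials of degree 0, 1, 2 in the shifts, Z for 8 T^3 s_1 s_2 s_3, q
  for l^2 / 4 and r for l^3 / 4. Everything cancels identically except what the assumption
  collects.\<close>

lemma pde_arith:
  fixes s :: real
  assumes "Z = 2 * q * b3 + r * a3"
  shows "s * a6 - 3 * q * (s * a4) - r * (s * a3)
     = s * (a6 - 2 * b5 + 4 * d4 - Z) - s * (3 * a6 - 4 * b5 + 4 * d4)
       + (s * (3 * a6 - 2 * b5) - q * (s * (3 * a4 - 2 * b3)))"
proof -
  have "s * a6 - 3 * q * (s * a4) - r * (s * a3)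
     = s * (a6 - 2 * b5 + 4 * d4 - Z) - s * (3 * a6 - 4 * b5 + 4 * d4)
       + (s * (3 * a6 - 2 * b5) - q * (s * (3 * a4 - 2 * b3))) + s * (Z - (2 * q * b3 + r * a3))"
    by (simp add: algebra_simps)
  also have "s * (Z - (2 * q * b3 + r * a3)) = 0"
    by (simp only: assms diff_self mult_zero_right)
  finally show ?thesis by (simp only: add_0_right)
qed

lemma kfield_pde:
  assumes l: "0 < l" and c: "c \<noteq> 0" and e: "\<And>d. e $ d * e $ d = 1"
    and u: "u = kfield l c e (\<lambda>i j k m. s * cf 0 (osm_weight l) i j k m)"
  shows "(damped_dt l ^^ 6) u t v - 3 * l\<^sup>2 / 4 * (damped_dt l ^^ 4) u t v - l ^ 3 / 4 * (damped_dt l ^^ 3) u t v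
     = c ^ 6 * mixed_sixth u t v - c ^ 4 * (damped_dt l ^^ 2) (mixed_fourth u) t v
       + c\<^sup>2 * ((damped_dt l ^^ 4) (laplacian u) t v - l\<^sup>2 / 4 * (damped_dt l ^^ 2) (laplacian u) t v)"
proof -
  define a where "a = osm_weight l"
  have a: "tame a" unfolding a_def by (rule tame_osm_weight[OF l])
  define xs :: combo where "xs = [(1, 0, a)]"
  define k where "k = 1 / c\<^sup>2"
  have xs: "tames xs" by (simp add: xs_def a)
  have u: "u = klc l c e s xs"
    by (simp add: u klc_def xs_def lc_def a_def)
  note st = tames_lc_step[OF xs] tames_lc_step[OF tames_lc_step[OF xs]]
    tames_lc_step[OF tames_lc_step[OF tames_lc_step[OF xs]]]
  have six: "mixed_sixth u = klc l c e (k * (k * (k * s))) (lc_step 1 (lc_step 2 (lc_step 3 xs)))"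
    unfolding mixed_sixth_def u by (simp only: pdx2_klc[OF e] xs st k_def)
  have lap: "laplacian u = klc l c e (k * s) (lc_step 1 xs @ lc_step 2 xs @ lc_step 3 xs)"
  proof (intro ext)
    fix t v
    have t3: "tames (lc_step 1 xs @ lc_step 2 xs @ lc_step 3 xs)"
      using st(1) by simp
    show "laplacian u t v = klc l c e (k * s) (lc_step 1 xs @ lc_step 2 xs @ lc_step 3 xs) t v"
      unfolding laplacian_def sum_3 u
      by (simp only: pdx2_klc[OF e xs] klc_eq[OF st(1)] klc_eq[OF t3] k_def map_append sum_list_append)
         (simp only: distrib_left add.assoc)
  qed
  have four: "mixed_fourth u = klc l c e (k * (k * s))
      (lc_step 1 (lc_step 2 xs) @ lc_step 1 (lc_step 3 xs) @ lc_step 2 (lc_step 3 xs))"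
  proof (intro ext)
    fix t v
    have t3: "tames (lc_step 1 (lc_step 2 xs) @ lc_step 1 (lc_step 3 xs) @ lc_step 2 (lc_step 3 xs))"
      using st(2) by simp
    show "mixed_fourth u t v = klc l c e (k * (k * s))
      (lc_step 1 (lc_step 2 xs) @ lc_step 1 (lc_step 3 xs) @ lc_step 2 (lc_step 3 xs)) t v"
      unfolding mixed_fourth_def u
      by (simp only: pdx2_klc[OF e] xs st(1) klc_eq[OF st(2)] klc_eq[OF t3] k_def map_append sum_list_append)
         (simp only: distrib_left add.assoc)
  qed
  define f where "f n b = kfield l c e (cf n b) t v" for n b
  have tm: "tame a" "tame (sh 1 a)" "tame (sh 2 a)" "tame (sh 3 a)"
     "tame (sh 1 (sh 2 a))" "tame (sh 1 (sh 3 a))" "tame (sh 2 (sh 3 a))" "tame (sh 1 (sh 2 (sh 3 a)))"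
    by (intro tame_sh a)+
  \<comment> \<open>The only place where the word counts enter: a combination with vanishing
    coefficients has a vanishing field.\<close>
  have rel: "8 * f 3 (sh 1 (sh 2 (sh 3 a))) = l\<^sup>2 / 2 * (f 3 (sh 1 a) + f 3 (sh 2 a) + f 3 (sh 3 a)) + l ^ 3 / 4 * f 3 a"
  proof -
    define Z :: combo where "Z = [(8, 3, sh 1 (sh 2 (sh 3 a))), (- (l\<^sup>2 / 2), 3, sh 1 a),
       (- (l\<^sup>2 / 2), 3, sh 2 a), (- (l\<^sup>2 / 2), 3, sh 3 a), (- (l ^ 3 / 4), 3, a)]"
    have "lc Z = lc []"
      unfolding Z_def a_def lc_osm_relation by (intro ext) (simp add: lc_def)
    moreover have "tames Z" by (simp add: Z_def tm)
    ultimately have "(\<Sum>(r, n, a)\<leftarrow>Z. r * kfield l c e (cf n a) t v) = 0"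
      using kfield_lc[of Z l c e t v] kfield_lc[of "[]" l c e t v] by simp
    then show ?thesis by (simp add: Z_def f_def distrib_left)
  qed
  have lhs: "(damped_dt l ^^ n) u t v = s * f n a" for n
    unfolding u damped_klc[OF xs] by (subst klc_eq) (simp_all add: xs_def lc_dt_def a f_def)
  have D4: "(damped_dt l ^^ n) (laplacian u) t v
     = k * s * (3 * f (2 + n) a - 2 * (f (1 + n) (sh 1 a) + f (1 + n) (sh 2 a) + f (1 + n) (sh 3 a)))" for n
    unfolding lap
    by (subst damped_klc, simp add: xs_def tm, subst klc_eq)
       (simp_all add: xs_def lc_dt_def tm f_def algebra_simps eval_nat_numeral)
  have D2: "(damped_dt l ^^ 2) (mixed_fourth u) t v
     = k * k * s * (3 * f 6 a - 4 * (f 5 (sh 1 a) + f 5 (sh 2 a) + f 5 (sh 3 a))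
        + 4 * (f 4 (sh 1 (sh 2 a)) + f 4 (sh 1 (sh 3 a)) + f 4 (sh 2 (sh 3 a))))"
    unfolding four
    by (subst damped_klc, simp add: xs_def tm, subst klc_eq)
       (simp_all add: xs_def lc_dt_def tm f_def algebra_simps eval_nat_numeral)
  have D0: "mixed_sixth u t v
     = k * k * k * s * (f 6 a - 2 * (f 5 (sh 1 a) + f 5 (sh 2 a) + f 5 (sh 3 a))
        + 4 * (f 4 (sh 1 (sh 2 a)) + f 4 (sh 1 (sh 3 a)) + f 4 (sh 2 (sh 3 a))) - 8 * f 3 (sh 1 (sh 2 (sh 3 a))))"
    unfolding six
    by (subst klc_eq) (simp_all add: xs_def tm f_def algebra_simps eval_nat_numeral)
  have k1: "c\<^sup>2 * k = 1" using c by (simp add: k_def)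
  have c46: "c ^ 4 = c\<^sup>2 * c\<^sup>2" "c ^ 6 = c\<^sup>2 * c\<^sup>2 * c\<^sup>2"
    by (simp_all flip: power_add)
  have "c ^ 4 * (k * k) = (c\<^sup>2 * k) * (c\<^sup>2 * k)" "c ^ 6 * (k * k * k) = (c\<^sup>2 * k) * (c\<^sup>2 * k) * (c\<^sup>2 * k)"
    by (simp_all only: c46 mult_ac)
  then have k2: "c ^ 4 * (k * k) = 1" "c ^ 6 * (k * k * k) = 1"
    by (simp_all only: k1 mult_1)
  have r0: "c ^ 6 * mixed_sixth u t v = s * (f 6 a - 2 * (f 5 (sh 1 a) + f 5 (sh 2 a) + f 5 (sh 3 a))
        + 4 * (f 4 (sh 1 (sh 2 a)) + f 4 (sh 1 (sh 3 a)) + f 4 (sh 2 (sh 3 a))) - 8 * f 3 (sh 1 (sh 2 (sh 3 a))))"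
    unfolding D0 mult.assoc[symmetric] using k2(2) by (simp add: mult.assoc)
  have r2: "c ^ 4 * (damped_dt l ^^ 2) (mixed_fourth u) t v = s * (3 * f 6 a - 4 * (f 5 (sh 1 a) + f 5 (sh 2 a) + f 5 (sh 3 a))
        + 4 * (f 4 (sh 1 (sh 2 a)) + f 4 (sh 1 (sh 3 a)) + f 4 (sh 2 (sh 3 a))))"
    unfolding D2 mult.assoc[symmetric] using k2(1) by (simp add: mult.assoc)
  have r4: "c\<^sup>2 * (damped_dt l ^^ n) (laplacian u) t v
      = s * (3 * f (2 + n) a - 2 * (f (1 + n) (sh 1 a) + f (1 + n) (sh 2 a) + f (1 + n) (sh 3 a)))" for n
    unfolding D4 mult.assoc[symmetric] using k1 by simp
  have rr: "c\<^sup>2 * (A - q * B) = c\<^sup>2 * A - q * (c\<^sup>2 * B)" for A B q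
    by (simp add: algebra_simps)
  have r44: "c\<^sup>2 * (damped_dt l ^^ 4) (laplacian u) t v = s * (3 * f 6 a - 2 * (f 5 (sh 1 a) + f 5 (sh 2 a) + f 5 (sh 3 a)))"
    and r42: "c\<^sup>2 * (damped_dt l ^^ 2) (laplacian u) t v = s * (3 * f 4 a - 2 * (f 3 (sh 1 a) + f 3 (sh 2 a) + f 3 (sh 3 a)))"
    using r4[of 4] r4[of 2] by (simp_all add: numeral_3_eq_3[symmetric])
  have rel': "8 * f 3 (sh 1 (sh 2 (sh 3 a))) = 2 * (l\<^sup>2 / 4) * (f 3 (sh 1 a) + f 3 (sh 2 a) + f 3 (sh 3 a)) + l ^ 3 / 4 * f 3 a"
    using rel by simp
  have "(damped_dt l ^^ 6) u t v - 3 * l\<^sup>2 / 4 * (damped_dt l ^^ 4) u t v - l ^ 3 / 4 * (damped_dt l ^^ 3) u t v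
      = s * f 6 a - 3 * (l\<^sup>2 / 4) * (s * f 4 a) - l ^ 3 / 4 * (s * f 3 a)"
    by (simp only: lhs times_divide_eq_right)
  also note pde_arith[OF rel']
  also have "s * (f 6 a - 2 * (f 5 (sh 1 a) + f 5 (sh 2 a) + f 5 (sh 3 a))
        + 4 * (f 4 (sh 1 (sh 2 a)) + f 4 (sh 1 (sh 3 a)) + f 4 (sh 2 (sh 3 a))) - 8 * f 3 (sh 1 (sh 2 (sh 3 a))))
      - s * (3 * f 6 a - 4 * (f 5 (sh 1 a) + f 5 (sh 2 a) + f 5 (sh 3 a))
        + 4 * (f 4 (sh 1 (sh 2 a)) + f 4 (sh 1 (sh 3 a)) + f 4 (sh 2 (sh 3 a))))
      + (s * (3 * f 6 a - 2 * (f 5 (sh 1 a) + f 5 (sh 2 a) + f 5 (sh 3 a)))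
        - l\<^sup>2 / 4 * (s * (3 * f 4 a - 2 * (f 3 (sh 1 a) + f 3 (sh 2 a) + f 3 (sh 3 a)))))
     = c ^ 6 * mixed_sixth u t v - c ^ 4 * (damped_dt l ^^ 2) (mixed_fourth u) t v
       + c\<^sup>2 * ((damped_dt l ^^ 4) (laplacian u) t v - l\<^sup>2 / 4 * (damped_dt l ^^ 2) (laplacian u) t v)"
    by (subst r0, subst r2, subst rr, subst r44, subst r42, rule refl)
  finally show ?thesis .
qed

section \<open>Integration along rays\<close>

definition Iop :: "'a::euclidean_space \<Rightarrow> ('a \<Rightarrow> ennreal) \<Rightarrow> 'a \<Rightarrow> ennreal" where
  "Iop z f y = (\<integral>\<^sup>+s. f (y + s *\<^sub>R z) * indicator {0..} s \<partial>lborel)"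

lemma Iop_measurable [measurable]:
  assumes [measurable]: "f \<in> borel_measurable borel"
  shows "Iop z f \<in> borel_measurable borel"
  unfolding Iop_def by measurable

lemma Iop_add:
  assumes [measurable]: "f \<in> borel_measurable borel" "g \<in> borel_measurable borel"
  shows "Iop z (\<lambda>y. f y + g y) = (\<lambda>y. Iop z f y + Iop z g y)"
  by (intro ext) (simp add: Iop_def distrib_right nn_integral_add)

lemma Iop_cmult:
  assumes [measurable]: "f \<in> borel_measurable borel"
  shows "Iop z (\<lambda>y. r * f y) = (\<lambda>y. r * Iop z f y)"
  by (intro ext) (simp add: Iop_def mult.assoc nn_integral_cmult)

lemma Iop_sum:
  assumes [measurable]: "\<And>i. f i \<in> borel_measurable borel"
  shows "Iop z (\<lambda>y. \<Sum>i\<in>S. f i y) = (\<lambda>y. \<Sum>i\<in>S. Iop z (f i) y)"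
  by (intro ext) (simp add: Iop_def sum_distrib_right nn_integral_sum)

lemma indicator_shift:
  "(indicator {r<..} s :: ennreal) = indicator {0<..} (s - r)"
  "(indicator {r..} s :: ennreal) = indicator {0..} (s - r)" for r s :: real
  by (auto simp: indicator_def)

lemma Iop_commute:
  assumes [measurable]: "f \<in> borel_measurable borel"
  shows "Iop z (Iop w f) = Iop w (Iop z f)"
proof
  fix y
  have "Iop z (Iop w f) y = (\<integral>\<^sup>+s. \<integral>\<^sup>+r. f (y + s *\<^sub>R z + r *\<^sub>R w) * indicator {0..} r * indicator {0..} s \<partial>lborel \<partial>lborel)"
    by (simp add: Iop_def nn_integral_multc)
  also have "\<dots> = (\<integral>\<^sup>+r. \<integral>\<^sup>+s. f (y + s *\<^sub>R z + r *\<^sub>R w) * indicator {0..} r * indicator {0..} s \<partial>lborel \<partial>lborel)"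
    by (rule lborel_pair.Fubini') measurable
  also have "\<dots> = (\<integral>\<^sup>+r. \<integral>\<^sup>+s. f (y + r *\<^sub>R w + s *\<^sub>R z) * indicator {0..} s * indicator {0..} r \<partial>lborel \<partial>lborel)"
    by (simp add: add_ac mult_ac)
  also have "\<dots> = Iop w (Iop z f) y"
    by (simp add: Iop_def nn_integral_multc)
  finally show "Iop z (Iop w f) y = Iop w (Iop z f) y" .
qed

text \<open>Beyond the parameter r, a ray is the ray that starts at its point r. An open and a
  closed version are required because a pointwise splitting of the quadrant assigns the diagonal to
  one half only.\<close>

lemma Iop_shift_open:
  assumes [measurable]: "f \<in> borel_measurable borel"
  shows "(\<integral>\<^sup>+s. f (y + s *\<^sub>R z) * indicator {r<..} s \<partial>lborel) = Iop z f (y + r *\<^sub>R z)"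
proof -
  have "(\<integral>\<^sup>+s. f (y + s *\<^sub>R z) * indicator {r<..} s \<partial>lborel)
     = (\<integral>\<^sup>+s. f (y + (r + s) *\<^sub>R z) * indicator {r<..} (r + s) \<partial>lborel)"
    by (subst nn_integral_real_affine[where c = 1 and t = r]) (auto simp: add_ac)
  also have "\<dots> = (\<integral>\<^sup>+s. f (y + (r + s) *\<^sub>R z) * indicator {0..} s \<partial>lborel)"
    using AE_lborel_singleton[of "0::real"]
    by (intro nn_integral_cong_AE) (auto simp: indicator_def elim!: eventually_mono)
  finally show ?thesis
    by (simp add: Iop_def algebra_simps)
qed

lemma Iop_shift_closed:
  assumes [measurable]: "f \<in> borel_measurable borel"
  shows "(\<integral>\<^sup>+s. f (y + s *\<^sub>R z) * indicator {r..} s \<partial>lborel) = Iop z f (y + r *\<^sub>R z)"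
proof -
  have "(\<integral>\<^sup>+s. f (y + s *\<^sub>R z) * indicator {r..} s \<partial>lborel)
     = (\<integral>\<^sup>+s. f (y + s *\<^sub>R z) * indicator {r<..} s \<partial>lborel)"
    using AE_lborel_singleton[of r]
    by (intro nn_integral_cong_AE) (auto simp: indicator_def elim!: eventually_mono)
  then show ?thesis by (simp only: Iop_shift_open[OF assms])
qed

text \<open>Split the quadrant of the two integration variables along its diagonal.\<close>

lemma Iop_resolvent:
  assumes [measurable]: "f \<in> borel_measurable borel"
  shows "Iop z (Iop w f) = Iop (z + w) (\<lambda>y. Iop z f y + Iop w f y)"
proof
  fix y
  define G where "G s r = f (y + s *\<^sub>R z + r *\<^sub>R w)" for s r
  have [measurable]: "(\<lambda>(s, r). G s r) \<in> borel_measurable (lborel \<Otimes>\<^sub>M lborel)"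
    unfolding G_def by measurable
  have m1 [measurable]: "(\<lambda>(s, r). G s r * indicator {r<..} s * indicator {0..} r) \<in> borel_measurable (lborel \<Otimes>\<^sub>M lborel)"
    by (subst indicator_shift(1)) measurable
  have m1': "(\<lambda>(r, s). G s r * indicator {r<..} s * indicator {0..} r) \<in> borel_measurable (lborel \<Otimes>\<^sub>M lborel)"
    by (subst indicator_shift(1)) measurable
  have m2 [measurable]: "(\<lambda>(s, r). G s r * indicator {s..} r * indicator {0..} s) \<in> borel_measurable (lborel \<Otimes>\<^sub>M lborel)"
    by (subst indicator_shift(2)) measurable
  have "Iop z (Iop w f) y = (\<integral>\<^sup>+s. \<integral>\<^sup>+r. G s r * indicator {0..} r * indicator {0..} s \<partial>lborel \<partial>lborel)"
    by (simp add: Iop_def nn_integral_multc G_def)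
  also have "\<dots> = (\<integral>\<^sup>+s. \<integral>\<^sup>+r. G s r * indicator {r<..} s * indicator {0..} r
        + G s r * indicator {s..} r * indicator {0..} s \<partial>lborel \<partial>lborel)"
    by (intro nn_integral_cong) (auto simp: indicator_def)
  also have "\<dots> = (\<integral>\<^sup>+s. \<integral>\<^sup>+r. G s r * indicator {r<..} s * indicator {0..} r \<partial>lborel \<partial>lborel)
      + (\<integral>\<^sup>+s. \<integral>\<^sup>+r. G s r * indicator {s..} r * indicator {0..} s \<partial>lborel \<partial>lborel)"
    by (subst nn_integral_add[symmetric]) (auto simp: nn_integral_add)
  also have "(\<integral>\<^sup>+s. \<integral>\<^sup>+r. G s r * indicator {r<..} s * indicator {0..} r \<partial>lborel \<partial>lborel)
      = (\<integral>\<^sup>+r. \<integral>\<^sup>+s. G s r * indicator {r<..} s * indicator {0..} r \<partial>lborel \<partial>lborel)"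
    by (rule lborel_pair.Fubini'[OF m1'])
  also have "\<dots> = (\<integral>\<^sup>+r. Iop z f (y + r *\<^sub>R (z + w)) * indicator {0..} r \<partial>lborel)"
  proof (rule nn_integral_cong)
    fix r :: real
    have "(\<integral>\<^sup>+s. f (y + r *\<^sub>R w + s *\<^sub>R z) * indicator {r<..} s \<partial>lborel) = Iop z f (y + r *\<^sub>R (z + w))"
      by (subst Iop_shift_open) (simp_all add: algebra_simps)
    then show "(\<integral>\<^sup>+s. G s r * indicator {r<..} s * indicator {0..} r \<partial>lborel) = Iop z f (y + r *\<^sub>R (z + w)) * indicator {0..} r"
      by (subst nn_integral_multc) (auto simp: G_def add_ac)
  qed
  also have "(\<integral>\<^sup>+s. \<integral>\<^sup>+r. G s r * indicator {s..} r * indicator {0..} s \<partial>lborel \<partial>lborel)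
      = (\<integral>\<^sup>+s. Iop w f (y + s *\<^sub>R (z + w)) * indicator {0..} s \<partial>lborel)"
  proof (rule nn_integral_cong)
    fix s :: real
    have "(\<integral>\<^sup>+r. f (y + s *\<^sub>R z + r *\<^sub>R w) * indicator {s..} r \<partial>lborel) = Iop w f (y + s *\<^sub>R (z + w))"
      by (subst Iop_shift_closed) (simp_all add: algebra_simps)
    then show "(\<integral>\<^sup>+r. G s r * indicator {s..} r * indicator {0..} s \<partial>lborel) = Iop w f (y + s *\<^sub>R (z + w)) * indicator {0..} s"
      by (subst nn_integral_multc) (auto simp: G_def)
  qed
  also have "(\<integral>\<^sup>+r. Iop z f (y + r *\<^sub>R (z + w)) * indicator {0..} r \<partial>lborel) + (\<integral>\<^sup>+s. Iop w f (y + s *\<^sub>R (z + w)) * indicator {0..} s \<partial>lborel)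
     = Iop (z + w) (\<lambda>y. Iop z f y + Iop w f y) y"
    by (simp add: Iop_def[of "z + w"] distrib_right nn_integral_add)
  finally show "Iop z (Iop w f) y = Iop (z + w) (\<lambda>y. Iop z f y + Iop w f y) y" .
qed

section \<open>Powers of ray operators\<close>

lemma Iop_funpow_measurable [measurable]:
  "f \<in> borel_measurable borel \<Longrightarrow> (Iop z ^^ n) f \<in> borel_measurable borel"
  by (induction n) auto

lemma Iop_funpow_commute:
  "f \<in> borel_measurable borel \<Longrightarrow> (Iop z ^^ n) (Iop w f) = Iop w ((Iop z ^^ n) f)"
  by (induction n) (auto simp: Iop_commute)

lemma Iop_funpow_add:
  "f \<in> borel_measurable borel \<Longrightarrow> g \<in> borel_measurable borel \<Longrightarrow>
    (Iop z ^^ n) (\<lambda>y. f y + g y) = (\<lambda>y. (Iop z ^^ n) f y + (Iop z ^^ n) g y)"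
  by (induction n) (auto simp: Iop_add)

lemma real_power_has_integral:
  assumes "0 \<le> (w::real)"
  shows "(\<integral>\<^sup>+s. ennreal (s ^ n / fact n) * indicator {0..w} s \<partial>lborel) = ennreal (w ^ Suc n / fact (Suc n))"
proof -
  have "(\<integral>\<^sup>+s. ennreal (s ^ n / fact n) * indicator {0..w} s \<partial>lborel) = ennreal (w ^ Suc n / fact (Suc n) - 0 ^ Suc n / fact (Suc n))"
  proof (rule nn_integral_FTC_Icc[where F = "\<lambda>w. w ^ Suc n / fact (Suc n)"])
    fix x :: real
    have "((\<lambda>w. w ^ Suc n / fact (Suc n)) has_real_derivative (real (Suc n) * x ^ n) / fact (Suc n)) (at x)"
      using DERIV_pow[of "Suc n" x UNIV] by (intro DERIV_cdivide) simp
    then show "((\<lambda>w. w ^ Suc n / fact (Suc n)) has_real_derivative x ^ n / fact n) (at x)"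
      by (simp add: field_simps del: of_nat_Suc)
  qed (use assms in auto)
  then show ?thesis by simp
qed

text \<open>Cauchy's formula for repeated integration.\<close>

lemma Iop_funpow_Suc:
  assumes [measurable]: "f \<in> borel_measurable borel"
  shows "(Iop z ^^ Suc n) f y = (\<integral>\<^sup>+s. ennreal (s ^ n / fact n) * f (y + s *\<^sub>R z) * indicator {0..} s \<partial>lborel)"
proof (induction n arbitrary: y)
  case 0
  show ?case by (simp add: Iop_def)
next
  case (Suc n)
  have "(Iop z ^^ Suc (Suc n)) f y = (\<integral>\<^sup>+r. (Iop z ^^ Suc n) f (y + r *\<^sub>R z) * indicator {0..} r \<partial>lborel)"
    by (simp add: Iop_def)
  \<comment> \<open>The variable w = r + s marks the end point on the ray. After exchanging the
    integrals, only (w - r)^n remains to be integrated over r between 0 and w.\<close>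
  also have "\<dots> = (\<integral>\<^sup>+r. (\<integral>\<^sup>+w. ennreal ((w - r) ^ n / fact n) * f (y + w *\<^sub>R z) * indicator {r..} w * indicator {0..} r \<partial>lborel) \<partial>lborel)"
  proof (rule nn_integral_cong)
    fix r :: real
    have "(Iop z ^^ Suc n) f (y + r *\<^sub>R z) = (\<integral>\<^sup>+w. ennreal ((w - r) ^ n / fact n) * f (y + w *\<^sub>R z) * indicator {r..} w \<partial>lborel)"
      unfolding Suc
      by (subst nn_integral_real_affine[where c = 1 and t = "- r"])
         (auto intro!: nn_integral_cong simp: indicator_def algebra_simps)
    then show "(Iop z ^^ Suc n) f (y + r *\<^sub>R z) * indicator {0..} r
      = (\<integral>\<^sup>+w. ennreal ((w - r) ^ n / fact n) * f (y + w *\<^sub>R z) * indicator {r..} w * indicator {0..} r \<partial>lborel)"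
      by (subst nn_integral_multc) auto
  qed
  also have "\<dots> = (\<integral>\<^sup>+w. (\<integral>\<^sup>+r. ennreal ((w - r) ^ n / fact n) * f (y + w *\<^sub>R z) * indicator {r..} w * indicator {0..} r \<partial>lborel) \<partial>lborel)"
    by (rule lborel_pair.Fubini', subst indicator_shift(2)) measurable
  also have "\<dots> = (\<integral>\<^sup>+w. ennreal (w ^ Suc n / fact (Suc n)) * f (y + w *\<^sub>R z) * indicator {0..} w \<partial>lborel)"
  proof (rule nn_integral_cong)
    fix w :: real
    have "(\<integral>\<^sup>+r. ennreal ((w - r) ^ n / fact n) * f (y + w *\<^sub>R z) * indicator {r..} w * indicator {0..} r \<partial>lborel)
       = (\<integral>\<^sup>+r. (ennreal ((w - r) ^ n / fact n) * indicator {0..w} (w - r)) * f (y + w *\<^sub>R z) \<partial>lborel)"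
      by (intro nn_integral_cong) (auto simp: indicator_def)
    also have "\<dots> = (\<integral>\<^sup>+r. (ennreal ((w - r) ^ n / fact n) * indicator {0..w} (w - r)) \<partial>lborel) * f (y + w *\<^sub>R z)"
      by (subst nn_integral_multc) auto
    also have "(\<integral>\<^sup>+r. (ennreal ((w - r) ^ n / fact n) * indicator {0..w} (w - r)) \<partial>lborel)
       = (\<integral>\<^sup>+s. ennreal (s ^ n / fact n) * indicator {0..w} s \<partial>lborel)"
      by (subst (2) nn_integral_real_affine[where c = "-1" and t = w]) auto
    also have "\<dots> = ennreal (w ^ Suc n / fact (Suc n)) * indicator {0..} w"
      using real_power_has_integral[of w n] by (cases "0 \<le> w") auto
    finally show "(\<integral>\<^sup>+r. ennreal ((w - r) ^ n / fact n) * f (y + w *\<^sub>R z) * indicator {r..} w * indicator {0..} r \<partial>lborel)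
       = ennreal (w ^ Suc n / fact (Suc n)) * f (y + w *\<^sub>R z) * indicator {0..} w"
      by (simp add: mult_ac)
  qed
  finally show ?case .
qed

text \<open>
  An array \<open>m i j s\<close> stands for \<open>A\<^sup>i C\<^sup>j B\<^sup>s\<close> with commuting operators satisfying
  \<open>A C = B (A + C)\<close>, and \<open>zeta\<close> for multiplication by \<open>A + C\<close>.
\<close>

definition zeta :: "(nat \<Rightarrow> nat \<Rightarrow> nat \<Rightarrow> ennreal) \<Rightarrow> nat \<Rightarrow> nat \<Rightarrow> nat \<Rightarrow> ennreal" where
  "zeta m i j s = m (Suc i) j s + m i (Suc j) s"

definition resolvent_array :: "(nat \<Rightarrow> nat \<Rightarrow> nat \<Rightarrow> ennreal) \<Rightarrow> bool" where
  "resolvent_array m \<longleftrightarrow> (\<forall>i j s. m (Suc i) (Suc j) s = m (Suc i) j (Suc s) + m i (Suc j) (Suc s))"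

lemma resolvent_array_zeta: "resolvent_array m \<Longrightarrow> resolvent_array (zeta m)"
  by (simp add: resolvent_array_def zeta_def add_ac)

text \<open>Apply A C = B (A + C) to A^(j+1) C again and again. Every application but the last
  splits off a pure power of A; the last one, at A C itself, leaves both A and C.\<close>

lemma resolvent_array_edge:
  assumes "resolvent_array m"
  shows "m (Suc j) 1 t = (\<Sum>r<j. m (Suc j - r) 0 (t + Suc r)) + m 1 0 (t + Suc j) + m 0 1 (t + Suc j)"
    "m 1 (Suc j) t = (\<Sum>r<j. m 0 (Suc j - r) (t + Suc r)) + m 1 0 (t + Suc j) + m 0 1 (t + Suc j)"
proof -
  have rec: "m (Suc i) (Suc j) s = m (Suc i) j (Suc s) + m i (Suc j) (Suc s)" for i j s
    using assms by (simp add: resolvent_array_def)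
  show "m (Suc j) 1 t = (\<Sum>r<j. m (Suc j - r) 0 (t + Suc r)) + m 1 0 (t + Suc j) + m 0 1 (t + Suc j)"
  proof (induction j arbitrary: t)
    case 0
    then show ?case using rec[of 0 0 t] by simp
  next
    case (Suc j)
    have "m (Suc (Suc j)) 1 t = m (Suc (Suc j)) 0 (Suc t) + m (Suc j) 1 (Suc t)"
      using rec[of "Suc j" 0 t] by simp
    then show ?case
      unfolding Suc by (subst sum.lessThan_Suc_shift) (simp add: add_ac)
  qed
  show "m 1 (Suc j) t = (\<Sum>r<j. m 0 (Suc j - r) (t + Suc r)) + m 1 0 (t + Suc j) + m 0 1 (t + Suc j)"
  proof (induction j arbitrary: t)
    case 0
    then show ?case using rec[of 0 0 t] by simp
  next
    case (Suc j)
    have "m 1 (Suc (Suc j)) t = m 1 (Suc j) (Suc t) + m 0 (Suc (Suc j)) (Suc t)"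
      using rec[of 0 "Suc j" t] by simp
    then show ?case
      unfolding Suc by (subst sum.lessThan_Suc_shift) (simp add: add_ac)
  qed
qed

text \<open>The induction multiplies by A + C on the inside, that is, the hypothesis is used for
  \<open>zeta m\<close>. The power sums A^j + C^j then collect partial sums of binomials, which the
  hockey-stick identity \<open>sum_choose_lower\<close> evaluates.\<close>

lemma zeta_funpow:
  assumes "resolvent_array m"
  shows "(zeta ^^ Suc k) m 0 0 t = (\<Sum>s\<le>k. of_nat ((k + s) choose s) * (m (Suc k - s) 0 (t + s) + m 0 (Suc k - s) (t + s)))"
  using assms
proof (induction k arbitrary: m)
  case 0
  then show ?case by (simp add: zeta_def)
next
  case (Suc k)
  define W where "W j t = m j 0 t + m 0 j t" for j t
  have z: "zeta m (Suc j) 0 t + zeta m 0 (Suc j) t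
      = (\<Sum>r\<le>j. W (Suc (Suc j) - r) (t + r)) + 2 * W 1 (t + Suc j)" for j t
  proof -
    have "zeta m (Suc j) 0 t + zeta m 0 (Suc j) t = W (Suc (Suc j)) t + (m (Suc j) 1 t + m 1 (Suc j) t)"
      by (simp add: zeta_def W_def add_ac)
    also have "m (Suc j) 1 t + m 1 (Suc j) t = (\<Sum>r<j. W (Suc j - r) (t + Suc r)) + 2 * W 1 (t + Suc j)"
      unfolding resolvent_array_edge[OF Suc.prems] W_def sum.distrib mult_2
      by (simp only: add_ac)
    also have "W (Suc (Suc j)) t + ((\<Sum>r<j. W (Suc j - r) (t + Suc r)) + 2 * W 1 (t + Suc j))
       = (\<Sum>r<Suc j. W (Suc (Suc j) - r) (t + r)) + 2 * W 1 (t + Suc j)"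
      unfolding sum.lessThan_Suc_shift by (simp only: diff_zero add_0_right diff_Suc_Suc add.assoc)
    finally show ?thesis
      unfolding lessThan_Suc_atMost .
  qed
  have "(zeta ^^ Suc (Suc k)) m 0 0 t = (zeta ^^ Suc k) (zeta m) 0 0 t"
    by (simp only: funpow_Suc_right comp_def)
  also have "\<dots> = (\<Sum>s\<le>k. of_nat ((k + s) choose s) * (zeta m (Suc (k - s)) 0 (t + s) + zeta m 0 (Suc (k - s)) (t + s)))"
    unfolding Suc.IH[OF resolvent_array_zeta[OF Suc.prems]] by (intro sum.cong refl) (simp add: Suc_diff_le)
  also have "\<dots> = (\<Sum>s\<le>k. \<Sum>r\<le>k - s. of_nat ((k + s) choose s) * W (Suc (Suc k) - (s + r)) (t + (s + r)))
      + 2 * of_nat (\<Sum>s\<le>k. (k + s) choose s) * W 1 (t + Suc k)"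
    unfolding z distrib_left sum.distrib
  proof (rule arg_cong2[where f = "(+)"])
    show "(\<Sum>s\<le>k. of_nat (k + s choose s) * (\<Sum>r\<le>k - s. W (Suc (Suc (k - s)) - r) (t + s + r)))
      = (\<Sum>s\<le>k. \<Sum>r\<le>k - s. of_nat (k + s choose s) * W (Suc (Suc k) - (s + r)) (t + (s + r)))"
      unfolding sum_distrib_left by (intro sum.cong refl) (simp add: add_ac Suc_diff_le diff_diff_eq)
    show "(\<Sum>s\<le>k. of_nat (k + s choose s) * (2 * W 1 (t + s + Suc (k - s))))
      = 2 * of_nat (\<Sum>s\<le>k. k + s choose s) * W 1 (t + Suc k)"
      unfolding of_nat_sum sum_distrib_left sum_distrib_right
      by (intro sum.cong refl) (simp add: mult_ac)
  qed
  also have "(\<Sum>s\<le>k. \<Sum>r\<le>k - s. of_nat ((k + s) choose s) * W (Suc (Suc k) - (s + r)) (t + (s + r)))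
     = (\<Sum>q\<le>k. of_nat (Suc k + q choose q) * W (Suc (Suc k) - q) (t + q))"
  proof -
    have "(\<Sum>s\<le>k. \<Sum>r\<le>k - s. of_nat ((k + s) choose s) * W (Suc (Suc k) - (s + r)) (t + (s + r)))
       = (\<Sum>(s, r)\<in>{(s, r). s + r \<le> k}. of_nat ((k + s) choose s) * W (Suc (Suc k) - (s + r)) (t + (s + r)))"
    proof -
      have "{(s, r). s + r \<le> k} = Sigma {..k} (\<lambda>s. {..k - s})" by auto
      then show ?thesis by (simp add: sum.Sigma)
    qed
    also have "\<dots> = (\<Sum>q\<le>k. \<Sum>s\<le>q. of_nat ((k + s) choose s) * W (Suc (Suc k) - (s + (q - s))) (t + (s + (q - s))))"
      by (rule sum.triangle_reindex_eq)
    also have "\<dots> = (\<Sum>q\<le>k. of_nat (\<Sum>s\<le>q. (k + s) choose s) * W (Suc (Suc k) - q) (t + q))"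
      unfolding of_nat_sum sum_distrib_right by (intro sum.cong refl) auto
    finally show ?thesis by (simp only: sum_choose_lower add_Suc)
  qed
  \<comment> \<open>\<open>W 1\<close> arises from both edges, hence the 2. Symmetry of the
    binomials makes the doubled value a central one, so the boundary term fits the general
    pattern.\<close>
  also have "2 * of_nat (\<Sum>s\<le>k. (k + s) choose s) = (of_nat (Suc k + Suc k choose Suc k) :: ennreal)"
  proof -
    have "Suc (k + k) choose Suc k = Suc (k + k) choose (Suc (k + k) - Suc k)"
      by (rule binomial_symmetric) simp
    then have "Suc (k + k) choose Suc k = Suc (k + k) choose k"
      by (simp only: diff_Suc_Suc diff_add_inverse)
    moreover have "(Suc k + Suc k choose Suc k) = (Suc (k + k) choose k) + (Suc (k + k) choose Suc k)"
      unfolding add_Suc add_Suc_right by (rule binomial_Suc_Suc)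
    ultimately have "(Suc k + Suc k choose Suc k) = 2 * (Suc (k + k) choose k)"
      by simp
    then show ?thesis unfolding sum_choose_lower by (simp only: of_nat_mult of_nat_numeral)
  qed
  finally show ?case by (simp add: W_def)
qed

section \<open>Two-sided ray operators\<close>

definition Zop :: "'a::euclidean_space \<Rightarrow> 'a \<Rightarrow> ('a \<Rightarrow> ennreal) \<Rightarrow> 'a \<Rightarrow> ennreal" where
  "Zop z w f y = Iop z f y + Iop w f y"

lemma Zop_measurable [measurable]:
  assumes [measurable]: "f \<in> borel_measurable borel"
  shows "Zop z w f \<in> borel_measurable borel"
  unfolding Zop_def by measurable

lemma Zop_funpow_measurable [measurable]:
  "f \<in> borel_measurable borel \<Longrightarrow> (Zop z w ^^ n) f \<in> borel_measurable borel"
  by (induction n) auto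

definition op_array :: "'a::euclidean_space \<Rightarrow> 'a \<Rightarrow> ('a \<Rightarrow> ennreal) \<Rightarrow> 'a \<Rightarrow> nat \<Rightarrow> nat \<Rightarrow> nat \<Rightarrow> ennreal" where
  "op_array z w f y i j s = (Iop z ^^ i) ((Iop w ^^ j) ((Iop (z + w) ^^ s) f)) y"

lemma op_array_resolvent:
  assumes [measurable]: "f \<in> borel_measurable borel"
  shows "resolvent_array (op_array z w f y)"
  unfolding resolvent_array_def op_array_def
proof (intro allI)
  fix i j s
  define g where "g = (Iop w ^^ j) ((Iop (z + w) ^^ s) f)"
  have [measurable]: "g \<in> borel_measurable borel" unfolding g_def by measurable
  have g: "(Iop w ^^ j) ((Iop (z + w) ^^ Suc s) f) = Iop (z + w) g"
    by (simp add: g_def Iop_funpow_commute)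
  have "(Iop z ^^ Suc i) ((Iop w ^^ Suc j) ((Iop (z + w) ^^ s) f)) = (Iop z ^^ i) (Iop z (Iop w g))"
    by (simp only: g_def funpow_Suc_right[of i] funpow.simps(2)[of j] comp_def)
  also have "Iop z (Iop w g) = (\<lambda>y. Iop z (Iop (z + w) g) y + Iop w (Iop (z + w) g) y)"
    unfolding Iop_resolvent[OF \<open>g \<in> borel_measurable borel\<close>, of z w]
    by (simp add: Iop_add Iop_commute[of g "z + w"])
  also have "(Iop z ^^ i) \<dots> = (\<lambda>y. (Iop z ^^ i) (Iop z (Iop (z + w) g)) y + (Iop z ^^ i) (Iop w (Iop (z + w) g)) y)"
    by (rule Iop_funpow_add) measurable
  finally show "(Iop z ^^ Suc i) ((Iop w ^^ Suc j) ((Iop (z + w) ^^ s) f)) y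
      = (Iop z ^^ Suc i) ((Iop w ^^ j) ((Iop (z + w) ^^ Suc s) f)) y
      + (Iop z ^^ i) ((Iop w ^^ Suc j) ((Iop (z + w) ^^ Suc s) f)) y"
    by (simp only: g funpow_Suc_right[of i] funpow.simps(2)[of j] comp_def g_def[symmetric])
qed

lemma op_array_Zop:
  assumes [measurable]: "f \<in> borel_measurable borel"
  shows "op_array z w (Zop z w f) y = zeta (op_array z w f y)"
proof (intro ext)
  fix i j s
  have "(Iop (z + w) ^^ s) (Zop z w f) = (\<lambda>y. Iop z ((Iop (z + w) ^^ s) f) y + Iop w ((Iop (z + w) ^^ s) f) y)"
    unfolding Zop_def by (subst Iop_funpow_add) (auto simp: Iop_funpow_commute)
  then show "op_array z w (Zop z w f) y i j s = zeta (op_array z w f y) i j s"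
    unfolding op_array_def zeta_def
    by (simp add: Iop_funpow_add Iop_funpow_commute)
qed

lemma Zop_funpow_array:
  "f \<in> borel_measurable borel \<Longrightarrow> (Zop z w ^^ k) f y = (zeta ^^ k) (op_array z w f y) 0 0 0"
proof (induction k arbitrary: f)
  case 0
  then show ?case by (simp add: op_array_def)
next
  case (Suc k)
  have "(Zop z w ^^ Suc k) f y = (Zop z w ^^ k) (Zop z w f) y"
    by (simp only: funpow_Suc_right comp_def)
  also have "\<dots> = (zeta ^^ k) (op_array z w (Zop z w f) y) 0 0 0"
    using Suc by simp
  finally show ?case
    using Suc.prems by (simp only: op_array_Zop funpow_Suc_right comp_def)
qed

definition Wop :: "'a::euclidean_space \<Rightarrow> 'a \<Rightarrow> nat \<Rightarrow> ('a \<Rightarrow> ennreal) \<Rightarrow> 'a \<Rightarrow> ennreal" where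
  "Wop z w n f y = (Iop z ^^ Suc n) f y + (Iop w ^^ Suc n) f y"

lemma Wop_measurable [measurable]:
  assumes [measurable]: "f \<in> borel_measurable borel"
  shows "Wop z w n f \<in> borel_measurable borel"
  unfolding Wop_def by measurable

text \<open>No product of opposite operators is left: pure one-sided powers and powers of
  \<open>Iop (z + w)\<close> have explicit kernels by \<open>Iop_funpow_Suc\<close>.\<close>

lemma Zop_funpow_Suc:
  assumes [measurable]: "f \<in> borel_measurable borel"
  shows "(Zop z w ^^ Suc k) f y
    = (\<Sum>s\<le>k. of_nat ((k + s) choose s) * Wop z w (k - s) ((Iop (z + w) ^^ s) f) y)"
  unfolding Zop_funpow_array[OF assms] zeta_funpow[OF op_array_resolvent[OF assms]]
  by (intro sum.cong refl) (simp add: op_array_def Wop_def Suc_diff_le)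

section \<open>Summation over the numbers of steps\<close>

type_synonym pt = "real \<times> (real ^ 3)"

definition zp :: "real \<Rightarrow> 3 \<Rightarrow> pt" where "zp c i = (1, c *\<^sub>R axis i 1)"
definition zm :: "real \<Rightarrow> 3 \<Rightarrow> pt" where "zm c i = (1, - c *\<^sub>R axis i 1)"

text \<open>Opposite velocities cancel in space, so the resolvent identity produces a pure time
  integral, the same one for all three axes.\<close>

lemma zp_add_zm: "zp c i + zm c i = (2, 0)"
  by (simp add: zp_def zm_def)

abbreviation Zax :: "real \<Rightarrow> 3 \<Rightarrow> (pt \<Rightarrow> ennreal) \<Rightarrow> pt \<Rightarrow> ennreal" where
  "Zax c i \<equiv> Zop (zp c i) (zm c i)"

abbreviation Wax :: "real \<Rightarrow> 3 \<Rightarrow> nat \<Rightarrow> (pt \<Rightarrow> ennreal) \<Rightarrow> pt \<Rightarrow> ennreal" where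
  "Wax c i \<equiv> Wop (zp c i) (zm c i)"

abbreviation Bop :: "(pt \<Rightarrow> ennreal) \<Rightarrow> pt \<Rightarrow> ennreal" where
  "Bop \<equiv> Iop (2, 0)"

lemma Iop_funpow_combo:
  assumes [measurable]: "\<And>i. g i \<in> borel_measurable borel"
  shows "(Iop z ^^ n) (\<lambda>y. \<Sum>i\<in>S. r i * g i y) = (\<lambda>y. \<Sum>i\<in>S. r i * (Iop z ^^ n) (g i) y)"
proof (induction n)
  case (Suc n)
  show ?case
    by (simp add: Suc Iop_sum Iop_cmult)
qed simp

lemma Wop_combo:
  assumes [measurable]: "\<And>i. g i \<in> borel_measurable borel"
  shows "Wop z w n (\<lambda>y. \<Sum>i\<in>S. r i * g i y) = (\<lambda>y. \<Sum>i\<in>S. r i * Wop z w n (g i) y)"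
  unfolding Wop_def Iop_funpow_combo[OF assms] by (simp add: distrib_left sum.distrib)

lemma Iop_funpow_funpow_commute:
  assumes "f \<in> borel_measurable borel"
  shows "(Iop z ^^ n) ((Iop w ^^ m) f) = (Iop w ^^ m) ((Iop z ^^ n) f)"
  using assms by (induction m) (auto simp: Iop_funpow_commute)

lemma Iop_funpow_Wop:
  assumes [measurable]: "f \<in> borel_measurable borel"
  shows "(Iop z ^^ s) (Wop u w n f) = Wop u w n ((Iop z ^^ s) f)"
proof
  fix y
  have "Wop u w n f = (\<lambda>y. (Iop u ^^ Suc n) f y + (Iop w ^^ Suc n) f y)"
    by (intro ext) (simp only: Wop_def)
  then show "(Iop z ^^ s) (Wop u w n f) y = Wop u w n ((Iop z ^^ s) f) y"
    unfolding Wop_def[of u w n "(Iop z ^^ s) f"]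
    by (simp only: Iop_funpow_add[OF Iop_funpow_measurable[OF assms] Iop_funpow_measurable[OF assms]]
        Iop_funpow_funpow_commute[OF assms, where z = z and n = s])
qed

lemma Zax_funpow_Suc:
  assumes "f \<in> borel_measurable borel"
  shows "(Zax c i ^^ Suc k) f = (\<lambda>y. \<Sum>s\<le>k. of_nat ((k + s) choose s) * Wax c i (k - s) ((Bop ^^ s) f) y)"
  by (intro ext) (simp only: Zop_funpow_Suc[OF assms] zp_add_zm)

definition T3 :: "real \<Rightarrow> (pt \<Rightarrow> ennreal) \<Rightarrow> nat \<times> nat \<times> nat \<Rightarrow> ennreal" where
  "T3 c f = (\<lambda>(i, j, k). (Zax c 1 ^^ i) ((Zax c 2 ^^ j) ((Zax c 3 ^^ k) f)) 0)"

definition W3 :: "real \<Rightarrow> (pt \<Rightarrow> ennreal) \<Rightarrow> nat \<times> nat \<times> nat \<Rightarrow> nat \<Rightarrow> ennreal" where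
  "W3 c f = (\<lambda>(i, j, k) s. Wax c 1 i (Wax c 2 j (Wax c 3 k ((Bop ^^ s) f))) 0)"

definition bin3 :: "nat \<times> nat \<times> nat \<Rightarrow> nat \<times> nat \<times> nat \<Rightarrow> ennreal" where
  "bin3 = (\<lambda>(i, j, k) (p, q, r). of_nat ((i + p) choose p) * of_nat ((j + q) choose q) * of_nat ((k + r) choose r))"

definition box3 :: "nat \<times> nat \<times> nat \<Rightarrow> (nat \<times> nat \<times> nat) set" where
  "box3 = (\<lambda>(i, j, k). {..i} \<times> {..j} \<times> {..k})"

definition total3 :: "nat \<times> nat \<times> nat \<Rightarrow> nat" where
  "total3 = (\<lambda>(p, q, r). p + q + r)"

definition suc3 :: "nat \<times> nat \<times> nat \<Rightarrow> nat \<times> nat \<times> nat" where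
  "suc3 = (\<lambda>(i, j, k). (Suc i, Suc j, Suc k))"

text \<open>Expand one axis after the other. The factors \<open>Bop\<close> from different axes are
  one operator that commutes with the rest, so only their total number is recorded.\<close>

lemma T3_suc3:
  assumes [measurable]: "f \<in> borel_measurable borel"
  shows "T3 c f (suc3 k) = (\<Sum>s\<in>box3 k. bin3 k s * W3 c f (k - s) (total3 s))"
proof -
  obtain k1 k2 k3 where k: "k = (k1, k2, k3)" by (cases k)
  have 3: "(Zax c 3 ^^ Suc k3) f = (\<lambda>y. \<Sum>r\<le>k3. of_nat ((k3 + r) choose r) * Wax c 3 (k3 - r) ((Bop ^^ r) f) y)"
    by (rule Zax_funpow_Suc) measurable
  have 2: "(Zax c 2 ^^ Suc k2) ((Zax c 3 ^^ Suc k3) f)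
    = (\<lambda>y. \<Sum>q\<le>k2. of_nat ((k2 + q) choose q) * (\<Sum>r\<le>k3. of_nat ((k3 + r) choose r) * Wax c 2 (k2 - q) (Wax c 3 (k3 - r) ((Bop ^^ (q + r)) f)) y))"
    by (subst Zax_funpow_Suc, measurable) (simp only: 3 Iop_funpow_combo Wop_combo Iop_funpow_Wop
      Wop_measurable Iop_funpow_measurable assms funpow_add comp_def)
  \<comment> \<open>Flattening to a single sum over pairs makes the combination lemmas applicable
    once more for the first axis.\<close>
  have 2: "(Zax c 2 ^^ Suc k2) ((Zax c 3 ^^ Suc k3) f)
    = (\<lambda>y. \<Sum>x\<in>{..k2} \<times> {..k3}. (of_nat ((k2 + fst x) choose fst x) * of_nat ((k3 + snd x) choose snd x))
        * Wax c 2 (k2 - fst x) (Wax c 3 (k3 - snd x) ((Bop ^^ (fst x + snd x)) f)) y)"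
    unfolding 2 sum.cartesian_product' sum_distrib_left by (simp only: mult.assoc fst_conv snd_conv)
  have "(Zax c 1 ^^ Suc k1) ((Zax c 2 ^^ Suc k2) ((Zax c 3 ^^ Suc k3) f))
    = (\<lambda>y. \<Sum>p\<le>k1. of_nat ((k1 + p) choose p) * (\<Sum>x\<in>{..k2} \<times> {..k3}. (of_nat ((k2 + fst x) choose fst x) * of_nat ((k3 + snd x) choose snd x))
       * Wax c 1 (k1 - p) (Wax c 2 (k2 - fst x) (Wax c 3 (k3 - snd x) ((Bop ^^ (p + (fst x + snd x))) f))) y))"
    by (subst Zax_funpow_Suc, measurable) (simp only: 2 Iop_funpow_combo Wop_combo Iop_funpow_Wop
      Wop_measurable Iop_funpow_measurable assms funpow_add comp_def)
  then show ?thesis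
    unfolding T3_def k suc3_def box3_def W3_def bin3_def total3_def
    by (simp add: sum.cartesian_product' sum_distrib_left mult.assoc add.assoc)
qed

section \<open>Kernels of the expanded operators\<close>

definition powf :: "real \<Rightarrow> nat \<Rightarrow> real \<Rightarrow> ennreal" where
  "powf c n x = ennreal ((\<bar>x\<bar> / c) ^ n / fact n)"

lemma powf_measurable [measurable]: "powf c n \<in> borel_measurable borel"
  unfolding powf_def by measurable

text \<open>The two opposite rays are the halves s >= 0 and s <= 0 of one line. The substitution x =
  c s contributes 1 / c, and reaching x takes the time |x| / c.\<close>

lemma Wax_eq:
  assumes c: "0 < c" and [measurable]: "f \<in> borel_measurable borel"
  shows "Wax c i n f y = ennreal (1 / c) * (\<integral>\<^sup>+x. powf c n x * f (y + (\<bar>x\<bar> / c, x *\<^sub>R axis i 1)) \<partial>lborel)"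
proof -
  define F where "F s = ennreal (\<bar>s\<bar> ^ n / fact n) * f (y + (\<bar>s\<bar>, (c * s) *\<^sub>R axis i 1))" for s :: real
  have [measurable]: "F \<in> borel_measurable borel" unfolding F_def by measurable
  have p: "(Iop (zp c i) ^^ Suc n) f y = (\<integral>\<^sup>+s. F s * indicator {0..} s \<partial>lborel)"
    unfolding Iop_funpow_Suc[OF assms(2)] F_def
    by (intro nn_integral_cong) (auto simp: indicator_def zp_def mult.commute)
  have m: "(Iop (zm c i) ^^ Suc n) f y = (\<integral>\<^sup>+s. F s * indicator {..0} s \<partial>lborel)"
  proof -
    have "(\<integral>\<^sup>+s. F s * indicator {..0} s \<partial>lborel) = (\<integral>\<^sup>+s. F (- s) * indicator {..0} (- s) \<partial>lborel)"
      by (subst nn_integral_real_affine[where c = "- 1" and t = 0]) auto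
    then show ?thesis
      unfolding Iop_funpow_Suc[OF assms(2)] F_def
      by (auto intro!: nn_integral_cong simp: indicator_def zm_def mult.commute)
  qed
  have "Wax c i n f y = (\<integral>\<^sup>+s. F s * indicator {0..} s + F s * indicator {..0} s \<partial>lborel)"
    unfolding Wop_def p m by (rule nn_integral_add[symmetric]) measurable
  also have "\<dots> = (\<integral>\<^sup>+s. F s \<partial>lborel)"
    using AE_lborel_singleton[of "0::real"]
    by (intro nn_integral_cong_AE) (auto simp: indicator_def elim!: eventually_mono)
  also have "\<dots> = ennreal (1 / c) * (\<integral>\<^sup>+x. powf c n x * f (y + (\<bar>x\<bar> / c, x *\<^sub>R axis i 1)) \<partial>lborel)"
    using c by (subst nn_integral_real_affine[where c = "1 / c" and t = 0])
      (auto simp: F_def powf_def abs_mult)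
  finally show ?thesis .
qed

definition vec3 :: "real \<Rightarrow> real \<Rightarrow> real \<Rightarrow> real ^ 3" where
  "vec3 x y z = x *\<^sub>R axis 1 1 + y *\<^sub>R axis 2 1 + z *\<^sub>R axis 3 1"

lemma vec3_nth [simp]: "vec3 x y z $ 1 = x" "vec3 x y z $ 2 = y" "vec3 x y z $ 3 = z"
  by (simp_all add: vec3_def axis_def)

lemma Basis_vec3: "(Basis :: (real ^ 3) set) = {axis 1 1, axis 2 1, axis 3 1}"
proof -
  have "(Basis :: (real ^ 3) set) = (\<lambda>i. axis i 1) ` UNIV"
    by (auto simp: Basis_vec_def)
  also have "(UNIV :: 3 set) = {1, 2, 3}" by (rule UNIV_3)
  finally show ?thesis by simp
qed

lemma axis3_neq: "axis (1::3) (1::real) \<noteq> axis 2 1" "axis (1::3) (1::real) \<noteq> axis 3 1" "axis (2::3) (1::real) \<noteq> axis 3 1"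
  by (simp_all add: axis_eq_axis)

text \<open>Lebesgue measure is the image of a product measure indexed by the three basis vectors;
  the factors are split off one at a time, axis 3 first.\<close>

lemma nn_integral_vec3:
  fixes f :: "real ^ 3 \<Rightarrow> ennreal"
  assumes [measurable]: "f \<in> borel_measurable borel"
  shows "(\<integral>\<^sup>+v. f v \<partial>lborel) = (\<integral>\<^sup>+x. \<integral>\<^sup>+y. \<integral>\<^sup>+z. f (vec3 x y z) \<partial>lborel \<partial>lborel \<partial>lborel)"
proof -
  interpret product_sigma_finite "\<lambda>_. lborel :: real measure" by standard
  let ?P = "\<lambda>I. \<Pi>\<^sub>M b\<in>I. (lborel :: real measure)"
  define F where "F g = f (\<Sum>b\<in>Basis. g b *\<^sub>R b)" for g :: "real ^ 3 \<Rightarrow> real"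
  let ?I1 = "{axis 1 1} :: (real ^ 3) set" and ?I2 = "{axis 2 1, axis 1 1} :: (real ^ 3) set"
  have B: "Basis = insert (axis 3 1) ?I2" by (auto simp: Basis_vec3)
  have [measurable]: "F \<in> borel_measurable (?P Basis)"
    unfolding F_def by measurable
  have F: "F g = f (vec3 (g (axis 1 1)) (g (axis 2 1)) (g (axis 3 1)))" for g
    unfolding F_def vec3_def Basis_vec3 using axis3_neq by (simp add: add_ac)
  have m: "(\<lambda>(g, z). f (vec3 (g (axis 1 1)) (g (axis 2 1)) z)) \<in> borel_measurable (?P ?I2 \<Otimes>\<^sub>M lborel)"
    unfolding vec3_def by measurable
  have mm: "(\<lambda>g. \<integral>\<^sup>+z. f (vec3 (g (axis 1 1)) (g (axis 2 1)) z) \<partial>lborel) \<in> borel_measurable (?P ?I2)"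
    using lborel.borel_measurable_nn_integral[OF m] by simp
  have mm1: "(\<lambda>g. \<integral>\<^sup>+y. \<integral>\<^sup>+z. f (vec3 (g (axis 1 1)) y z) \<partial>lborel \<partial>lborel) \<in> borel_measurable (?P ?I1)"
    unfolding vec3_def by measurable
  have "(\<integral>\<^sup>+v. f v \<partial>lborel) = (\<integral>\<^sup>+g. F g \<partial>?P Basis)"
    unfolding lborel_def[where 'a = "real ^ 3"] F_def
    by (subst nn_integral_distr) (auto simp: lborel_eq_real)
  also have "\<dots> = (\<integral>\<^sup>+g. \<integral>\<^sup>+z. F (g(axis 3 1 := z)) \<partial>lborel \<partial>?P ?I2)"
    unfolding B by (rule product_nn_integral_insert) (use axis3_neq B in auto)
  also have "\<dots> = (\<integral>\<^sup>+g. \<integral>\<^sup>+z. f (vec3 (g (axis 1 1)) (g (axis 2 1)) z) \<partial>lborel \<partial>?P ?I2)"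
    unfolding F using axis3_neq by simp
  also have "\<dots> = (\<integral>\<^sup>+g. \<integral>\<^sup>+y. (\<integral>\<^sup>+z. f (vec3 ((g(axis 2 1 := y)) (axis 1 1)) ((g(axis 2 1 := y)) (axis 2 1)) z) \<partial>lborel) \<partial>lborel \<partial>?P ?I1)"
    by (rule product_nn_integral_insert[OF _ _ mm]) (use axis3_neq in auto)
  also have "\<dots> = (\<integral>\<^sup>+g. \<integral>\<^sup>+y. \<integral>\<^sup>+z. f (vec3 (g (axis 1 1)) y z) \<partial>lborel \<partial>lborel \<partial>?P ?I1)"
    using axis3_neq by simp
  also have "\<dots> = (\<integral>\<^sup>+x. \<integral>\<^sup>+y. \<integral>\<^sup>+z. f (vec3 x y z) \<partial>lborel \<partial>lborel \<partial>lborel)"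
    by (rule product_nn_integral_singleton) (unfold vec3_def, measurable)
  finally show ?thesis .
qed

text \<open>The least time in which axis-parallel motion with speed c leads from the origin to
  v.\<close>

definition tau :: "real \<Rightarrow> real ^ 3 \<Rightarrow> real" where
  "tau c v = (\<bar>v $ 1\<bar> + \<bar>v $ 2\<bar> + \<bar>v $ 3\<bar>) / c"

lemma borel_measurable_nth3 [measurable]: "(\<lambda>v :: real ^ 3. v $ i) \<in> borel_measurable borel"
  by (intro borel_measurable_continuous_onI continuous_intros)

lemma tau_measurable [measurable]: "tau c \<in> borel_measurable borel"
  unfolding tau_def by measurable

definition pow3 :: "real \<Rightarrow> nat \<times> nat \<times> nat \<Rightarrow> real ^ 3 \<Rightarrow> ennreal" where
  "pow3 c = (\<lambda>(i, j, k) v. powf c i (v $ 1) * powf c j (v $ 2) * powf c k (v $ 3))"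

lemma pow3_measurable [measurable]: "pow3 c a \<in> borel_measurable borel"
  unfolding pow3_def split_beta by measurable

lemma W3_eq:
  assumes c: "0 < c" and [measurable]: "f \<in> borel_measurable borel"
  shows "W3 c f a s = ennreal (1 / c ^ 3) * (\<integral>\<^sup>+v. pow3 c a v * (Bop ^^ s) f (tau c v, v) \<partial>lborel)"
proof -
  obtain i j k where a: "a = (i, j, k)" by (cases a)
  define g where "g = (Bop ^^ s) f"
  have [measurable]: "g \<in> borel_measurable borel" unfolding g_def by measurable
  have [measurable]: "vec3 x y \<in> borel_measurable borel" for x y
    unfolding vec3_def by measurable
  have e: "(0 + (\<bar>x\<bar> / c, x *\<^sub>R axis 1 1) + (\<bar>y\<bar> / c, y *\<^sub>R axis 2 1) + (\<bar>z\<bar> / c, z *\<^sub>R axis 3 1) :: pt)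
      = (tau c (vec3 x y z), vec3 x y z)" for x y z
    unfolding tau_def vec3_nth by (simp add: vec3_def add_divide_distrib zero_prod_def)
  have "W3 c f a s = ennreal (1 / c) * (\<integral>\<^sup>+x. powf c i x * (ennreal (1 / c) * (\<integral>\<^sup>+y. powf c j y * (ennreal (1 / c) * (\<integral>\<^sup>+z. powf c k z *
      g (tau c (vec3 x y z), vec3 x y z) \<partial>lborel)) \<partial>lborel)) \<partial>lborel)"
    unfolding W3_def a prod.case g_def[symmetric]
    by (subst Wax_eq[OF c], measurable, subst Wax_eq[OF c], measurable, subst Wax_eq[OF c], measurable)
       (simp only: e)
  also have "\<dots> = ennreal (1 / c) * (ennreal (1 / c) * (ennreal (1 / c) * (\<integral>\<^sup>+x. \<integral>\<^sup>+y. \<integral>\<^sup>+z. 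
      pow3 c a (vec3 x y z) * g (tau c (vec3 x y z), vec3 x y z) \<partial>lborel \<partial>lborel \<partial>lborel)))"
  proof -
    define G where "G x y z = g (tau c (vec3 x y z), vec3 x y z)" for x y z
    define Z where "Z x y = (\<integral>\<^sup>+z. powf c k z * G x y z \<partial>lborel)" for x y
    define Y where "Y x = (\<integral>\<^sup>+y. powf c j y * Z x y \<partial>lborel)" for x
    have [measurable (raw)]: "(\<lambda>p. G (A p) (B p) (C p)) \<in> borel_measurable M"
      if [measurable]: "A \<in> borel_measurable M" "B \<in> borel_measurable M" "C \<in> borel_measurable M"
      for A B C and M :: "'m measure"
      unfolding G_def tau_def vec3_def by measurable
    have [measurable]: "(\<lambda>p. Z (fst p) (snd p)) \<in> borel_measurable (lborel \<Otimes>\<^sub>M lborel)" "Z x \<in> borel_measurable lborel" for x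
      unfolding Z_def by measurable
    have [measurable]: "Y \<in> borel_measurable lborel"
      unfolding Y_def using \<open>(\<lambda>p. Z (fst p) (snd p)) \<in> borel_measurable (lborel \<Otimes>\<^sub>M lborel)\<close>
      by (intro lborel.borel_measurable_nn_integral) (simp add: split_beta)
    have 1: "(\<integral>\<^sup>+z. pow3 c a (vec3 x y z) * G x y z \<partial>lborel) = powf c i x * (powf c j y * Z x y)" for x y
      unfolding Z_def a pow3_def by (simp add: nn_integral_cmult mult.assoc)
    have 2: "(\<integral>\<^sup>+y. powf c i x * (powf c j y * Z x y) \<partial>lborel) = powf c i x * Y x" for x
      unfolding Y_def by (simp add: nn_integral_cmult)
    have 3: "(\<integral>\<^sup>+y. powf c j y * (C * Z x y) \<partial>lborel) = C * Y x" for x C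
      unfolding Y_def by (subst nn_integral_cmult[symmetric], measurable) (intro nn_integral_cong mult.left_commute)
    have 4: "(\<integral>\<^sup>+x. powf c i x * (C * (C * Y x)) \<partial>lborel) = C * (C * (\<integral>\<^sup>+x. powf c i x * Y x \<partial>lborel))" for C
      unfolding mult.assoc[symmetric, of C C]
      by (subst nn_integral_cmult[symmetric], measurable) (intro nn_integral_cong mult.left_commute)
    show ?thesis
      unfolding G_def[symmetric] 1 2 Z_def[symmetric] 3 4 ..
  qed
  also have "ennreal (1 / c) * (ennreal (1 / c) * (ennreal (1 / c) * X)) = ennreal (1 / c ^ 3) * X" for X
    using c by (simp add: ennreal_mult[symmetric] mult.assoc[symmetric] power3_eq_cube)
  also have "(\<integral>\<^sup>+x. \<integral>\<^sup>+y. \<integral>\<^sup>+z. pow3 c a (vec3 x y z) * g (tau c (vec3 x y z), vec3 x y z) \<partial>lborel \<partial>lborel \<partial>lborel)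
     = (\<integral>\<^sup>+v. pow3 c a v * g (tau c v, v) \<partial>lborel)"
    by (rule nn_integral_vec3[symmetric]) measurable
  finally show ?thesis unfolding g_def .
qed

text \<open>The time integral runs at speed 2; the substitution t = r + 2 s is the origin of the
  halved time coordinate and of the factor 1 / 2.\<close>

lemma Bop_Suc_eq:
  assumes [measurable]: "f \<in> borel_measurable borel"
  shows "(Bop ^^ Suc m) f (r, v) = ennreal (1 / 2) * (\<integral>\<^sup>+t. ennreal (((t - r) / 2) ^ m / fact m) * f (t, v) * indicator {r..} t \<partial>lborel)"
proof -
  define F where "F t = ennreal (((t - r) / 2) ^ m / fact m) * f (t, v) * indicator {r..} t" for t
  have [measurable]: "F \<in> borel_measurable borel" unfolding F_def by measurable
  have "(\<integral>\<^sup>+t. F t \<partial>lborel) = 2 * (\<integral>\<^sup>+s. F (r + 2 * s) \<partial>lborel)"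
    by (subst nn_integral_real_affine[where c = 2 and t = r]) auto
  also have "(\<integral>\<^sup>+s. F (r + 2 * s) \<partial>lborel) = (Bop ^^ Suc m) f (r, v)"
    unfolding Iop_funpow_Suc[OF assms] F_def
    by (intro nn_integral_cong) (auto simp: indicator_def mult.commute)
  finally have "ennreal (1 / 2) * (\<integral>\<^sup>+t. F t \<partial>lborel) = (ennreal (1 / 2) * ennreal 2) * (Bop ^^ Suc m) f (r, v)"
    by (simp add: mult.assoc)
  also have "ennreal (1 / 2) * ennreal 2 = 1"
    by (subst ennreal_mult[symmetric]) auto
  finally show ?thesis unfolding F_def by simp
qed

lemma mem_interior_octahedron:
  assumes "0 < r"
  shows "v \<in> interior (octahedron r) \<longleftrightarrow> \<bar>v $ 1\<bar> + \<bar>v $ 2\<bar> + \<bar>v $ 3\<bar> < r"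
proof
  define n where "n v = \<bar>v $ 1\<bar> + \<bar>v $ 2\<bar> + \<bar>v $ 3\<bar>" for v :: "real ^ 3"
  assume v: "v \<in> interior (octahedron r)"
  then have "n v \<le> r" using interior_subset by (force simp: octahedron_def n_def)
  moreover have "n v \<noteq> r"
  proof
    assume *: "n v = r"
    \<comment> \<open>A boundary point pushed outwards along its own ray leaves the octahedron at
      once, so it cannot be interior.\<close>
    have "((\<lambda>d. v + d *\<^sub>R v) \<longlongrightarrow> v + 0 *\<^sub>R v) (at_right 0)"
      by (intro tendsto_intros)
    then have "eventually (\<lambda>d. v + d *\<^sub>R v \<in> interior (octahedron r)) (at_right 0)"
      using v by (intro topological_tendstoD) auto
    moreover have "eventually (\<lambda>d::real. d > 0) (at_right 0)"
      by (rule eventually_at_right_less)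
    ultimately have "eventually (\<lambda>d::real. False) (at_right 0)"
    proof eventually_elim
      case (elim d)
      have "v + d *\<^sub>R v = (1 + d) *\<^sub>R v" by (simp add: algebra_simps)
      then have "n ((1 + d) *\<^sub>R v) \<le> r"
        using elim(1) interior_subset by (force simp: octahedron_def n_def)
      moreover have "n ((1 + d) *\<^sub>R v) = (1 + d) * n v"
        using elim(2) by (simp add: n_def abs_mult distrib_left)
      ultimately show False using * elim(2) assms by simp
    qed
    then show False by simp
  qed
  ultimately show "\<bar>v $ 1\<bar> + \<bar>v $ 2\<bar> + \<bar>v $ 3\<bar> < r" by (simp add: n_def)
next
  assume *: "\<bar>v $ 1\<bar> + \<bar>v $ 2\<bar> + \<bar>v $ 3\<bar> < r"
  have "open {v :: real ^ 3. \<bar>v $ 1\<bar> + \<bar>v $ 2\<bar> + \<bar>v $ 3\<bar> < r}"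
    by (intro open_Collect_less continuous_intros)
  then show "v \<in> interior (octahedron r)"
    using * by (intro interiorI[of "{v. \<bar>v $ 1\<bar> + \<bar>v $ 2\<bar> + \<bar>v $ 3\<bar> < r}"]) (auto simp: octahedron_def)
qed

lemma tau_nonneg: "0 < c \<Longrightarrow> 0 \<le> tau c v"
  by (simp add: tau_def)

lemma mem_osm_region:
  assumes "0 < c"
  shows "(t, v) \<in> osm_region c \<longleftrightarrow> tau c v < t \<and> (\<forall>i. v $ i \<noteq> 0)"
proof -
  have "0 < t" if "tau c v < t" using that tau_nonneg[OF assms, of v] by linarith
  then show ?thesis
    using assms by (auto simp: osm_region_def mem_interior_octahedron tau_def field_simps)
qed

section \<open>Reindexing the sums over step numbers\<close>

lemma nn_integral_count_space_support:
  fixes F :: "'a \<Rightarrow> ennreal"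
  assumes "inj g" "\<And>x. x \<notin> range g \<Longrightarrow> F x = 0"
  shows "(\<integral>\<^sup>+x. F x \<partial>count_space UNIV) = (\<integral>\<^sup>+y. F (g y) \<partial>count_space UNIV)"
proof -
  have "(\<integral>\<^sup>+x. F x \<partial>count_space UNIV) = (\<integral>\<^sup>+x. F x * indicator (range g) x \<partial>count_space UNIV)"
    using assms(2) by (intro nn_integral_cong) (auto simp: indicator_def)
  also have "\<dots> = (\<integral>\<^sup>+x. F x \<partial>count_space (range g))"
    by (simp add: nn_integral_count_space_indicator)
  also have "\<dots> = (\<integral>\<^sup>+y. F (g y) \<partial>count_space UNIV)"
    by (rule nn_integral_bij_count_space[symmetric]) (use assms(1) in \<open>simp add: inj_on_imp_bij_betw\<close>)
  finally show ?thesis .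
qed

lemma nn_integral_count_space_sum:
  fixes F :: "'a \<Rightarrow> ennreal"
  assumes "finite S"
  shows "(\<Sum>x\<in>S. F x) = (\<integral>\<^sup>+x. F x * indicator S x \<partial>count_space UNIV)"
  using assms by (simp add: nn_integral_count_space_finite flip: nn_integral_count_space_indicator)

lemma finite_box3: "finite (box3 k)"
  by (simp add: box3_def split: prod.splits)

text \<open>Substitute k = a + s. On the box the truncated difference is exact, so the pairs (k, s)
  and (a, s) correspond one to one.\<close>

lemma sum_box3_reindex:
  fixes G :: "nat \<times> nat \<times> nat \<Rightarrow> nat \<times> nat \<times> nat \<Rightarrow> ennreal"
  shows "(\<integral>\<^sup>+k. (\<Sum>s\<in>box3 k. G (k - s) s) \<partial>count_space UNIV)
    = (\<integral>\<^sup>+a. \<integral>\<^sup>+s. G a s \<partial>count_space UNIV \<partial>count_space UNIV)"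
proof -
  define H where "H = (\<lambda>(k, s). G (k - s) s * indicator (box3 k) s)"
  have "(\<integral>\<^sup>+k. (\<Sum>s\<in>box3 k. G (k - s) s) \<partial>count_space UNIV)
    = (\<integral>\<^sup>+k. \<integral>\<^sup>+s. H (k, s) \<partial>count_space UNIV \<partial>count_space UNIV)"
    by (simp add: H_def nn_integral_count_space_sum[OF finite_box3])
  also have "\<dots> = (\<integral>\<^sup>+x. H x \<partial>count_space UNIV)"
    by (rule nn_integral_fst_count_space)
  also have "\<dots> = (\<integral>\<^sup>+y. H ((\<lambda>(a, s). (a + s, s)) y) \<partial>count_space UNIV)"
  proof (rule nn_integral_count_space_support)
    show "inj (\<lambda>(a, s). (a + s, s :: nat \<times> nat \<times> nat))"
      by (auto simp: inj_def)
    fix x :: "(nat \<times> nat \<times> nat) \<times> (nat \<times> nat \<times> nat)"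
    assume x: "x \<notin> range (\<lambda>(a, s). (a + s, s))"
    obtain k s where ks: "x = (k, s)" by (cases x)
    have "s \<notin> box3 k"
    proof
      assume "s \<in> box3 k"
      then have "k - s + s = k" by (auto simp: box3_def minus_prod_def plus_prod_def split: prod.splits)
      then have "x = (\<lambda>(a, s). (a + s, s)) (k - s, s)" by (simp add: ks)
      then show False using x by blast
    qed
    then show "H x = 0" by (simp add: H_def ks)
  qed
  also have "\<dots> = (\<integral>\<^sup>+(a, s). G a s \<partial>count_space UNIV)"
  proof (rule nn_integral_cong)
    fix y :: "(nat \<times> nat \<times> nat) \<times> (nat \<times> nat \<times> nat)"
    obtain a s where y: "y = (a, s)" by (cases y)
    have "s \<in> box3 (a + s)" by (cases a; cases s) (auto simp: box3_def plus_prod_def)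
    moreover have "a + s - s = a" by (cases a; cases s) (auto simp: minus_prod_def plus_prod_def)
    ultimately show "H (case y of (a, s) \<Rightarrow> (a + s, s)) = (case y of (a, s) \<Rightarrow> G a s)"
      by (simp add: H_def y)
  qed
  also have "\<dots> = (\<integral>\<^sup>+a. \<integral>\<^sup>+s. G a s \<partial>count_space UNIV \<partial>count_space UNIV)"
    by (subst nn_integral_fst_count_space[symmetric]) simp
  finally show ?thesis .
qed

lemma comp3_total3: "s \<in> comp3 M \<longleftrightarrow> total3 s = M"
  by (auto simp: comp3_def total3_def)

lemma sum_comp3_group:
  fixes H :: "nat \<times> nat \<times> nat \<Rightarrow> ennreal"
  assumes "\<And>s. total3 s = 0 \<Longrightarrow> H s = 0"
  shows "(\<integral>\<^sup>+s. H s \<partial>count_space UNIV) = (\<integral>\<^sup>+m. (\<Sum>s\<in>comp3 (Suc m). H s) \<partial>count_space UNIV)"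
proof -
  have "(\<integral>\<^sup>+s. H s \<partial>count_space UNIV) = (\<integral>\<^sup>+s. \<integral>\<^sup>+m. H s * indicator (comp3 (Suc m)) s \<partial>count_space UNIV \<partial>count_space UNIV)"
  proof (rule nn_integral_cong)
    fix s
    show "H s = (\<integral>\<^sup>+m. H s * indicator (comp3 (Suc m)) s \<partial>count_space UNIV)"
    proof (cases "total3 s")
      case 0
      then show ?thesis using assms by simp
    next
      case (Suc M)
      have "(\<integral>\<^sup>+m. H s * indicator (comp3 (Suc m)) s \<partial>count_space UNIV) = (\<integral>\<^sup>+m. H s * indicator {M} m \<partial>count_space UNIV)"
        by (intro nn_integral_cong) (auto simp: indicator_def comp3_total3 Suc)
      also have "\<dots> = H s" using nn_integral_count_space_sum[of "{M}" "\<lambda>_. H s"] by simp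
      finally show ?thesis ..
    qed
  qed
  also have "\<dots> = (\<integral>\<^sup>+m. \<integral>\<^sup>+s. H s * indicator (comp3 (Suc m)) s \<partial>count_space UNIV \<partial>count_space UNIV)"
    by (rule nn_integral_count_space_nn_integral) auto
  finally show ?thesis by (simp add: nn_integral_count_space_sum)
qed

text \<open>Such test functions vanish on the coordinate planes and on the boundary of the
  octahedron, where degenerate words and expanded terms are concentrated.\<close>

definition region_supp :: "real \<Rightarrow> (pt \<Rightarrow> ennreal) \<Rightarrow> bool" where
  "region_supp c f \<longleftrightarrow> (\<forall>t v. (t, v) \<notin> osm_region c \<longrightarrow> f (t, v) = 0)"

definition slice0 :: "3 \<Rightarrow> (pt \<Rightarrow> ennreal) \<Rightarrow> bool" where
  "slice0 i f \<longleftrightarrow> (\<forall>t v. v $ i = 0 \<longrightarrow> f (t, v) = 0)"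

lemma slice0_Iop:
  assumes "slice0 i f" "snd z $ i = 0"
  shows "slice0 i (Iop z f)"
  unfolding slice0_def
proof (intro allI impI)
  fix t and v :: "real ^ 3" assume "v $ i = 0"
  then have "f ((t, v) + s *\<^sub>R z) = 0" for s
    using assms by (cases z) (simp add: slice0_def)
  then show "Iop z f (t, v) = 0" by (simp add: Iop_def)
qed

lemma slice0_Zop: "slice0 i (Iop z f) \<Longrightarrow> slice0 i (Iop w f) \<Longrightarrow> slice0 i (Zop z w f)"
  by (simp add: slice0_def Zop_def)

lemma slice0_Zax_funpow: "slice0 i f \<Longrightarrow> i \<noteq> j \<Longrightarrow> slice0 i ((Zax c j ^^ n) f)"
proof (induction n)
  case (Suc n)
  then show ?case
    by (auto intro!: slice0_Zop slice0_Iop simp: zp_def zm_def axis_def)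
qed simp

lemma T3_eq_0:
  assumes "0 < c" "region_supp c f" "k \<notin> range suc3"
  shows "T3 c f k = 0"
proof -
  obtain k1 k2 k3 where k: "k = (k1, k2, k3)" by (cases k)
  have s: "slice0 i f" for i
    using assms(1,2) by (auto simp: slice0_def region_supp_def mem_osm_region)
  have "k1 = 0 \<or> k2 = 0 \<or> k3 = 0"
  proof (rule ccontr)
    assume "\<not> ?thesis"
    then have "k = suc3 (k1 - 1, k2 - 1, k3 - 1)" by (simp add: suc3_def k)
    then show False using assms(3) by blast
  qed
  moreover have "T3 c f k = 0" if "k1 = 0"
  proof -
    have "slice0 1 ((Zax c 2 ^^ k2) ((Zax c 3 ^^ k3) f))"
      by (intro slice0_Zax_funpow s) auto
    then show ?thesis
      by (simp add: T3_def k that slice0_def zero_prod_def)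
  qed
  moreover have "T3 c f k = 0" if "k2 = 0"
  proof -
    have "slice0 2 ((Zax c 1 ^^ k1) ((Zax c 3 ^^ k3) f))"
      by (intro slice0_Zax_funpow s) auto
    then show ?thesis
      by (simp add: T3_def k that slice0_def zero_prod_def)
  qed
  moreover have "T3 c f k = 0" if "k3 = 0"
  proof -
    have "slice0 3 ((Zax c 1 ^^ k1) ((Zax c 2 ^^ k2) f))"
      by (intro slice0_Zax_funpow s) auto
    then show ?thesis
      by (simp add: T3_def k that slice0_def zero_prod_def)
  qed
  ultimately show ?thesis by blast
qed

text \<open>Without a factor \<open>Bop\<close> the point v is reached at time
  \<open>tau c v\<close>, the earliest possible one, and this space-time point is outside the
  region.\<close>

lemma W3_0:
  assumes "0 < c" "region_supp c f" and [measurable]: "f \<in> borel_measurable borel"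
  shows "W3 c f a 0 = 0"
proof -
  have "f (tau c v, v) = 0" for v
    using assms by (simp add: region_supp_def mem_osm_region)
  then show ?thesis by (simp add: W3_eq assms)
qed

text \<open>The kernel of \<open>W3 c f a (Suc m)\<close>: three spatial substitutions give 1 / c^3,
  the time substitution gives 1 / 2.\<close>

definition kern :: "real \<Rightarrow> nat \<times> nat \<times> nat \<Rightarrow> nat \<Rightarrow> real \<Rightarrow> real ^ 3 \<Rightarrow> ennreal" where
  "kern c a m t v = ennreal (1 / (2 * c ^ 3)) * (pow3 c a v * ennreal (((t - tau c v) / 2) ^ m / fact m))"

lemma kern_measurable [measurable]: "(\<lambda>(v, t). kern c a m t v) \<in> borel_measurable (lborel \<Otimes>\<^sub>M lborel)"
  unfolding kern_def by measurable

lemma W3_Suc: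
  assumes c: "0 < c" and supp: "region_supp c f" and [measurable]: "f \<in> borel_measurable borel"
  shows "W3 c f a (Suc m) = (\<integral>\<^sup>+v. \<integral>\<^sup>+t. f (t, v) * kern c a m t v \<partial>lborel \<partial>lborel)"
proof -
  define F where "F v = (\<integral>\<^sup>+t. ennreal (((t - tau c v) / 2) ^ m / fact m) * f (t, v) \<partial>lborel)" for v
  have [measurable]: "F \<in> borel_measurable lborel" unfolding F_def by measurable
  \<comment> \<open>The lower limit of the time integral is implied by the support of f.\<close>
  have "f (t, v) * indicator {tau c v..} t = f (t, v)" for t v
    using supp c by (auto simp: indicator_def region_supp_def mem_osm_region)
  then have B: "(Bop ^^ Suc m) f (tau c v, v) = ennreal (1 / 2) * F v" for v
    unfolding Bop_Suc_eq[OF assms(3)] F_def by (simp add: mult.assoc)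
  have C: "ennreal (1 / c ^ 3) * ennreal (1 / 2) = ennreal (1 / (2 * c ^ 3))"
    using c by (subst ennreal_mult[symmetric]) auto
  have "W3 c f a (Suc m) = ennreal (1 / c ^ 3) * (ennreal (1 / 2) * (\<integral>\<^sup>+v. pow3 c a v * F v \<partial>lborel))"
    unfolding W3_eq[OF c assms(3)] B
    by (subst (2) nn_integral_cmult[symmetric], measurable)
       (intro arg_cong2[where f = "(*)"] refl nn_integral_cong mult.left_commute)
  also have "\<dots> = (\<integral>\<^sup>+v. ennreal (1 / (2 * c ^ 3)) * (pow3 c a v * F v) \<partial>lborel)"
    unfolding mult.assoc[symmetric] C by (simp add: nn_integral_cmult mult.assoc)
  also have "\<dots> = (\<integral>\<^sup>+v. \<integral>\<^sup>+t. f (t, v) * kern c a m t v \<partial>lborel \<partial>lborel)"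
  proof (rule nn_integral_cong)
    fix v
    have "(\<integral>\<^sup>+t. f (t, v) * kern c a m t v \<partial>lborel)
      = (\<integral>\<^sup>+t. (ennreal (1 / (2 * c ^ 3)) * pow3 c a v) * (ennreal (((t - tau c v) / 2) ^ m / fact m) * f (t, v)) \<partial>lborel)"
      unfolding kern_def by (intro nn_integral_cong) (simp only: mult_ac)
    also have "\<dots> = (ennreal (1 / (2 * c ^ 3)) * pow3 c a v) * F v"
      unfolding F_def by (rule nn_integral_cmult) measurable
    finally show "ennreal (1 / (2 * c ^ 3)) * (pow3 c a v * F v) = (\<integral>\<^sup>+t. f (t, v) * kern c a m t v \<partial>lborel)"
      by (simp only: mult.assoc)
  qed
  finally show ?thesis .
qed

lemma nn_integral_swap_count:
  fixes g :: "'i::countable \<Rightarrow> real ^ 3 \<Rightarrow> real \<Rightarrow> ennreal"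
  assumes [measurable]: "\<And>i. (\<lambda>(v, t). g i v t) \<in> borel_measurable (lborel \<Otimes>\<^sub>M lborel)"
  shows "(\<integral>\<^sup>+i. \<integral>\<^sup>+v. \<integral>\<^sup>+t. g i v t \<partial>lborel \<partial>lborel \<partial>count_space UNIV)
    = (\<integral>\<^sup>+v. \<integral>\<^sup>+t. \<integral>\<^sup>+i. g i v t \<partial>count_space UNIV \<partial>lborel \<partial>lborel)"
proof -
  have "(\<integral>\<^sup>+v. \<integral>\<^sup>+t. \<integral>\<^sup>+i. g i v t \<partial>count_space UNIV \<partial>lborel \<partial>lborel)
    = (\<integral>\<^sup>+v. \<integral>\<^sup>+i. \<integral>\<^sup>+t. g i v t \<partial>lborel \<partial>count_space UNIV \<partial>lborel)"
    by (intro nn_integral_cong nn_integral_count_space_nn_integral) (auto intro!: measurable_Pair2)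
  also have "\<dots> = (\<integral>\<^sup>+i. \<integral>\<^sup>+v. \<integral>\<^sup>+t. g i v t \<partial>lborel \<partial>lborel \<partial>count_space UNIV)"
    by (rule nn_integral_count_space_nn_integral) auto
  finally show ?thesis ..
qed

text \<open>Since f is an arbitrary test function, its factor on the right is the space-time
  density. Nonnegativity justifies every change of order, for any weight w and without a convergence
  condition.\<close>

lemma sum_T3:
  assumes c: "0 < c" and supp: "region_supp c f" and [measurable]: "f \<in> borel_measurable borel"
  shows "(\<integral>\<^sup>+k. w k * T3 c f k \<partial>count_space UNIV)
    = (\<integral>\<^sup>+v. \<integral>\<^sup>+t. f (t, v) * (\<integral>\<^sup>+a. \<integral>\<^sup>+m. (\<Sum>s\<in>comp3 (Suc m). w (suc3 (a + s)) * bin3 (a + s) s) * kern c a m t v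
        \<partial>count_space UNIV \<partial>count_space UNIV) \<partial>lborel \<partial>lborel)"
proof -
  define A where "A a m = (\<Sum>s\<in>comp3 (Suc m). w (suc3 (a + s)) * bin3 (a + s) s)" for a m
  have "inj suc3" by (auto simp: inj_def suc3_def)
  then have "(\<integral>\<^sup>+k. w k * T3 c f k \<partial>count_space UNIV) = (\<integral>\<^sup>+k. w (suc3 k) * T3 c f (suc3 k) \<partial>count_space UNIV)"
    using T3_eq_0[OF c supp] by (intro nn_integral_count_space_support) auto
  also have "\<dots> = (\<integral>\<^sup>+k. (\<Sum>s\<in>box3 k. w (suc3 (k - s + s)) * bin3 (k - s + s) s * W3 c f (k - s) (total3 s)) \<partial>count_space UNIV)"
  proof (intro nn_integral_cong)
    fix k
    have "k - s + s = k" if "s \<in> box3 k" for s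
      using that by (auto simp: box3_def minus_prod_def plus_prod_def split: prod.splits)
    then show "w (suc3 k) * T3 c f (suc3 k) = (\<Sum>s\<in>box3 k. w (suc3 (k - s + s)) * bin3 (k - s + s) s * W3 c f (k - s) (total3 s))"
      unfolding T3_suc3[OF assms(3)] sum_distrib_left by (intro sum.cong) (auto simp: mult.assoc)
  qed
  also have "\<dots> = (\<integral>\<^sup>+a. \<integral>\<^sup>+s. w (suc3 (a + s)) * bin3 (a + s) s * W3 c f a (total3 s) \<partial>count_space UNIV \<partial>count_space UNIV)"
    by (rule sum_box3_reindex)
  also have "\<dots> = (\<integral>\<^sup>+a. \<integral>\<^sup>+m. A a m * W3 c f a (Suc m) \<partial>count_space UNIV \<partial>count_space UNIV)"
  proof (rule nn_integral_cong)
    fix a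
    have "(\<integral>\<^sup>+s. w (suc3 (a + s)) * bin3 (a + s) s * W3 c f a (total3 s) \<partial>count_space UNIV)
      = (\<integral>\<^sup>+m. (\<Sum>s\<in>comp3 (Suc m). w (suc3 (a + s)) * bin3 (a + s) s * W3 c f a (total3 s)) \<partial>count_space UNIV)"
      by (rule sum_comp3_group) (simp add: W3_0[OF c supp])
    also have "\<dots> = (\<integral>\<^sup>+m. A a m * W3 c f a (Suc m) \<partial>count_space UNIV)"
      unfolding A_def sum_distrib_right by (intro nn_integral_cong sum.cong) (auto simp: comp3_total3)
    finally show "(\<integral>\<^sup>+s. w (suc3 (a + s)) * bin3 (a + s) s * W3 c f a (total3 s) \<partial>count_space UNIV)
      = (\<integral>\<^sup>+m. A a m * W3 c f a (Suc m) \<partial>count_space UNIV)" .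
  qed
  also have "\<dots> = (\<integral>\<^sup>+a. \<integral>\<^sup>+m. \<integral>\<^sup>+v. \<integral>\<^sup>+t. f (t, v) * (A a m * kern c a m t v) \<partial>lborel \<partial>lborel \<partial>count_space UNIV \<partial>count_space UNIV)"
  proof (intro nn_integral_cong)
    fix a m
    have "A a m * W3 c f a (Suc m) = (\<integral>\<^sup>+v. A a m * (\<integral>\<^sup>+t. f (t, v) * kern c a m t v \<partial>lborel) \<partial>lborel)"
      unfolding W3_Suc[OF assms] by (rule nn_integral_cmult[symmetric]) measurable
    also have "\<dots> = (\<integral>\<^sup>+v. \<integral>\<^sup>+t. f (t, v) * (A a m * kern c a m t v) \<partial>lborel \<partial>lborel)"
      by (intro nn_integral_cong) (subst nn_integral_cmult[symmetric], measurable, simp only: mult_ac)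
    finally show "A a m * W3 c f a (Suc m) = (\<integral>\<^sup>+v. \<integral>\<^sup>+t. f (t, v) * (A a m * kern c a m t v) \<partial>lborel \<partial>lborel)" .
  qed
  also have "\<dots> = (\<integral>\<^sup>+x. \<integral>\<^sup>+v. \<integral>\<^sup>+t. f (t, v) * (A (fst x) (snd x) * kern c (fst x) (snd x) t v) \<partial>lborel \<partial>lborel \<partial>count_space UNIV)"
    by (subst nn_integral_fst_count_space[symmetric]) simp
  also have "\<dots> = (\<integral>\<^sup>+v. \<integral>\<^sup>+t. \<integral>\<^sup>+x. f (t, v) * (A (fst x) (snd x) * kern c (fst x) (snd x) t v) \<partial>count_space UNIV \<partial>lborel \<partial>lborel)"
    by (rule nn_integral_swap_count) measurable
  also have "\<dots> = (\<integral>\<^sup>+v. \<integral>\<^sup>+t. f (t, v) * (\<integral>\<^sup>+x. A (fst x) (snd x) * kern c (fst x) (snd x) t v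
        \<partial>count_space UNIV) \<partial>lborel \<partial>lborel)"
    by (simp add: nn_integral_cmult)
  also have "\<dots> = (\<integral>\<^sup>+v. \<integral>\<^sup>+t. f (t, v) * (\<integral>\<^sup>+a. \<integral>\<^sup>+m. A a m * kern c a m t v
        \<partial>count_space UNIV \<partial>count_space UNIV) \<partial>lborel \<partial>lborel)"
    by (subst nn_integral_fst_count_space[symmetric]) simp
  finally show ?thesis unfolding A_def .
qed

section \<open>The density as a series of nonnegative terms\<close>

fun mser_ennreal :: "real list \<Rightarrow> (nat list \<Rightarrow> real) \<Rightarrow> ennreal" where
  "mser_ennreal [] A = ennreal (A [])"
| "mser_ennreal (x # xs) A =
     (\<integral>\<^sup>+n. ennreal (x ^ n / fact n) * mser_ennreal xs (\<lambda>\<alpha>. A (n # \<alpha>)) \<partial>count_space UNIV)"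

lemma mser_eq_mser_ennreal:
  "geo (length xs) A \<Longrightarrow> (\<And>\<alpha>. length \<alpha> = length xs \<Longrightarrow> 0 \<le> A \<alpha>) \<Longrightarrow> (\<And>x. x \<in> set xs \<Longrightarrow> 0 \<le> x) \<Longrightarrow>
    0 \<le> mser xs A \<and> ennreal (mser xs A) = mser_ennreal xs A"
proof (induction xs arbitrary: A)
  case Nil
  then show ?case by simp
next
  case (Cons x xs)
  obtain K B where *: "geo_bound (Suc (length xs)) K B A"
    using Cons.prems(1) by (auto simp: geo_def)
  define b where "b n = mser xs (\<lambda>\<alpha>. A (n # \<alpha>))" for n
  have ih: "0 \<le> b n" "ennreal (b n) = mser_ennreal xs (\<lambda>\<alpha>. A (n # \<alpha>))" for n
    using Cons.IH[of "\<lambda>\<alpha>. A (n # \<alpha>)"] geo_bound_Cons[OF *] Cons.prems by (auto simp: b_def geo_def)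
  have sm: "summable (\<lambda>n. b n * x ^ n / fact n)"
    unfolding b_def
    by (rule ser_summable(1)[OF mser_coeff_bound[OF *, OF order_refl]]) (use * in \<open>auto simp: geo_bound_def\<close>)
  have nn: "0 \<le> b n * x ^ n / fact n" for n
    using ih(1) Cons.prems(3)[of x] by simp
  have "ennreal (mser (x # xs) A) = (\<Sum>n. ennreal (b n * x ^ n / fact n))"
    by (simp add: ser_def b_def[symmetric] suminf_ennreal2[OF nn sm])
  also have "\<dots> = mser_ennreal (x # xs) A"
    unfolding mser_ennreal.simps nn_integral_count_space_nat ih(2)[symmetric]
    using Cons.prems(3)[of x] ih(1)
    by (intro suminf_cong) (simp add: ennreal_mult[symmetric] mult.commute)
  finally show ?case
    using suminf_nonneg[OF sm nn] by (simp add: ser_def b_def)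
qed

text \<open>The constant is 2 / (3 l) times (l / 4)^3, from \<open>path_weight\<close> at three
  raised indices, times 1 / (2 c^3) from \<open>kern\<close>. The factor
  \<open>exp (- l * t)\<close> is absent here because \<open>ew\<close> puts it into the test
  function.\<close>

definition dens :: "real \<Rightarrow> real \<Rightarrow> real \<Rightarrow> real ^ 3 \<Rightarrow> real" where
  "dens c l t v = l\<^sup>2 / (192 * c ^ 3) *
     mser [\<bar>v $ 1\<bar> / c, \<bar>v $ 2\<bar> / c, \<bar>v $ 3\<bar> / c, (t - tau c v) / 2] (on_list (cf 0 (osm_weight l)))"

text \<open>A path with n directions has n - 1 completed waiting times, which give l^(n-1), and
  probability (1 / 6) (1 / 4)^(n-1). The product is 2 / (3 l) times (l / 4)^n. \<open>words\<close>
  counts the sequences of axes; the signs are summed inside \<open>Zax\<close>.\<close>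

definition path_weight :: "real \<Rightarrow> nat \<times> nat \<times> nat \<Rightarrow> ennreal" where
  "path_weight l = (\<lambda>(i, j, k). ennreal (2 / (3 * l) * (l / 4) ^ (i + j + k) * real (words i j k)))"

lemma osm_weight_nonneg: "0 < l \<Longrightarrow> 0 \<le> osm_weight l i j k"
  by (simp add: osm_weight_def)

lemma cterm_nonneg: "0 < l \<Longrightarrow> 0 \<le> cterm (osm_weight l) i j k x"
  by (cases x) (simp add: cterm_def osm_weight_nonneg)

lemma comps_nonneg: "0 < l \<Longrightarrow> 0 \<le> comps (osm_weight l) i j k M"
  unfolding comps_def by (intro sum_nonneg cterm_nonneg)

lemma path_weight_comps:
  assumes "0 < l"
  shows "(\<Sum>s\<in>comp3 (Suc m). path_weight l (suc3 ((i, j, k) + s)) * bin3 ((i, j, k) + s) s)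
    = ennreal (2 / (3 * l) * (l / 4) ^ 3) * ennreal (comps (osm_weight l) i j k (Suc m))"
proof -
  have t: "path_weight l (suc3 ((i, j, k) + s)) * bin3 ((i, j, k) + s) s
     = ennreal (2 / (3 * l) * (l / 4) ^ 3) * ennreal (cterm (osm_weight l) i j k s)" for s
  proof -
    obtain p q r where s: "s = (p, q, r)" by (cases s)
    define X where "X = 2 / (3 * l) * (l / 4) ^ 3"
    define o' where "o' = osm_weight l (i + p) (j + q) (k + r)"
    define b' where "b' = ballot i p * ballot j q * ballot k r"
    have nn: "0 \<le> X" "0 \<le> o'" "0 \<le> b'"
      using assms osm_weight_nonneg by (auto simp: X_def o'_def b'_def)
    have b: "bin3 ((i, j, k) + s) s = ennreal b'"
      by (simp add: b'_def s bin3_def plus_prod_def ballot_def ennreal_mult ennreal_of_nat_eq_real_of_nat mult_2 add.assoc)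
    have pw: "path_weight l (suc3 ((i, j, k) + s)) = ennreal (X * o')"
      by (simp add: X_def o'_def s path_weight_def suc3_def plus_prod_def osm_weight_def power3_eq_cube mult_ac)
    have c: "cterm (osm_weight l) i j k s = o' * b'"
      by (simp add: s cterm_def o'_def b'_def)
    show ?thesis
      unfolding pw b c X_def[symmetric] using nn by (simp add: ennreal_mult mult.assoc)
  qed
  show ?thesis
    unfolding t comps_def sum_distrib_left[symmetric]
    by (subst sum_ennreal) (auto intro: cterm_nonneg assms)
qed

text \<open>For \<open>tau c v \<le> t\<close> all four arguments of the series are nonnegative, so
  the real series equals the nested sum of nonnegative terms produced by
  \<open>sum_T3\<close>.\<close>

lemma dens_eq:
  assumes "0 < c" "0 < l" "tau c v \<le> t"
  shows "0 \<le> dens c l t v"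
    "(\<integral>\<^sup>+a. \<integral>\<^sup>+m. (\<Sum>s\<in>comp3 (Suc m). path_weight l (suc3 (a + s)) * bin3 (a + s) s) * kern c a m t v
        \<partial>count_space UNIV \<partial>count_space UNIV) = ennreal (dens c l t v)"
proof -
  define A where "A = on_list (cf 0 (osm_weight l))"
  define sg where "sg = (t - tau c v) / 2"
  define xs where "xs = [\<bar>v $ 1\<bar> / c, \<bar>v $ 2\<bar> / c, \<bar>v $ 3\<bar> / c, sg]"
  define K where "K = l\<^sup>2 / (192 * c ^ 3)"
  have A4: "A [i, j, k, m] = comps (osm_weight l) i j k (Suc m)" for i j k m
    by (simp add: A_def cf_def)
  have sg: "0 \<le> sg" using assms by (simp add: sg_def)
  have "0 \<le> mser xs A \<and> ennreal (mser xs A) = mser_ennreal xs A"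
  proof (rule mser_eq_mser_ennreal)
    show "geo (length xs) A"
      unfolding A_def using geo_cf_tame[OF tame_osm_weight[OF assms(2)], of 0] by (simp add: xs_def eval_nat_numeral)
    show "0 \<le> A \<alpha>" if "length \<alpha> = length xs" for \<alpha>
    proof -
      have "length \<alpha> = 4" using that by (simp add: xs_def)
      then obtain i j k m where "\<alpha> = [i, j, k, m]" using length_4_ex by blast
      then show ?thesis by (simp add: A4 comps_nonneg assms)
    qed
    show "0 \<le> x" if "x \<in> set xs" for x
      using that assms sg by (auto simp: xs_def)
  qed
  then have m: "0 \<le> mser xs A" "ennreal (mser xs A) = mser_ennreal xs A" by auto
  have d: "dens c l t v = K * mser xs A"
    by (simp add: dens_def K_def xs_def sg_def A_def)
  have K0: "0 \<le> K" using assms by (simp add: K_def)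
  show "0 \<le> dens c l t v"
    unfolding d using m assms by (simp add: K_def)
  have KK: "ennreal (2 / (3 * l) * (l / 4) ^ 3) * ennreal (1 / (2 * c ^ 3)) = ennreal K"
    using assms by (subst ennreal_mult[symmetric]) (auto simp: K_def field_simps power2_eq_square power3_eq_cube)
  have t: "(\<Sum>s\<in>comp3 (Suc m). path_weight l (suc3 ((i, j, k) + s)) * bin3 ((i, j, k) + s) s) * kern c (i, j, k) m t v
     = ennreal K * (ennreal ((\<bar>v $ 1\<bar> / c) ^ i / fact i) * (ennreal ((\<bar>v $ 2\<bar> / c) ^ j / fact j)
        * (ennreal ((\<bar>v $ 3\<bar> / c) ^ k / fact k) * (ennreal (sg ^ m / fact m) * ennreal (A [i, j, k, m])))))" for i j k m
    unfolding path_weight_comps[OF assms(2)] kern_def KK[symmetric] A4 pow3_def prod.case powf_def sg_def[symmetric]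
    by (simp only: mult_ac)
  have "(\<integral>\<^sup>+a. \<integral>\<^sup>+m. (\<Sum>s\<in>comp3 (Suc m). path_weight l (suc3 (a + s)) * bin3 (a + s) s) * kern c a m t v
        \<partial>count_space UNIV \<partial>count_space UNIV)
     = (\<integral>\<^sup>+i. \<integral>\<^sup>+j. \<integral>\<^sup>+k. \<integral>\<^sup>+m. (\<Sum>s\<in>comp3 (Suc m). path_weight l (suc3 ((i, j, k) + s)) * bin3 ((i, j, k) + s) s) * kern c (i, j, k) m t v
        \<partial>count_space UNIV \<partial>count_space UNIV \<partial>count_space UNIV \<partial>count_space UNIV)"
    by (subst nn_integral_fst_count_space[symmetric], subst nn_integral_fst_count_space[symmetric]) (rule refl)
  also have "\<dots> = ennreal K * mser_ennreal xs A"
    unfolding t xs_def mser_ennreal.simps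
    by (simp add: nn_integral_cmult)
  also have "\<dots> = ennreal (dens c l t v)"
    unfolding d m(2)[symmetric] using m(1) K0 by (simp add: ennreal_mult)
  finally show "(\<integral>\<^sup>+a. \<integral>\<^sup>+m. (\<Sum>s\<in>comp3 (Suc m). path_weight l (suc3 (a + s)) * bin3 (a + s) s) * kern c a m t v
        \<partial>count_space UNIV \<partial>count_space UNIV) = ennreal (dens c l t v)" .
qed

lemma sum_T3_dens:
  assumes c: "0 < c" and l: "0 < l" and supp: "region_supp c f" and f: "f \<in> borel_measurable borel"
  shows "(\<integral>\<^sup>+k. path_weight l k * T3 c f k \<partial>count_space UNIV)
    = (\<integral>\<^sup>+v. \<integral>\<^sup>+t. f (t, v) * ennreal (dens c l t v) \<partial>lborel \<partial>lborel)"
  unfolding sum_T3[OF c supp f]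
proof (intro nn_integral_cong)
  fix v t
  show "f (t, v) * (\<integral>\<^sup>+a. \<integral>\<^sup>+m. (\<Sum>s\<in>comp3 (Suc m). path_weight l (suc3 (a + s)) * bin3 (a + s) s) * kern c a m t v
        \<partial>count_space UNIV \<partial>count_space UNIV) = f (t, v) * ennreal (dens c l t v)"
  proof (cases "(t, v) \<in> osm_region c")
    case True
    then show ?thesis using dens_eq(2)[OF c l, of v t] c by (simp add: mem_osm_region)
  next
    case False
    then show ?thesis using supp by (simp add: region_supp_def)
  qed
qed

section \<open>Direction paths\<close>

lemma osm_directions_axis: "osm_directions = (\<lambda>i. axis i 1) ` UNIV \<union> (\<lambda>i. - axis i 1) ` UNIV"
proof -
  have e: "vector [1, 0, 0] = axis (1::3) (1::real)" "vector [0, 1, 0] = axis (2::3) (1::real)"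
    "vector [0, 0, 1] = axis (3::3) (1::real)" "vector [- 1, 0, 0] = - axis (1::3) (1::real)"
    "vector [0, - 1, 0] = - axis (2::3) (1::real)" "vector [0, 0, - 1] = - axis (3::3) (1::real)"
    by (simp_all add: vec_eq_iff forall_3 axis_def)
  show ?thesis unfolding osm_directions_def e UNIV_3 image_insert image_empty by blast
qed

lemma axis_neq_minus_axis: "axis i (1::real) \<noteq> - axis j 1"
proof
  assume "axis i (1::real) = - axis j 1"
  then have "axis i (1::real) $ i = (- axis j 1) $ i" by simp
  then show False by (auto simp: axis_def split: if_splits)
qed

lemma finite_osm_directions [simp]: "finite osm_directions"
  by (simp add: osm_directions_def)

lemma sum_osm_directions:
  fixes g :: "real ^ 3 \<Rightarrow> 'b::comm_monoid_add"
  shows "(\<Sum>v\<in>osm_directions. g v) = (\<Sum>j\<in>UNIV. g (axis j 1) + g (- axis j 1))"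
proof -
  have "(\<Sum>v\<in>osm_directions. g v) = (\<Sum>v\<in>(\<lambda>i. axis i 1) ` UNIV. g v) + (\<Sum>v\<in>(\<lambda>i. - axis i 1) ` UNIV. g v)"
    unfolding osm_directions_axis using axis_neq_minus_axis by (intro sum.union_disjoint) auto
  also have "\<dots> = (\<Sum>j\<in>UNIV. g (axis j 1)) + (\<Sum>j\<in>UNIV. g (- axis j 1))"
    by (subst (1 2) sum.reindex) (auto simp: inj_on_def axis_eq_axis)
  finally show ?thesis by (simp add: sum.distrib)
qed

lemma orthogonal_axis: "orthogonal (axis i (1::real)) (axis j 1) \<longleftrightarrow> i \<noteq> j"
  by (auto simp: orthogonal_def inner_axis_axis)

lemma orthogonal_axis_signs [simp]:
  "orthogonal (axis i (1::real)) (axis j 1) \<longleftrightarrow> i \<noteq> j"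
  "orthogonal (- axis i (1::real)) (axis j 1) \<longleftrightarrow> i \<noteq> j"
  "orthogonal (axis i (1::real)) (- axis j 1) \<longleftrightarrow> i \<noteq> j"
  "orthogonal (- axis i (1::real)) (- axis j 1) \<longleftrightarrow> i \<noteq> j"
  by (auto simp: orthogonal_axis orthogonal_clauses)
    (auto simp: orthogonal_def inner_axis_axis)

lemma card_osm_directions: "card osm_directions = 6"
  using sum_osm_directions[of "\<lambda>_. 1 :: nat"] by simp

lemma card_orthogonal_directions:
  assumes "u \<in> osm_directions"
  shows "card {v \<in> osm_directions. orthogonal u v} = 4"
proof -
  obtain i where i: "u = axis i 1 \<or> u = - axis i 1"
    using assms by (auto simp: osm_directions_axis)
  have "card {v \<in> osm_directions. orthogonal u v} = (\<Sum>v\<in>osm_directions. if orthogonal u v then 1 else 0)"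
    by (subst sum.inter_filter[symmetric]) auto
  also have "\<dots> = (\<Sum>j\<in>UNIV. if i \<noteq> j then 2 else 0)"
    unfolding sum_osm_directions by (intro sum.cong) (use i in auto)
  also have "\<dots> = 4" using exhaust_3[of i] by (auto simp: sum_3)
  finally show ?thesis .
qed

text \<open>Direction paths are lists with the most recent direction first.\<close>

fun path_prob :: "(real ^ 3) list \<Rightarrow> real" where
  "path_prob [] = 1"
| "path_prob [u] = 1 / 6"
| "path_prob (u # v # ys) = (if orthogonal v u then 1 / 4 else 0) * path_prob (v # ys)"

lemma path_prob_nonneg: "0 \<le> path_prob ys"
  by (induction ys rule: path_prob.induct) auto

definition velocity :: "real \<Rightarrow> real ^ 3 \<Rightarrow> pt" where
  "velocity c u = (1, c *\<^sub>R u)"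

lemma velocity_axis: "velocity c (axis i 1) = zp c i" "velocity c (- axis i 1) = zm c i"
  by (simp_all add: velocity_def zp_def zm_def)

text \<open>The head is the latest direction. Its integral is innermost, because the last segment
  starts where the earlier ones end.\<close>

fun path_op :: "real \<Rightarrow> (real ^ 3) list \<Rightarrow> (pt \<Rightarrow> ennreal) \<Rightarrow> ennreal" where
  "path_op c [] f = f 0"
| "path_op c (u # ys) f = path_op c ys (Iop (velocity c u) f)"

lemma path_op_add:
  "f \<in> borel_measurable borel \<Longrightarrow> g \<in> borel_measurable borel \<Longrightarrow>
    path_op c ys (\<lambda>y. f y + g y) = path_op c ys f + path_op c ys g"
  by (induction ys arbitrary: f g) (auto simp: Iop_add)

definition paths :: "nat \<Rightarrow> (real ^ 3) list set" where
  "paths n = {ys. set ys \<subseteq> osm_directions \<and> length ys = n}"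

lemma finite_paths [simp]: "finite (paths n)"
  unfolding paths_def by (rule finite_lists_length_eq) simp

lemma paths_0: "paths 0 = {[]}"
  by (auto simp: paths_def)

lemma sum_paths_Suc: "(\<Sum>ys\<in>paths (Suc n). g ys) = (\<Sum>u\<in>osm_directions. \<Sum>ys\<in>paths n. g (u # ys))"
proof -
  have "paths (Suc n) = (\<lambda>(u, ys). u # ys) ` (osm_directions \<times> paths n)"
    by (auto simp: paths_def length_Suc_conv image_iff)
  then have "(\<Sum>ys\<in>paths (Suc n). g ys) = (\<Sum>(u, ys)\<in>osm_directions \<times> paths n. g (u # ys))"
    by (simp add: sum.reindex inj_on_def split_beta comp_def)
  then show ?thesis by (simp add: sum.cartesian_product)
qed

definition end_sum :: "real \<Rightarrow> nat \<Rightarrow> real ^ 3 \<Rightarrow> (pt \<Rightarrow> ennreal) \<Rightarrow> ennreal" where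
  "end_sum c n u f = (\<Sum>ys\<in>paths n. ennreal (path_prob (u # ys)) * path_op c (u # ys) f)"

lemma end_sum_0: "end_sum c 0 u f = ennreal (1 / 6) * Iop (velocity c u) f 0"
  by (simp add: end_sum_def paths_0)

lemma end_sum_add:
  "f \<in> borel_measurable borel \<Longrightarrow> g \<in> borel_measurable borel \<Longrightarrow>
    end_sum c n u (\<lambda>y. f y + g y) = end_sum c n u f + end_sum c n u g"
  unfolding end_sum_def by (simp only: path_op_add distrib_left sum.distrib)

lemma end_sum_Suc:
  "end_sum c (Suc n) u f = (\<Sum>v\<in>osm_directions. if orthogonal v u then ennreal (1 / 4) * end_sum c n v (Iop (velocity c u) f) else 0)"
  unfolding end_sum_def sum_paths_Suc
  by (intro sum.cong refl) (auto simp: sum_distrib_left ennreal_mult path_prob_nonneg mult.assoc intro!: sum.cong)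

definition axis_sum :: "real \<Rightarrow> nat \<Rightarrow> 3 \<Rightarrow> (pt \<Rightarrow> ennreal) \<Rightarrow> ennreal" where
  "axis_sum c n i f = end_sum c n (axis i 1) f + end_sum c n (- axis i 1) f"

lemma axis_sum_0: "axis_sum c 0 i f = ennreal (1 / 6) * Zax c i f 0"
  by (simp add: axis_sum_def end_sum_0 velocity_axis Zop_def distrib_left)

lemma axis_sum_add:
  "f \<in> borel_measurable borel \<Longrightarrow> g \<in> borel_measurable borel \<Longrightarrow>
    axis_sum c n i (\<lambda>y. f y + g y) = axis_sum c n i f + axis_sum c n i g"
  unfolding axis_sum_def by (simp only: end_sum_add add_ac)

lemma axis_sum_Suc:
  assumes [measurable]: "f \<in> borel_measurable borel"
  shows "axis_sum c (Suc n) i f = ennreal (1 / 4) * (\<Sum>j\<in>UNIV - {i}. axis_sum c n j (Zax c i f))"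
proof -
  have e: "end_sum c (Suc n) u f = ennreal (1 / 4) * (\<Sum>j\<in>UNIV - {i}. axis_sum c n j (Iop (velocity c u) f))"
    if "u = axis i 1 \<or> u = - axis i 1" for u
  proof -
    have "end_sum c (Suc n) u f = (\<Sum>j\<in>UNIV. if j \<noteq> i then ennreal (1 / 4) * axis_sum c n j (Iop (velocity c u) f) else 0)"
      unfolding end_sum_Suc sum_osm_directions axis_sum_def distrib_left
      by (intro sum.cong refl) (use that in auto)
    also have "\<dots> = (\<Sum>j\<in>UNIV - {i}. ennreal (1 / 4) * axis_sum c n j (Iop (velocity c u) f))"
      by (rule sum.mono_neutral_cong_right) auto
    finally show ?thesis by (simp only: sum_distrib_left)
  qed
  have z: "Zax c i f = (\<lambda>y. Iop (zp c i) f y + Iop (zm c i) f y)"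
    by (intro ext) (simp only: Zop_def)
  show ?thesis
    unfolding axis_sum_def[of c "Suc n"] e[OF disjI1[OF refl]] e[OF disjI2[OF refl]] velocity_axis z
    by (simp only: axis_sum_add Iop_measurable assms sum.distrib distrib_left)
qed

section \<open>Counting the axis words of direction paths\<close>

definition axis_words :: "3 \<Rightarrow> nat \<times> nat \<times> nat \<Rightarrow> nat" where
  "axis_words i = (\<lambda>(a, b, d). if i = 1 then carlitz a b d else if i = 2 then carlitz b a d else carlitz d a b)"

definition inc3 :: "3 \<Rightarrow> nat \<times> nat \<times> nat \<Rightarrow> nat \<times> nat \<times> nat" where
  "inc3 i = (\<lambda>(a, b, d). if i = 1 then (Suc a, b, d) else if i = 2 then (a, Suc b, d) else (a, b, Suc d))"

lemma total3_inc3 [simp]: "total3 (inc3 i k) = Suc (total3 k)"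
  by (cases k) (simp add: total3_def inc3_def)

lemma total3_eq_0: "total3 k = 0 \<longleftrightarrow> k = (0, 0, 0)"
  by (cases k) (simp add: total3_def)

lemma inj_inc3: "inj (inc3 i)"
  by (auto simp: inj_def inc3_def split: if_splits)

lemma axis_words_eq_0: "k \<notin> range (inc3 i) \<Longrightarrow> axis_words i k = 0"
proof (rule ccontr)
  assume k: "k \<notin> range (inc3 i)" and nz: "axis_words i k \<noteq> 0"
  obtain a b d where kk: "k = (a, b, d)" by (cases k)
  have "k = inc3 i (if i = 1 then (a - 1, b, d) else if i = 2 then (a, b - 1, d) else (a, b, d - 1))"
    using nz by (cases a; cases b; cases d) (auto simp: kk axis_words_def inc3_def split: if_splits)
  then show False using k by blast
qed

lemma UNIV_3_minus:
  "UNIV - {1::3} = {2, 3}" "UNIV - {2::3} = {1, 3}" "UNIV - {3::3} = {1, 2}"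
  using exhaust_3 by auto

text \<open>Deleting the last letter i leaves a word that ends in another letter, provided that the
  remainder is not empty.\<close>

lemma axis_words_inc3:
  assumes "0 < total3 k"
  shows "axis_words i (inc3 i k) = (\<Sum>j\<in>UNIV - {i}. axis_words j k)"
proof -
  obtain a b d where k: "k = (a, b, d)" by (cases k)
  show ?thesis
    using exhaust_3[of i] assms
    by (auto simp: k axis_words_def inc3_def total3_def UNIV_3_minus carlitz_commute[of b d a]
        carlitz_commute[of d a b] carlitz_commute[of a b d])
qed

lemma axis_words_inc3_0: "axis_words i (inc3 j (0, 0, 0)) = (if i = j then 1 else 0)"
  using exhaust_3[of i] exhaust_3[of j] by (auto simp: axis_words_def inc3_def)

lemma Zop_commute:
  assumes [measurable]: "f \<in> borel_measurable borel"
  shows "Zop z w (Zop u v f) = Zop u v (Zop z w f)"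
proof -
  have z: "Zop a b g = (\<lambda>y. Iop a g y + Iop b g y)" for a b :: 'a and g
    by (intro ext) (simp only: Zop_def)
  show ?thesis
    unfolding z by (simp add: Iop_add Iop_commute[of f z u] Iop_commute[of f z v] Iop_commute[of f w u]
      Iop_commute[of f w v] add_ac)
qed

lemma Zop_funpow_commute:
  "f \<in> borel_measurable borel \<Longrightarrow> (Zop z w ^^ n) (Zop u v f) = Zop u v ((Zop z w ^^ n) f)"
  by (induction n) (auto simp: Zop_commute)

lemma T3_Zax:
  assumes "f \<in> borel_measurable borel"
  shows "T3 c (Zax c i f) k = T3 c f (inc3 i k)"
proof -
  obtain a b d where k: "k = (a, b, d)" by (cases k)
  show ?thesis
    using exhaust_3[of i] assms by (auto simp: k T3_def inc3_def Zop_funpow_commute)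
qed

text \<open>Axis operators commute, so all words with the same letter counts yield the same value
  \<open>T3 c f k\<close>, and only their number matters.\<close>

lemma axis_sum_eq:
  assumes "f \<in> borel_measurable borel"
  shows "axis_sum c n i f = ennreal (1 / 6 * (1 / 4) ^ n) *
    (\<integral>\<^sup>+k. of_nat (axis_words i k) * of_bool (total3 k = Suc n) * T3 c f k \<partial>count_space UNIV)"
  using assms
proof (induction n arbitrary: i f)
  case 0
  define F where "F k = of_nat (axis_words i k) * of_bool (total3 k = Suc 0) * T3 c f k" for k
  have "(\<integral>\<^sup>+k. F k \<partial>count_space UNIV) = (\<integral>\<^sup>+k. F (inc3 i k) \<partial>count_space UNIV)"
    by (rule nn_integral_count_space_support[OF inj_inc3]) (simp add: F_def axis_words_eq_0)
  also have "\<dots> = (\<integral>\<^sup>+k. T3 c f (inc3 i (0, 0, 0)) * indicator {(0::nat, 0::nat, 0::nat)} k \<partial>count_space UNIV)"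
    by (intro nn_integral_cong) (auto simp: F_def axis_words_inc3_0 indicator_def total3_eq_0)
  also have "\<dots> = T3 c f (inc3 i (0, 0, 0))"
    using nn_integral_count_space_sum[of "{(0::nat, 0::nat, 0::nat)}" "\<lambda>_. T3 c f (inc3 i (0, 0, 0))"] by simp
  also have "\<dots> = Zax c i f 0"
    by (subst T3_Zax[OF 0, symmetric]) (simp add: T3_def)
  finally show ?case by (simp add: axis_sum_0 F_def)
next
  case (Suc n)
  define F where "F k = of_nat (axis_words i k) * of_bool (total3 k = Suc (Suc n)) * T3 c f k" for k
  have "axis_sum c (Suc n) i f = ennreal (1 / 4) * (\<Sum>j\<in>UNIV - {i}. ennreal (1 / 6 * (1 / 4) ^ n) *
    (\<integral>\<^sup>+k. of_nat (axis_words j k) * of_bool (total3 k = Suc n) * T3 c f (inc3 i k) \<partial>count_space UNIV))"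
    unfolding axis_sum_Suc[OF Suc.prems] by (subst Suc.IH) (auto simp: T3_Zax Suc.prems intro!: Zop_measurable)
  also have "\<dots> = ennreal (1 / 4) * ennreal (1 / 6 * (1 / 4) ^ n) *
    (\<integral>\<^sup>+k. (\<Sum>j\<in>UNIV - {i}. of_nat (axis_words j k) * of_bool (total3 k = Suc n) * T3 c f (inc3 i k)) \<partial>count_space UNIV)"
    by (simp only: sum_distrib_left[symmetric] mult.assoc nn_integral_sum borel_measurable_count_space)
  also have "ennreal (1 / 4) * ennreal (1 / 6 * (1 / 4) ^ n) = ennreal (1 / 6 * (1 / 4) ^ Suc n)"
    by (subst ennreal_mult[symmetric]) auto
  also have "(\<integral>\<^sup>+k. (\<Sum>j\<in>UNIV - {i}. of_nat (axis_words j k) * of_bool (total3 k = Suc n) * T3 c f (inc3 i k)) \<partial>count_space UNIV)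
     = (\<integral>\<^sup>+k. F (inc3 i k) \<partial>count_space UNIV)"
  proof (rule nn_integral_cong)
    fix k
    show "(\<Sum>j\<in>UNIV - {i}. of_nat (axis_words j k) * of_bool (total3 k = Suc n) * T3 c f (inc3 i k)) = F (inc3 i k)"
    proof (cases "total3 k = Suc n")
      case True
      then show ?thesis by (simp add: F_def axis_words_inc3 sum_distrib_right)
    next
      case False
      then show ?thesis by (simp add: F_def)
    qed
  qed
  also have "\<dots> = (\<integral>\<^sup>+k. F k \<partial>count_space UNIV)"
    by (rule nn_integral_count_space_support[OF inj_inc3, symmetric]) (simp add: F_def axis_words_eq_0)
  finally show ?case unfolding F_def .
qed

text \<open>A nonzero triple k belongs to the single path length \<open>total3 k\<close>, so after
  exchanging the sums at most one n contributes for each k.\<close>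

lemma sum_paths_eq_T3:
  assumes l: "0 < l" and f: "f \<in> borel_measurable borel"
  shows "(\<Sum>n. ennreal (l ^ n) * (\<Sum>ys\<in>paths (Suc n). ennreal (path_prob ys) * path_op c ys f))
    = (\<integral>\<^sup>+k. path_weight l k * T3 c f k \<partial>count_space UNIV)"
proof -
  define G where "G n k = ennreal (1 / 6 * (l / 4) ^ n) * (of_nat (case k of (a, b, d) \<Rightarrow> words a b d) * of_bool (total3 k = Suc n) * T3 c f k)"
    for n k
  have w: "(\<Sum>i\<in>UNIV. axis_words i k) = (case k of (a, b, d) \<Rightarrow> words a b d)" for k
    by (cases k) (simp add: sum_3 axis_words_def words_def)
  have 1: "ennreal (l ^ n) * (\<Sum>ys\<in>paths (Suc n). ennreal (path_prob ys) * path_op c ys f) = (\<integral>\<^sup>+k. G n k \<partial>count_space UNIV)" for n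
  proof -
    have "(\<Sum>ys\<in>paths (Suc n). ennreal (path_prob ys) * path_op c ys f) = (\<Sum>i\<in>UNIV. axis_sum c n i f)"
      unfolding sum_paths_Suc sum_osm_directions axis_sum_def end_sum_def ..
    also have "\<dots> = ennreal (1 / 6 * (1 / 4) ^ n) * (\<integral>\<^sup>+k. (\<Sum>i\<in>UNIV. of_nat (axis_words i k) * of_bool (total3 k = Suc n) * T3 c f k) \<partial>count_space UNIV)"
      unfolding axis_sum_eq[OF f]
      by (simp only: sum_distrib_left[symmetric] nn_integral_sum borel_measurable_count_space)
    also have "(\<integral>\<^sup>+k. (\<Sum>i\<in>UNIV. of_nat (axis_words i k) * of_bool (total3 k = Suc n) * T3 c f k) \<partial>count_space UNIV)
       = (\<integral>\<^sup>+k. of_nat (case k of (a, b, d) \<Rightarrow> words a b d) * of_bool (total3 k = Suc n) * T3 c f k \<partial>count_space UNIV)"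
      by (simp only: w[symmetric] sum_distrib_right of_nat_sum)
    finally have "ennreal (l ^ n) * (\<Sum>ys\<in>paths (Suc n). ennreal (path_prob ys) * path_op c ys f)
       = (ennreal (l ^ n) * ennreal (1 / 6 * (1 / 4) ^ n)) * (\<integral>\<^sup>+k. of_nat (case k of (a, b, d) \<Rightarrow> words a b d) * of_bool (total3 k = Suc n) * T3 c f k \<partial>count_space UNIV)"
      by (simp only: mult.assoc)
    also have "ennreal (l ^ n) * ennreal (1 / 6 * (1 / 4) ^ n) = ennreal (1 / 6 * (l / 4) ^ n)"
      using l by (subst ennreal_mult[symmetric]) (auto simp: power_divide field_simps)
    finally show ?thesis
      unfolding G_def by (subst nn_integral_cmult) auto
  qed
  have 2: "(\<integral>\<^sup>+n. G n k \<partial>count_space UNIV) = path_weight l k * T3 c f k" for k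
  proof -
    obtain a b d where k: "k = (a, b, d)" by (cases k)
    show ?thesis
    proof (cases "total3 k")
      case 0
      then show ?thesis by (simp add: G_def path_weight_def k total3_def words_def)
    next
      case (Suc N)
      have e: "1 / 6 * (l / 4) ^ N * real (words a b d) = 2 / (3 * l) * (l / 4) ^ (a + b + d) * real (words a b d)"
        using Suc l by (simp add: k total3_def)
      have "(\<integral>\<^sup>+n. G n k \<partial>count_space UNIV) = (\<integral>\<^sup>+n. G N k * indicator {N} n \<partial>count_space UNIV)"
        by (intro nn_integral_cong) (auto simp: G_def Suc indicator_def)
      also have "\<dots> = G N k" using nn_integral_count_space_sum[of "{N}" "\<lambda>_. G N k"] by simp
      also have "\<dots> = ennreal (1 / 6 * (l / 4) ^ N * real (words a b d)) * T3 c f k"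
      proof -
        have "ennreal (1 / 6 * (l / 4) ^ N * real (words a b d)) = ennreal (1 / 6 * (l / 4) ^ N) * of_nat (words a b d)"
          using l by (subst ennreal_mult) (auto simp: ennreal_of_nat_eq_real_of_nat)
        then show ?thesis using Suc by (simp add: G_def k mult.assoc)
      qed
      finally show ?thesis unfolding e by (simp add: path_weight_def k)
    qed
  qed
  show ?thesis
    unfolding 1 nn_integral_count_space_nat[symmetric] 2[symmetric]
    by (rule nn_integral_count_space_nn_integral) auto
qed

section \<open>The process along a direction path\<close>

lemma fst_pt_measurable [measurable]: "(fst :: pt \<Rightarrow> real) \<in> borel_measurable borel"
  by (intro borel_measurable_continuous_onI continuous_intros)

definition ew :: "real \<Rightarrow> (pt \<Rightarrow> ennreal) \<Rightarrow> pt \<Rightarrow> ennreal" where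
  "ew l f p = ennreal (exp (- l * fst p)) * f p"

lemma ew_measurable [measurable]:
  assumes [measurable]: "f \<in> borel_measurable borel"
  shows "ew l f \<in> borel_measurable borel"
  unfolding ew_def by measurable

definition discount :: "real \<Rightarrow> pt \<Rightarrow> (pt \<Rightarrow> ennreal) \<Rightarrow> pt \<Rightarrow> ennreal" where
  "discount l z f y = (\<integral>\<^sup>+s. ennreal (exp (- l * s)) * f (y + s *\<^sub>R z) * indicator {0..} s \<partial>lborel)"

lemma discount_measurable [measurable]:
  assumes [measurable]: "f \<in> borel_measurable borel"
  shows "discount l z f \<in> borel_measurable borel"
  unfolding discount_def by measurable

text \<open>Time runs with speed 1 along z, so discounting by \<open>exp (- l * s)\<close> is
  conjugate under \<open>ew\<close> to plain ray integration. This removes the rate from the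
  operators.\<close>

lemma ew_discount:
  assumes [measurable]: "f \<in> borel_measurable borel" and z: "fst z = 1"
  shows "ew l (discount l z f) = Iop z (ew l f)"
proof
  fix y
  have "ew l (discount l z f) y = (\<integral>\<^sup>+s. ennreal (exp (- l * fst y)) * (ennreal (exp (- l * s)) * f (y + s *\<^sub>R z) * indicator {0..} s) \<partial>lborel)"
    unfolding ew_def discount_def by (rule nn_integral_cmult[symmetric]) measurable
  also have "\<dots> = Iop z (ew l f) y"
    unfolding Iop_def ew_def
  proof (rule nn_integral_cong)
    fix s
    have "exp (- l * fst (y + s *\<^sub>R z)) = exp (- l * fst y) * exp (- l * s)"
      using z by (simp add: exp_add[symmetric] algebra_simps)
    then show "ennreal (exp (- l * fst y)) * (ennreal (exp (- l * s)) * f (y + s *\<^sub>R z) * indicator {0..} s)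
      = ennreal (exp (- l * fst (y + s *\<^sub>R z))) * f (y + s *\<^sub>R z) * indicator {0..} s"
      by (simp only: ennreal_mult exp_ge_zero mult.assoc)
  qed
  finally show "ew l (discount l z f) y = Iop z (ew l f) y" .
qed

text \<open>\<open>ys\<close> lists the directions before u, so u belongs to the waiting time with
  index \<open>length ys\<close>.\<close>

fun path_point :: "real \<Rightarrow> (real ^ 3) list \<Rightarrow> (nat \<Rightarrow> real) \<Rightarrow> pt" where
  "path_point c [] w = 0"
| "path_point c (u # ys) w = path_point c ys w + w (length ys) *\<^sub>R velocity c u"

lemma path_point_restrict:
  "length ys \<le> n \<Longrightarrow> path_point c ys (restrict w {..<n}) = path_point c ys w"
  by (induction ys) auto

lemma path_point_measurable:
  "length ys \<le> n \<Longrightarrow> path_point c ys \<in> measurable (Pi\<^sub>M {..<n} (\<lambda>_. borel)) borel"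
proof (induction ys)
  case (Cons u ys)
  then have [measurable]: "path_point c ys \<in> measurable (Pi\<^sub>M {..<n} (\<lambda>_. borel)) borel" by simp
  have [measurable]: "length ys \<in> {..<n}" using Cons.prems by simp
  show ?case by simp
next
  case Nil
  have "path_point c [] = (\<lambda>_. 0)" by (intro ext) simp
  then show ?case by simp
qed

lemma path_point_measurable_UNIV [measurable]:
  "path_point c ys \<in> measurable (Pi\<^sub>M UNIV (\<lambda>_. borel)) borel"
proof (induction ys)
  case (Cons u ys)
  then have [measurable]: "path_point c ys \<in> measurable (Pi\<^sub>M UNIV (\<lambda>_. borel)) borel" by simp
  show ?case by simp
qed simp

fun path_event :: "(nat \<Rightarrow> 'a \<Rightarrow> real ^ 3) \<Rightarrow> (real ^ 3) list \<Rightarrow> 'a \<Rightarrow> bool" where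
  "path_event V [] \<omega> = True"
| "path_event V (u # ys) \<omega> = (V (length ys) \<omega> = u \<and> path_event V ys \<omega>)"

lemma path_event_rev: "path_event V ys \<omega> \<longleftrightarrow> (\<forall>i<length ys. V i \<omega> = rev ys ! i)"
proof (induction ys)
  case (Cons u ys)
  show ?case
    unfolding path_event.simps Cons.IH length_Cons All_less_Suc by (simp add: nth_append)
qed simp

lemma path_event_unique: "path_event V ys \<omega> \<longleftrightarrow> ys = rev (map (\<lambda>i. V i \<omega>) [0..<length ys])"
proof (induction ys)
  case (Cons u ys)
  have "rev (map (\<lambda>i. V i \<omega>) [0..<length (u # ys)]) = V (length ys) \<omega> # rev (map (\<lambda>i. V i \<omega>) [0..<length ys])"
    by simp
  then show ?case
    unfolding path_event.simps Cons.IH list.inject by (auto simp del: rev_map upt_Suc)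
qed simp

context orthogonal_standard_motion
begin

lemma W_measurable [measurable]: "W k \<in> borel_measurable M"
  using waiting_indep unfolding indep_vars_def by auto

lemma V_measurable [measurable]: "V n \<in> M \<rightarrow>\<^sub>M count_space osm_directions"
  by (rule direction_measurable)

lemma V_in: "\<omega> \<in> space M \<Longrightarrow> V n \<omega> \<in> osm_directions"
  using measurable_space[OF direction_measurable] by simp

lemma V_borel [measurable]: "V n \<in> borel_measurable M"
  by (rule measurable_compose[OF direction_measurable]) simp

text \<open>The point depends only on waiting times with smaller index, hence is independent of the
  next one, and their joint law is a product.\<close>

lemma nn_integral_next_wait:
  assumes [measurable]: "G \<in> borel_measurable (borel \<Otimes>\<^sub>M borel)"
  shows "(\<integral>\<^sup>+\<omega>. G (path_point c ys (\<lambda>k. W k \<omega>), W (length ys) \<omega>) \<partial>M)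
    = (\<integral>\<^sup>+\<omega>. \<integral>\<^sup>+s. ennreal (exponential_density l s) * G (path_point c ys (\<lambda>k. W k \<omega>), s) \<partial>lborel \<partial>M)"
proof -
  let ?n = "length ys"
  let ?Y = "\<lambda>\<omega>. path_point c ys (\<lambda>k. W k \<omega>)"
  \<comment> \<open>The waiting time is padded to a space-time point because
    \<open>indep_var\<close> relates two variables of one type.\<close>
  let ?W = "\<lambda>\<omega>. (W ?n \<omega>, 0) :: pt"
  have "indep_var borel (path_point c ys \<circ> (\<lambda>\<omega>. restrict (\<lambda>k. W k \<omega>) {..<?n})) borel ((\<lambda>g. (g ?n, 0)) \<circ> (\<lambda>\<omega>. restrict (\<lambda>k. W k \<omega>) {?n}))"
    by (intro indep_var_compose[OF indep_var_restrict[OF waiting_indep]] path_point_measurable) auto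
  also have "path_point c ys \<circ> (\<lambda>\<omega>. restrict (\<lambda>k. W k \<omega>) {..<?n}) = ?Y"
    by (auto simp: path_point_restrict)
  also have "(\<lambda>g. (g ?n, 0)) \<circ> (\<lambda>\<omega>. restrict (\<lambda>k. W k \<omega>) {?n}) = ?W"
    by auto
  finally have ind: "indep_var borel ?Y borel ?W" .
  then have [measurable]: "?Y \<in> borel_measurable M" by (rule indep_var_rv1)
  interpret P: prob_space "distr M borel ?W" by (rule prob_space_distr) measurable
  have "(\<integral>\<^sup>+\<omega>. G (?Y \<omega>, W ?n \<omega>) \<partial>M) = (\<integral>\<^sup>+x. G (fst x, fst (snd x)) \<partial>distr M (borel \<Otimes>\<^sub>M borel) (\<lambda>\<omega>. (?Y \<omega>, ?W \<omega>)))"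
    by (subst nn_integral_distr) auto
  also have "\<dots> = (\<integral>\<^sup>+x. G (fst x, fst (snd x)) \<partial>(distr M borel ?Y \<Otimes>\<^sub>M distr M borel ?W))"
    using ind by (simp add: indep_var_distribution_eq)
  also have "\<dots> = (\<integral>\<^sup>+y. \<integral>\<^sup>+s. G (y, fst s) \<partial>distr M borel ?W \<partial>distr M borel ?Y)"
    by (subst P.nn_integral_fst[symmetric]) (simp_all cong: measurable_cong_sets)
  also have "\<dots> = (\<integral>\<^sup>+\<omega>. \<integral>\<^sup>+s. G (?Y \<omega>, fst s) \<partial>distr M borel ?W \<partial>M)"
    by (subst nn_integral_distr) auto
  also have "\<dots> = (\<integral>\<^sup>+\<omega>. \<integral>\<^sup>+s. ennreal (exponential_density l s) * G (?Y \<omega>, s) \<partial>lborel \<partial>M)"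
  proof (rule nn_integral_cong)
    fix \<omega>
    have "(\<integral>\<^sup>+s. G (?Y \<omega>, fst s) \<partial>distr M borel ?W) = (\<integral>\<^sup>+\<omega>'. G (?Y \<omega>, W ?n \<omega>') \<partial>M)"
      by (subst nn_integral_distr) auto
    also have "\<dots> = (\<integral>\<^sup>+s. ennreal (exponential_density l s) * G (?Y \<omega>, s) \<partial>lborel)"
      by (rule distributed_nn_integral[OF waiting_exponential, symmetric]) measurable
    finally show "(\<integral>\<^sup>+s. G (?Y \<omega>, fst s) \<partial>distr M borel ?W) = (\<integral>\<^sup>+s. ennreal (exponential_density l s) * G (?Y \<omega>, s) \<partial>lborel)" .
  qed
  finally show ?thesis .
qed

lemma exponential_tail:
  assumes "0 \<le> s"
  shows "(\<integral>\<^sup>+w. ennreal (exponential_density l w) * indicator {s<..} w \<partial>lborel) = ennreal (exp (- l * s))"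
proof -
  have "(\<integral>\<^sup>+w. ennreal (exponential_density l w) * indicator {s<..} w \<partial>lborel) = (\<integral>\<^sup>+\<omega>. indicator {s<..} (W 0 \<omega>) \<partial>M)"
    by (rule distributed_nn_integral[OF waiting_exponential]) measurable
  also have "\<dots> = (\<integral>\<^sup>+\<omega>. indicator {\<omega> \<in> space M. s < W 0 \<omega>} \<omega> \<partial>M)"
    by (intro nn_integral_cong) (auto simp: indicator_def)
  also have "\<dots> = emeasure M {\<omega> \<in> space M. s < W 0 \<omega>}"
    by (rule nn_integral_indicator) measurable
  also have "\<dots> = ennreal (exp (- l * s))"
    unfolding emeasure_eq_measure exponential_distributedD_gt[OF waiting_exponential assms rate_pos]
    by (simp add: mult.commute)
  finally show ?thesis .
qed

text \<open>Each exponential waiting time contributes l times a discounted ray integral, which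
  \<open>ew_discount\<close> turns into \<open>Iop\<close>.\<close>

lemma nn_integral_path_point:
  assumes "f \<in> borel_measurable borel"
  shows "(\<integral>\<^sup>+\<omega>. f (path_point c ys (\<lambda>k. W k \<omega>)) \<partial>M) = ennreal (l ^ length ys) * path_op c ys (ew l f)"
  using assms
proof (induction ys arbitrary: f)
  case Nil
  then show ?case by (simp add: ew_def emeasure_space_1)
next
  case (Cons u ys)
  note [measurable] = Cons.prems
  let ?z = "velocity c u"
  have pm [measurable]: "(\<lambda>\<omega>. path_point c ys (\<lambda>k. W k \<omega>)) \<in> borel_measurable M"
    by (rule measurable_compose[OF _ path_point_measurable_UNIV]) (simp add: measurable_PiM_single' space_PiM)
  have "(\<integral>\<^sup>+\<omega>. f (path_point c (u # ys) (\<lambda>k. W k \<omega>)) \<partial>M)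
     = (\<integral>\<^sup>+\<omega>. \<integral>\<^sup>+s. ennreal (exponential_density l s) * f (path_point c ys (\<lambda>k. W k \<omega>) + s *\<^sub>R ?z) \<partial>lborel \<partial>M)"
    using nn_integral_next_wait[of "\<lambda>(y, s). f (y + s *\<^sub>R ?z)" ys] by simp
  also have "\<dots> = (\<integral>\<^sup>+\<omega>. ennreal l * discount l ?z f (path_point c ys (\<lambda>k. W k \<omega>)) \<partial>M)"
  proof (rule nn_integral_cong)
    fix \<omega>
    show "(\<integral>\<^sup>+s. ennreal (exponential_density l s) * f (path_point c ys (\<lambda>k. W k \<omega>) + s *\<^sub>R ?z) \<partial>lborel)
      = ennreal l * discount l ?z f (path_point c ys (\<lambda>k. W k \<omega>))"
      unfolding discount_def
      by (subst nn_integral_cmult[symmetric], measurable, intro nn_integral_cong)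
         (use rate_pos in \<open>auto simp: exponential_density_def indicator_def ennreal_mult mult_ac\<close>)
  qed
  also have "\<dots> = ennreal l * (ennreal (l ^ length ys) * path_op c ys (ew l (discount l ?z f)))"
    by (subst nn_integral_cmult) (auto simp: Cons.IH)
  also have "\<dots> = ennreal (l ^ length (u # ys)) * path_op c (u # ys) (ew l f)"
    using rate_pos by (simp add: ew_discount velocity_def ennreal_mult mult.assoc)
  finally show ?case .
qed

definition segment :: "(pt \<Rightarrow> ennreal) \<Rightarrow> pt \<Rightarrow> pt \<Rightarrow> real \<Rightarrow> ennreal" where
  "segment f y z w = (\<integral>\<^sup>+s. f (y + s *\<^sub>R z) * indicator {0..<w} s \<partial>lborel)"

lemma indicator_0_less: "(indicator {0..<w} s :: ennreal) = indicator {0..} s * indicator {0<..} (w - s)" for w s :: real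
  by (auto simp: indicator_def)

lemma segment_measurable [measurable (raw)]:
  assumes [measurable]: "f \<in> borel_measurable borel" "Y \<in> borel_measurable N" "Z \<in> borel_measurable N" "w \<in> borel_measurable N"
  shows "(\<lambda>x. segment f (Y x) (Z x) (w x)) \<in> borel_measurable N"
  unfolding segment_def indicator_0_less by measurable

text \<open>The segment in progress is only required to last beyond s. This has probability
  \<open>exp (- l * s)\<close>, without the factor l of the exponential density, so l is raised to
  the number of completed segments.\<close>

lemma nn_integral_segment:
  assumes [measurable]: "f \<in> borel_measurable borel"
  shows "(\<integral>\<^sup>+\<omega>. segment f (path_point c ys (\<lambda>k. W k \<omega>)) (velocity c u) (W (length ys) \<omega>) \<partial>M)
    = ennreal (l ^ length ys) * path_op c (u # ys) (ew l f)"
proof -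
  let ?z = "velocity c u"
  have "(\<integral>\<^sup>+\<omega>. segment f (path_point c ys (\<lambda>k. W k \<omega>)) ?z (W (length ys) \<omega>) \<partial>M)
    = (\<integral>\<^sup>+\<omega>. \<integral>\<^sup>+w. ennreal (exponential_density l w) * segment f (path_point c ys (\<lambda>k. W k \<omega>)) ?z w \<partial>lborel \<partial>M)"
    using nn_integral_next_wait[of "\<lambda>(y, w). segment f y ?z w" ys] by simp
  also have "\<dots> = (\<integral>\<^sup>+\<omega>. discount l ?z f (path_point c ys (\<lambda>k. W k \<omega>)) \<partial>M)"
  proof (rule nn_integral_cong)
    fix \<omega>
    let ?y = "path_point c ys (\<lambda>k. W k \<omega>)"
    have "(\<integral>\<^sup>+w. ennreal (exponential_density l w) * segment f ?y ?z w \<partial>lborel)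
      = (\<integral>\<^sup>+w. \<integral>\<^sup>+s. ennreal (exponential_density l w) * (f (?y + s *\<^sub>R ?z) * indicator {0..} s * indicator {0<..} (w - s)) \<partial>lborel \<partial>lborel)"
      unfolding segment_def indicator_0_less by (subst nn_integral_cmult) (auto simp: mult.assoc)
    also have "\<dots> = (\<integral>\<^sup>+s. \<integral>\<^sup>+w. ennreal (exponential_density l w) * (f (?y + s *\<^sub>R ?z) * indicator {0..} s * indicator {0<..} (w - s)) \<partial>lborel \<partial>lborel)"
      by (rule lborel_pair.Fubini') measurable
    also have "\<dots> = (\<integral>\<^sup>+s. ennreal (exp (- l * s)) * f (?y + s *\<^sub>R ?z) * indicator {0..} s \<partial>lborel)"
    proof (rule nn_integral_cong)
      fix s :: real
      have "(\<integral>\<^sup>+w. ennreal (exponential_density l w) * (f (?y + s *\<^sub>R ?z) * indicator {0..} s * indicator {0<..} (w - s)) \<partial>lborel)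
        = (\<integral>\<^sup>+w. (f (?y + s *\<^sub>R ?z) * indicator {0..} s) * (ennreal (exponential_density l w) * indicator {s<..} w) \<partial>lborel)"
        by (intro nn_integral_cong) (auto simp: indicator_def mult_ac)
      also have "\<dots> = (f (?y + s *\<^sub>R ?z) * indicator {0..} s) * (\<integral>\<^sup>+w. ennreal (exponential_density l w) * indicator {s<..} w \<partial>lborel)"
        by (rule nn_integral_cmult) measurable
      also have "\<dots> = ennreal (exp (- l * s)) * f (?y + s *\<^sub>R ?z) * indicator {0..} s"
      proof (cases "0 \<le> s")
        case True
        show ?thesis unfolding exponential_tail[OF True] by (simp only: mult_ac)
      qed simp
      finally show "(\<integral>\<^sup>+w. ennreal (exponential_density l w) * (f (?y + s *\<^sub>R ?z) * indicator {0..} s * indicator {0<..} (w - s)) \<partial>lborel)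
        = ennreal (exp (- l * s)) * f (?y + s *\<^sub>R ?z) * indicator {0..} s" .
    qed
    finally show "(\<integral>\<^sup>+w. ennreal (exponential_density l w) * segment f ?y ?z w \<partial>lborel) = discount l ?z f ?y"
      unfolding discount_def .
  qed
  also have "\<dots> = ennreal (l ^ length ys) * path_op c (u # ys) (ew l f)"
    by (simp add: nn_integral_path_point ew_discount velocity_def)
  finally show ?thesis .
qed

lemma prob_path_event:
  "set ys \<subseteq> osm_directions \<Longrightarrow> prob {\<omega> \<in> space M. path_event V ys \<omega>} = path_prob ys"
proof (induction ys rule: path_prob.induct)
  case 1
  then show ?case by (simp add: prob_space)
next
  case (2 u)
  then show ?case
    using initial_direction[of u] card_osm_directions by (simp add: pmf_of_set osm_directions_def[THEN arg_cong, of "\<lambda>x. x \<noteq> {}"])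
next
  case (3 u v ys)
  let ?n = "length ys"
  let ?h = "\<lambda>i. rev (v # ys) ! i"
  have Q: "path_event V (v # ys) \<omega> \<longleftrightarrow> (\<forall>i\<le>?n. V i \<omega> = ?h i)" for \<omega>
    unfolding path_event_rev by (simp add: less_Suc_eq_le)
  have hn: "?h ?n = v" by (simp add: nth_append)
  have IH: "prob {\<omega> \<in> space M. path_event V (v # ys) \<omega>} = path_prob (v # ys)"
    using 3 by simp
  have u: "u \<in> osm_directions" and v: "v \<in> osm_directions" using 3 by auto
  show ?case
  \<comment> \<open>Given a null event the transition law prescribes nothing; there monotonicity of
    the probability settles the claim.\<close>
  proof (cases "path_prob (v # ys) = 0")
    case True
    have "prob {\<omega> \<in> space M. path_event V (u # v # ys) \<omega>} \<le> prob {\<omega> \<in> space M. path_event V (v # ys) \<omega>}"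
      unfolding path_event_rev by (rule finite_measure_mono) (auto simp: nth_append All_less_Suc)
    then show ?thesis using True IH by (simp add: measure_le_0_iff)
  next
    case False
    have "prob {\<omega> \<in> space M. path_event V (u # v # ys) \<omega>} / path_prob (v # ys)
      = \<P>(\<omega> in M. V (Suc ?n) \<omega> = u \<bar> \<forall>i\<le>?n. V i \<omega> = ?h i)"
      unfolding cond_prob_def Q[symmetric] IH by simp
    also have "\<dots> = pmf (pmf_of_set {w \<in> osm_directions. orthogonal v w}) u"
      using next_direction[of ?n ?h u] False IH unfolding Q hn by simp
    also have "\<dots> = (if orthogonal v u then 1 / 4 else 0)"
    proof -
      have "{w \<in> osm_directions. orthogonal v w} \<noteq> {}"
        using card_orthogonal_directions[OF v] by (metis card.empty zero_neq_numeral)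
      then show ?thesis
        using card_orthogonal_directions[OF v] u by (simp add: pmf_of_set)
    qed
    finally show ?thesis using False by (simp add: field_simps)
  qed
qed

lemma W_sequence_measurable [measurable]: "(\<lambda>\<omega> k. W k \<omega>) \<in> M \<rightarrow>\<^sub>M (\<Pi>\<^sub>M k\<in>UNIV. borel)"
  by (rule measurable_PiM_single') (auto simp: space_PiM)

lemma V_sequence_measurable: "(\<lambda>\<omega> n. V n \<omega>) \<in> M \<rightarrow>\<^sub>M (\<Pi>\<^sub>M n\<in>UNIV. count_space osm_directions)"
  by (rule measurable_PiM_single') (auto simp: space_PiM V_in)

lemma path_event_measurable [measurable]: "{\<omega> \<in> space M. path_event V ys \<omega>} \<in> sets M"
  unfolding path_event_rev by measurable

lemma prob_path_event_wait:
  assumes B: "B \<in> sets (\<Pi>\<^sub>M k\<in>UNIV. borel)"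
  shows "prob ({\<omega> \<in> space M. path_event V ys \<omega>} \<inter> ((\<lambda>\<omega> k. W k \<omega>) -` B \<inter> space M))
    = prob {\<omega> \<in> space M. path_event V ys \<omega>} * prob ((\<lambda>\<omega> k. W k \<omega>) -` B \<inter> space M)"
proof -
  let ?S = "\<Pi>\<^sub>M k\<in>(UNIV :: nat set). (borel :: real measure)"
  let ?T = "\<Pi>\<^sub>M n\<in>(UNIV :: nat set). count_space osm_directions"
  define E where "E = {v \<in> space ?T. \<forall>i<length ys. v i = rev ys ! i}"
  have E: "E \<in> sets ?T"
    unfolding E_def by measurable
  have "{\<omega> \<in> space M. path_event V ys \<omega>} = (\<lambda>\<omega> n. V n \<omega>) -` E \<inter> space M"
    unfolding path_event_rev E_def using measurable_space[OF V_sequence_measurable] by auto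
  then have 1: "{\<omega> \<in> space M. path_event V ys \<omega>} \<in> sets (vimage_algebra (space M) (\<lambda>\<omega> n. V n \<omega>) ?T)"
    using E by (auto simp: sets_vimage_algebra intro!: sigma_sets.Basic)
  have 2: "(\<lambda>\<omega> k. W k \<omega>) -` B \<inter> space M \<in> sets (vimage_algebra (space M) (\<lambda>\<omega> k. W k \<omega>) ?S)"
    using B by (auto simp: sets_vimage_algebra intro!: sigma_sets.Basic)
  show ?thesis
    using indep_setD[OF waiting_indep_directions 2 1] by (simp add: Int_commute mult.commute)
qed

text \<open>By independence, restriction to the path event multiplies the law of the waiting times
  by \<open>path_prob ys\<close>. As an equality of measures this carries over from sets to
  integrands.\<close>

lemma nn_integral_on_path:
  assumes [measurable]: "G \<in> borel_measurable (\<Pi>\<^sub>M k\<in>UNIV. borel)" and ys: "set ys \<subseteq> osm_directions"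
  shows "(\<integral>\<^sup>+\<omega>. G (\<lambda>k. W k \<omega>) * indicator {\<omega> \<in> space M. path_event V ys \<omega>} \<omega> \<partial>M)
    = ennreal (path_prob ys) * (\<integral>\<^sup>+\<omega>. G (\<lambda>k. W k \<omega>) \<partial>M)"
proof -
  let ?S = "\<Pi>\<^sub>M k\<in>(UNIV :: nat set). (borel :: real measure)"
  let ?X = "\<lambda>\<omega> k. W k \<omega>" and ?A = "{\<omega> \<in> space M. path_event V ys \<omega>}"
  have eq: "distr (density M (indicator ?A)) ?S ?X = scale_measure (ennreal (path_prob ys)) (distr M ?S ?X)"
  proof (rule measure_eqI)
    fix B assume "B \<in> sets (distr (density M (indicator ?A)) ?S ?X)"
    then have B [measurable]: "B \<in> sets ?S" by simp
    have XB: "?X -` B \<inter> space M \<in> sets M" by measurable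
    have "emeasure (distr (density M (indicator ?A)) ?S ?X) B = (\<integral>\<^sup>+\<omega>. indicator ?A \<omega> * indicator (?X -` B \<inter> space M) \<omega> \<partial>M)"
      by (subst emeasure_distr) (auto simp: emeasure_density measurable_cong_sets[OF sets_density refl])
    also have "\<dots> = emeasure M (?A \<inter> (?X -` B \<inter> space M))"
      unfolding indicator_inter_arith[symmetric]
      by (rule nn_integral_indicator) (intro sets.Int XB path_event_measurable)
    also have "\<dots> = ennreal (path_prob ys) * emeasure (distr M ?S ?X) B"
      by (simp add: emeasure_eq_measure prob_path_event_wait[OF B] prob_path_event[OF ys] emeasure_distr ennreal_mult path_prob_nonneg)
    finally show "emeasure (distr (density M (indicator ?A)) ?S ?X) B = emeasure (scale_measure (ennreal (path_prob ys)) (distr M ?S ?X)) B"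
      by simp
  qed simp
  have "(\<integral>\<^sup>+\<omega>. G (?X \<omega>) * indicator ?A \<omega> \<partial>M) = (\<integral>\<^sup>+\<omega>. G (?X \<omega>) \<partial>density M (indicator ?A))"
    by (subst nn_integral_density) (auto simp: mult.commute)
  also have "\<dots> = (\<integral>\<^sup>+w. G w \<partial>distr (density M (indicator ?A)) ?S ?X)"
    by (subst nn_integral_distr) auto
  also have "\<dots> = ennreal (path_prob ys) * (\<integral>\<^sup>+w. G w \<partial>distr M ?S ?X)"
    unfolding eq by (subst nn_integral_scale_measure) auto
  also have "(\<integral>\<^sup>+w. G w \<partial>distr M ?S ?X) = (\<integral>\<^sup>+\<omega>. G (?X \<omega>) \<partial>M)"
    by (subst nn_integral_distr) auto
  finally show ?thesis .
qed

definition point :: "nat \<Rightarrow> 'a \<Rightarrow> pt" where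
  "point n \<omega> = (\<Sum>k<n. W k \<omega> *\<^sub>R velocity c (V k \<omega>))"

lemma point_path: "path_event V ys \<omega> \<Longrightarrow> point (length ys) \<omega> = path_point c ys (\<lambda>k. W k \<omega>)"
  by (induction ys) (auto simp: point_def)

text \<open>The realised directions form exactly one of the finitely many paths, so the integrand is
  a sum over path events with a single surviving term.\<close>

lemma nn_integral_segments:
  assumes [measurable]: "f \<in> borel_measurable borel"
  shows "(\<integral>\<^sup>+\<omega>. segment f (point n \<omega>) (velocity c (V n \<omega>)) (W n \<omega>) \<partial>M)
    = ennreal (l ^ n) * (\<Sum>ys\<in>paths (Suc n). ennreal (path_prob ys) * path_op c ys (ew l f))"
proof -
  define G where "G h w = (case h of [] \<Rightarrow> 0 | u # ys \<Rightarrow> segment f (path_point c ys w) (velocity c u) (w (length ys)))" for h w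
  have G [measurable]: "G h \<in> borel_measurable (\<Pi>\<^sub>M k\<in>UNIV. borel)" for h
    unfolding G_def by (cases h) (simp_all, measurable)
  have "(\<integral>\<^sup>+\<omega>. segment f (point n \<omega>) (velocity c (V n \<omega>)) (W n \<omega>) \<partial>M)
    = (\<integral>\<^sup>+\<omega>. (\<Sum>h\<in>paths (Suc n). G h (\<lambda>k. W k \<omega>) * indicator {\<omega> \<in> space M. path_event V h \<omega>} \<omega>) \<partial>M)"
  proof (rule nn_integral_cong)
    fix \<omega> assume \<omega>: "\<omega> \<in> space M"
    define h where "h = rev (map (\<lambda>i. V i \<omega>) [0..<Suc n])"
    have h: "h \<in> paths (Suc n)" using V_in[OF \<omega>] by (auto simp: h_def paths_def)
    have len: "length h = Suc n" by (simp add: h_def)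
    have ev: "path_event V h \<omega>" unfolding path_event_unique len by (simp add: h_def)
    have "(\<Sum>h\<in>paths (Suc n). G h (\<lambda>k. W k \<omega>) * indicator {\<omega> \<in> space M. path_event V h \<omega>} \<omega>)
      = (\<Sum>h'\<in>{h}. G h' (\<lambda>k. W k \<omega>) * indicator {\<omega> \<in> space M. path_event V h' \<omega>} \<omega>)"
    proof (rule sum.mono_neutral_right)
      show "\<forall>i\<in>paths (Suc n) - {h}. G i (\<lambda>k. W k \<omega>) * indicator {\<omega> \<in> space M. path_event V i \<omega>} \<omega> = 0"
        using path_event_unique[of V _ \<omega>] by (auto simp: indicator_def paths_def h_def)
    qed (use h in auto)
    also have "\<dots> = G h (\<lambda>k. W k \<omega>)" using ev \<omega> by simp
    also have "\<dots> = segment f (point n \<omega>) (velocity c (V n \<omega>)) (W n \<omega>)"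
    proof -
      obtain u ys where uy: "h = u # ys" "length ys = n" using len by (cases h) auto
      then show ?thesis using ev point_path[of ys \<omega>] by (simp add: G_def)
    qed
    finally show "segment f (point n \<omega>) (velocity c (V n \<omega>)) (W n \<omega>)
      = (\<Sum>h\<in>paths (Suc n). G h (\<lambda>k. W k \<omega>) * indicator {\<omega> \<in> space M. path_event V h \<omega>} \<omega>)" ..
  qed
  also have "\<dots> = (\<Sum>h\<in>paths (Suc n). (\<integral>\<^sup>+\<omega>. G h (\<lambda>k. W k \<omega>) * indicator {\<omega> \<in> space M. path_event V h \<omega>} \<omega> \<partial>M))"
    by (rule nn_integral_sum) (intro borel_measurable_times_ennreal measurable_compose[OF W_sequence_measurable G]
        borel_measurable_indicator path_event_measurable)
  also have "\<dots> = (\<Sum>h\<in>paths (Suc n). ennreal (l ^ n) * (ennreal (path_prob h) * path_op c h (ew l f)))"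
  proof (rule sum.cong)
    fix h assume h: "h \<in> paths (Suc n)"
    then obtain u ys where uy: "h = u # ys" "length ys = n" by (cases h) (auto simp: paths_def)
    have "(\<integral>\<^sup>+\<omega>. G h (\<lambda>k. W k \<omega>) * indicator {\<omega> \<in> space M. path_event V h \<omega>} \<omega> \<partial>M)
      = ennreal (path_prob h) * (\<integral>\<^sup>+\<omega>. G h (\<lambda>k. W k \<omega>) \<partial>M)"
      by (rule nn_integral_on_path[OF G]) (use h in \<open>auto simp: paths_def\<close>)
    also have "(\<integral>\<^sup>+\<omega>. G h (\<lambda>k. W k \<omega>) \<partial>M) = ennreal (l ^ n) * path_op c h (ew l f)"
      using nn_integral_segment[OF assms, of ys u] by (simp only: G_def uy list.case)
    finally show "(\<integral>\<^sup>+\<omega>. G h (\<lambda>k. W k \<omega>) * indicator {\<omega> \<in> space M. path_event V h \<omega>} \<omega> \<partial>M)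
      = ennreal (l ^ n) * (ennreal (path_prob h) * path_op c h (ew l f))" by (simp only: mult.left_commute)
  qed simp
  finally show ?thesis by (simp only: sum_distrib_left)
qed

end

section \<open>Sample paths, their measurability and the occupation integral\<close>

context orthogonal_standard_motion
begin

text \<open>On these outcomes the event times increase strictly to infinity, so that
  \<open>event_count\<close> counts a finite set and the path consists of successive straight
  segments.\<close>

definition good :: "'a \<Rightarrow> bool" where
  "good \<omega> \<longleftrightarrow> (\<forall>k. 0 < W k \<omega>) \<and> (\<forall>t. \<exists>n. t < event_time W n \<omega>)"

lemma event_time_0 [simp]: "event_time W 0 \<omega> = 0"
  by (simp add: event_time_def)

lemma event_time_Suc: "event_time W (Suc n) \<omega> = event_time W n \<omega> + W n \<omega>"
  by (simp add: event_time_def)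

lemma event_time_strict_mono: "good \<omega> \<Longrightarrow> strict_mono (\<lambda>n. event_time W n \<omega>)"
  by (rule strict_monoI_Suc) (simp add: good_def event_time_Suc)

lemma event_time_le_iff: "good \<omega> \<Longrightarrow> event_time W m \<omega> \<le> event_time W n \<omega> \<longleftrightarrow> m \<le> n"
  using strict_mono_less_eq[OF event_time_strict_mono] .

lemma event_time_less_iff: "good \<omega> \<Longrightarrow> event_time W m \<omega> < event_time W n \<omega> \<longleftrightarrow> m < n"
  using strict_mono_less[OF event_time_strict_mono] .

lemma event_count_eq:
  assumes "good \<omega>" "event_time W n \<omega> \<le> t" "t < event_time W (Suc n) \<omega>"
  shows "event_count W t \<omega> = n"
proof -
  have *: "event_time W m \<omega> \<le> t \<longleftrightarrow> m \<le> n" for m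
  proof
    assume "m \<le> n"
    then have "event_time W m \<omega> \<le> event_time W n \<omega>"
      by (rule event_time_le_iff[OF assms(1), THEN iffD2])
    then show "event_time W m \<omega> \<le> t" using assms(2) by (rule order_trans)
  next
    assume "event_time W m \<omega> \<le> t"
    then have "event_time W m \<omega> < event_time W (Suc n) \<omega>" using assms(3) by (rule le_less_trans)
    then have "m < Suc n" by (rule event_time_less_iff[OF assms(1), THEN iffD1])
    then show "m \<le> n" by (rule less_Suc_eq_le[THEN iffD1])
  qed
  have "{m. 1 \<le> m \<and> event_time W m \<omega> \<le> t} = {1..n}"
    unfolding * by auto
  then show ?thesis unfolding event_count_def by simp
qed

lemma fst_point: "fst (point n \<omega>) = event_time W n \<omega>"
  by (simp add: point_def event_time_def velocity_def fst_sum)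

lemma direction_integral_segment:
  assumes "good \<omega>" "event_time W n \<omega> \<le> t" "t \<le> event_time W (Suc n) \<omega>"
  shows "((\<lambda>s. osm_direction W V s \<omega>) has_integral (t - event_time W n \<omega>) *\<^sub>R V n \<omega>) {event_time W n \<omega>..t}"
\<comment> \<open>At the end point t the next event may just have occurred, so this point is
  removed.\<close>
proof (rule has_integral_spike_finite[of "{t}"])
  show "((\<lambda>_. V n \<omega>) has_integral (t - event_time W n \<omega>) *\<^sub>R V n \<omega>) {event_time W n \<omega>..t}"
    using has_integral_const_real[of "V n \<omega>" "event_time W n \<omega>" t] assms by simp
  fix s assume "s \<in> {event_time W n \<omega>..t} - {t}"
  then show "osm_direction W V s \<omega> = V n \<omega>"
    using event_count_eq[OF assms(1), of n s] assms by (simp add: osm_direction_def)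
qed simp

lemma direction_integral:
  assumes "good \<omega>"
  shows "((\<lambda>s. osm_direction W V s \<omega>) has_integral (\<Sum>k<n. W k \<omega> *\<^sub>R V k \<omega>)) {0..event_time W n \<omega>}"
proof (induction n)
  case (Suc n)
  have "event_time W 0 \<omega> \<le> event_time W n \<omega>" "event_time W n \<omega> \<le> event_time W (Suc n) \<omega>"
    by (simp_all only: event_time_le_iff[OF assms] le0 le_SucI order_refl)
  then show ?case
    using has_integral_combine[OF _ _ Suc direction_integral_segment[OF assms _ order_refl, of n]]
    by (simp add: event_time_Suc)
qed (simp add: has_integral_refl)

lemma position_eq:
  assumes "good \<omega>" "event_time W n \<omega> \<le> t" "t \<le> event_time W (Suc n) \<omega>"
  shows "(t, osm_position c W V t \<omega>) = point n \<omega> + (t - event_time W n \<omega>) *\<^sub>R velocity c (V n \<omega>)"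
proof -
  have "event_time W 0 \<omega> \<le> event_time W n \<omega>"
    by (simp only: event_time_le_iff[OF assms(1)] le0)
  then have "((\<lambda>s. osm_direction W V s \<omega>) has_integral ((\<Sum>k<n. W k \<omega> *\<^sub>R V k \<omega>) + (t - event_time W n \<omega>) *\<^sub>R V n \<omega>)) {0..t}"
    by (intro has_integral_combine[OF _ assms(2) direction_integral direction_integral_segment] assms) simp
  then have "osm_position c W V t \<omega> = c *\<^sub>R ((\<Sum>k<n. W k \<omega> *\<^sub>R V k \<omega>) + (t - event_time W n \<omega>) *\<^sub>R V n \<omega>)"
    unfolding osm_position_def by (simp add: integral_unique)
  also have "\<dots> = snd (point n \<omega> + (t - event_time W n \<omega>) *\<^sub>R velocity c (V n \<omega>))"
    by (simp add: point_def velocity_def snd_sum scaleR_sum_right scaleR_right_distrib mult.commute)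
  finally have "osm_position c W V t \<omega> = snd (point n \<omega> + (t - event_time W n \<omega>) *\<^sub>R velocity c (V n \<omega>))" .
  moreover have "t = fst (point n \<omega> + (t - event_time W n \<omega>) *\<^sub>R velocity c (V n \<omega>))"
    by (simp add: fst_point velocity_def)
  ultimately show ?thesis by (simp add: prod_eq_iff)
qed

lemma event_count_measurable [measurable]:
  "(\<lambda>(s, \<omega>). event_count W s \<omega>) \<in> measurable (borel \<Otimes>\<^sub>M M) (count_space UNIV)"
proof -
  have [measurable]: "(\<lambda>x. event_time W n (snd x)) \<in> borel_measurable (borel \<Otimes>\<^sub>M M)" for n
    unfolding event_time_def by measurable
  show ?thesis unfolding event_count_def split_beta by measurable
qed

lemma direction_joint_measurable [measurable]:
  "(\<lambda>(s, \<omega>). osm_direction W V s \<omega>) \<in> borel_measurable (borel \<Otimes>\<^sub>M M)"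
  unfolding osm_direction_def split_beta
  by (rule measurable_compose_countable[where f = "\<lambda>n x. V n (snd x)" and g = "\<lambda>x. event_count W (fst x) (snd x)"])
    (use event_count_measurable in \<open>simp_all add: split_beta\<close>)

lemma norm_direction: "\<omega> \<in> space M \<Longrightarrow> norm (osm_direction W V s \<omega>) \<le> 1"
  using V_in[of \<omega> "event_count W s \<omega>"] by (auto simp: osm_direction_def osm_directions_axis)

lemma direction_set_integrable:
  assumes "\<omega> \<in> space M"
  shows "set_integrable lborel {0..t} (\<lambda>s. osm_direction W V s \<omega>)"
proof (rule set_integrable_bound[where f = "\<lambda>_. 1 :: real"])
  have "(\<lambda>s. osm_direction W V s \<omega>) \<in> borel_measurable borel"
    using measurable_Pair_compose_split[OF direction_joint_measurable measurable_ident measurable_const[OF assms]] by simp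
  then show "set_borel_measurable lborel {0..t} (\<lambda>s. osm_direction W V s \<omega>)"
    unfolding set_borel_measurable_def by measurable
qed (use norm_direction[OF assms] in \<open>auto simp: set_integrable_def emeasure_lborel_Icc_eq intro!: integrable_real_indicator\<close>)

text \<open>The variable limit t moves into an indicator of t - s, so that joint measurability
  follows from that of an integral with a parameter.\<close>

lemma position_eq_lebesgue:
  assumes "\<omega> \<in> space M"
  shows "osm_position c W V t \<omega> = c *\<^sub>R (\<integral>s. indicator {0..} s *\<^sub>R (indicator {0..} (t - s) *\<^sub>R osm_direction W V s \<omega>) \<partial>lborel)"
proof -
  have "(\<integral>s. indicator {0..} s *\<^sub>R (indicator {0..} (t - s) *\<^sub>R osm_direction W V s \<omega>) \<partial>lborel) = (LINT s:{0..t}|lborel. osm_direction W V s \<omega>)"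
    unfolding set_lebesgue_integral_def by (intro Bochner_Integration.integral_cong) (auto simp: indicator_def)
  also have "\<dots> = integral {0..t} (\<lambda>s. osm_direction W V s \<omega>)"
    by (rule set_borel_integral_eq_integral(2)[OF direction_set_integrable[OF assms]])
  finally show ?thesis by (simp add: osm_position_def)
qed

lemma position_joint_measurable [measurable]:
  "(\<lambda>(t, \<omega>). osm_position c W V t \<omega>) \<in> borel_measurable (borel \<Otimes>\<^sub>M M)"
proof -
  have "(\<lambda>x. c *\<^sub>R (\<integral>s. indicator {0..} s *\<^sub>R (indicator {0..} (fst x - s) *\<^sub>R osm_direction W V s (snd x)) \<partial>lborel)) \<in> borel_measurable (borel \<Otimes>\<^sub>M M)"
    by measurable
  then show ?thesis
    by (rule measurable_cong[THEN iffD1, rotated]) (auto simp: space_pair_measure position_eq_lebesgue)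
qed

lemma position_continuous:
  assumes "\<omega> \<in> space M"
  shows "continuous_on {0..b} (\<lambda>t. osm_position c W V t \<omega>)"
  unfolding osm_position_def
  by (intro continuous_intros indefinite_integral_continuous_1
      set_borel_integral_eq_integral(1)[OF direction_set_integrable[OF assms]])

text \<open>The half-open intervals between successive events partition the time axis of a good
  outcome, and on each of them the path is a straight segment.\<close>

lemma path_integral_eq:
  assumes [measurable]: "f \<in> borel_measurable borel" and g: "good \<omega>" and \<omega>: "\<omega> \<in> space M"
  shows "(\<integral>\<^sup>+t. f (t, osm_position c W V t \<omega>) * indicator {0..} t \<partial>lborel)
    = (\<Sum>n. segment f (point n \<omega>) (velocity c (V n \<omega>)) (W n \<omega>))"
proof -
  let ?T = "\<lambda>n. event_time W n \<omega>"
  have [measurable]: "(\<lambda>t. osm_position c W V t \<omega>) \<in> borel_measurable borel"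
    using measurable_Pair_compose_split[OF position_joint_measurable measurable_ident measurable_const[OF \<omega>]] by simp
  have mono: "?T n \<le> ?T m \<longleftrightarrow> n \<le> m" for n m
    by (rule event_time_le_iff[OF g])
  have cover: "{0..} = (\<Union>n. {?T n..<?T (Suc n)})"
  proof (intro equalityI subsetI)
    fix t :: real assume t: "t \<in> {0..}"
    define N where "N = (LEAST n. t < ?T n)"
    have N: "t < ?T N" using g unfolding N_def good_def by (metis LeastI_ex)
    then have "N \<noteq> 0" using t by (metis atLeast_iff event_time_0 not_le)
    then obtain n where n: "N = Suc n" by (cases N) auto
    have "\<not> t < ?T n" using not_less_Least[of n "\<lambda>n. t < ?T n"] n by (simp add: N_def)
    then have "t \<in> {?T n..<?T (Suc n)}" using N unfolding n by (simp add: not_less)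
    then show "t \<in> (\<Union>n. {?T n..<?T (Suc n)})" by blast
  next
    fix t assume "t \<in> (\<Union>n. {?T n..<?T (Suc n)})"
    then show "t \<in> {0..}" using mono[of 0] by (auto intro: order_trans)
  qed
  have "disjoint_family (\<lambda>n. {?T n..<?T (Suc n)})"
    unfolding disjoint_family_on_def
  proof (intro ballI impI)
    fix m n :: nat assume "m \<noteq> n"
    then have "?T (Suc m) \<le> ?T n \<or> ?T (Suc n) \<le> ?T m" unfolding mono by linarith
    then show "{?T m..<?T (Suc m)} \<inter> {?T n..<?T (Suc n)} = {}" by auto
  qed
  then have "(\<integral>\<^sup>+t. f (t, osm_position c W V t \<omega>) * indicator {0..} t \<partial>lborel)
    = (\<Sum>n. \<integral>\<^sup>+t\<in>{?T n..<?T (Suc n)}. f (t, osm_position c W V t \<omega>) \<partial>lborel)"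
    unfolding cover by (intro nn_integral_disjoint_family) auto
  also have "\<dots> = (\<Sum>n. segment f (point n \<omega>) (velocity c (V n \<omega>)) (W n \<omega>))"
  proof (rule suminf_cong)
    fix n
    have "(\<integral>\<^sup>+t\<in>{?T n..<?T (Suc n)}. f (t, osm_position c W V t \<omega>) \<partial>lborel)
      = (\<integral>\<^sup>+t\<in>{?T n..<?T (Suc n)}. f (point n \<omega> + (t - ?T n) *\<^sub>R velocity c (V n \<omega>)) \<partial>lborel)"
      using position_eq[OF g, of n] by (intro nn_integral_cong) (auto simp: indicator_def)
    also have "\<dots> = (\<integral>\<^sup>+s. f (point n \<omega> + s *\<^sub>R velocity c (V n \<omega>)) * indicator {?T n..<?T (Suc n)} (?T n + s) \<partial>lborel)"
      by (subst nn_integral_real_affine[where c = 1 and t = "?T n"]) auto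
    also have "\<dots> = segment f (point n \<omega>) (velocity c (V n \<omega>)) (W n \<omega>)"
      unfolding segment_def by (intro nn_integral_cong) (auto simp: indicator_def event_time_Suc)
    finally show "(\<integral>\<^sup>+t\<in>{?T n..<?T (Suc n)}. f (t, osm_position c W V t \<omega>) \<partial>lborel)
      = segment f (point n \<omega>) (velocity c (V n \<omega>)) (W n \<omega>)" .
  qed
  finally show ?thesis .
qed

section \<open>Events do not accumulate\<close>

lemma Iop_exp:
  assumes "0 < a" "fst z = 1"
  shows "Iop z (\<lambda>p. ennreal (exp (- a * fst p))) = (\<lambda>p. ennreal (1 / a) * ennreal (exp (- a * fst p)))"
proof
  fix p
  have "(\<integral>\<^sup>+s. ennreal (exponential_density a s) \<partial>lborel) = 1"
    using prob_space.emeasure_space_1[OF prob_space_exponential_density[OF assms(1)]] by (simp add: emeasure_density)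
  moreover have "Iop z (\<lambda>p. ennreal (exp (- a * fst p))) p
    = (\<integral>\<^sup>+s. ennreal (1 / a * exp (- a * fst p)) * ennreal (exponential_density a s) \<partial>lborel)"
    unfolding Iop_def
  proof (rule nn_integral_cong)
    fix s
    have "exp (- a * fst (p + s *\<^sub>R z)) = 1 / a * exp (- a * fst p) * (a * exp (- s * a))"
      using assms by (simp add: exp_add[symmetric] algebra_simps)
    then show "ennreal (exp (- a * fst (p + s *\<^sub>R z))) * indicator {0..} s = ennreal (1 / a * exp (- a * fst p)) * ennreal (exponential_density a s)"
      using assms(1) by (auto simp: exponential_density_def indicator_def ennreal_mult[symmetric])
  qed
  moreover have "ennreal (1 / a * exp (- a * fst p)) = ennreal (1 / a) * ennreal (exp (- a * fst p))"
    using assms(1) by (intro ennreal_mult) auto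
  ultimately show "Iop z (\<lambda>p. ennreal (exp (- a * fst p))) p = ennreal (1 / a) * ennreal (exp (- a * fst p))"
    by (subst (asm) nn_integral_cmult) (simp_all only: mult_1_right, measurable)
qed

text \<open>Exponentials in time are eigenfunctions of every ray operator with time speed 1, with
  eigenvalue 1 / a.\<close>

lemma path_op_exp:
  assumes "0 < a"
  shows "path_op c ys (\<lambda>p. r * ennreal (exp (- a * fst p))) = r * ennreal (1 / a) ^ length ys"
proof (induction ys arbitrary: r)
  case (Cons u ys)
  have I: "Iop (velocity c u) (\<lambda>p. r * ennreal (exp (- a * fst p))) = (\<lambda>p. (r * ennreal (1 / a)) * ennreal (exp (- a * fst p)))"
  proof -
    have m: "(\<lambda>p :: pt. ennreal (exp (- a * fst p))) \<in> borel_measurable borel" by measurable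
    have v: "fst (velocity c u) = 1" by (simp add: velocity_def)
    show ?thesis by (simp only: Iop_cmult[OF m] Iop_exp[OF assms v] mult.assoc)
  qed
  show ?case
    unfolding path_op.simps I by (subst Cons) (simp only: length_Cons power_Suc mult.assoc)
qed simp

lemma fst_path_point: "fst (path_point c ys w) = (\<Sum>k<length ys. w k)"
  by (induction ys) (auto simp: velocity_def)

lemma nn_integral_exp_event_time:
  "(\<integral>\<^sup>+\<omega>. ennreal (exp (- event_time W n \<omega>)) \<partial>M) = ennreal ((l / (l + 1)) ^ n)"
proof -
  \<comment> \<open>Only the time component matters, so the zero vector serves as a dummy
    direction.\<close>
  define ys :: "(real ^ 3) list" where "ys = replicate n 0"
  have len: "length ys = n" by (simp add: ys_def)
  have "(\<integral>\<^sup>+\<omega>. ennreal (exp (- event_time W n \<omega>)) \<partial>M) = (\<integral>\<^sup>+\<omega>. (\<lambda>p. ennreal (exp (- fst p))) (path_point c ys (\<lambda>k. W k \<omega>)) \<partial>M)"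
    by (simp add: fst_path_point len event_time_def)
  also have "\<dots> = ennreal (l ^ n) * path_op c ys (ew l (\<lambda>p. ennreal (exp (- fst p))))"
    by (subst nn_integral_path_point) (auto simp: len)
  also have "ew l (\<lambda>p. ennreal (exp (- fst p))) = (\<lambda>p. 1 * ennreal (exp (- (l + 1) * fst p)))"
    by (intro ext) (simp add: ew_def ennreal_mult[symmetric] exp_add[symmetric] algebra_simps)
  also have "path_op c ys \<dots> = ennreal (1 / (l + 1)) ^ n"
    using path_op_exp[of "l + 1" ys 1] rate_pos by (simp add: len)
  also have "ennreal (l ^ n) * ennreal (1 / (l + 1)) ^ n = ennreal ((l / (l + 1)) ^ n)"
    using rate_pos by (simp add: ennreal_power ennreal_mult[symmetric] power_divide)
  finally show ?thesis .
qed

text \<open>The infimum over n of \<open>exp (- event_time W n \<omega>)\<close> has expectation at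
  most (l / (l + 1))^n for every n. So it vanishes almost surely, which forces the event times to be
  unbounded.\<close>

lemma AE_good: "AE \<omega> in M. good \<omega>"
proof -
  have "AE \<omega> in M. \<not> W k \<omega> \<le> 0" for k
  proof -
    have "prob {\<omega> \<in> space M. W k \<omega> \<le> 0} = 0"
      using exponential_distributedD_le[OF waiting_exponential order_refl rate_pos, of k] by simp
    then show ?thesis by (subst (asm) prob_Collect_eq_0) auto
  qed
  then have 1: "AE \<omega> in M. \<forall>k. 0 < W k \<omega>"
    unfolding AE_all_countable by (simp add: not_le)
  define I where "I \<omega> = (INF n. ennreal (exp (- event_time W n \<omega>)))" for \<omega>
  have [measurable]: "event_time W n \<in> borel_measurable M" for n
    unfolding event_time_def by measurable
  have [measurable]: "I \<in> borel_measurable M" unfolding I_def by measurable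
  have le: "(\<integral>\<^sup>+\<omega>. I \<omega> \<partial>M) \<le> ennreal ((l / (l + 1)) ^ n)" for n
    unfolding nn_integral_exp_event_time[symmetric] I_def by (intro nn_integral_mono INF_lower) auto
  have "(\<lambda>n. ennreal ((l / (l + 1)) ^ n)) \<longlonglongrightarrow> ennreal 0"
    using rate_pos by (intro tendsto_ennrealI LIMSEQ_realpow_zero) auto
  then have "(\<integral>\<^sup>+\<omega>. I \<omega> \<partial>M) \<le> 0"
    using le by (intro LIMSEQ_le_const) auto
  then have "AE \<omega> in M. I \<omega> = 0"
    by (subst nn_integral_0_iff_AE[symmetric]) auto
  with 1 show ?thesis
  proof eventually_elim
    case (elim \<omega>)
    have "\<exists>n. t < event_time W n \<omega>" for t
    proof (rule ccontr)
      assume "\<not> ?thesis"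
      then have "ennreal (exp (- t)) \<le> I \<omega>"
        unfolding I_def by (intro INF_greatest ennreal_leI) (auto simp: not_less)
      then show False using elim by (simp add: ennreal_eq_0_iff)
    qed
    then show ?case using elim by (simp add: good_def)
  qed
qed

text \<open>The occupation integral is resolved into segments, direction paths and step numbers in
  turn. It involves an integral over t, hence by itself determines the density for almost every time
  only.\<close>

lemma spacetime_density:
  assumes [measurable]: "f \<in> borel_measurable borel" and supp: "region_supp c f"
  shows "(\<integral>\<^sup>+\<omega>. \<integral>\<^sup>+t. f (t, osm_position c W V t \<omega>) * indicator {0..} t \<partial>lborel \<partial>M)
    = (\<integral>\<^sup>+v. \<integral>\<^sup>+t. f (t, v) * ennreal (exp (- l * t) * dens c l t v) \<partial>lborel \<partial>lborel)"
proof -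
  have [measurable]: "point n \<in> borel_measurable M" "(\<lambda>\<omega>. velocity c (V n \<omega>)) \<in> borel_measurable M" for n
    unfolding point_def velocity_def by measurable
  have supp': "region_supp c (ew l f)"
    using supp by (simp add: region_supp_def ew_def)
  have e: "ennreal (exp (- l * t) * dens c l t v) = ennreal (exp (- l * t)) * ennreal (dens c l t v)" for t v
    by (rule ennreal_mult') simp
  have "(\<integral>\<^sup>+\<omega>. \<integral>\<^sup>+t. f (t, osm_position c W V t \<omega>) * indicator {0..} t \<partial>lborel \<partial>M)
    = (\<integral>\<^sup>+\<omega>. (\<Sum>n. segment f (point n \<omega>) (velocity c (V n \<omega>)) (W n \<omega>)) \<partial>M)"
    using AE_good AE_space by (intro nn_integral_cong_AE) (auto simp: path_integral_eq elim!: eventually_elim2)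
  also have "\<dots> = (\<Sum>n. ennreal (l ^ n) * (\<Sum>ys\<in>paths (Suc n). ennreal (path_prob ys) * path_op c ys (ew l f)))"
    by (simp add: nn_integral_suminf nn_integral_segments)
  also have "\<dots> = (\<integral>\<^sup>+k. path_weight l k * T3 c (ew l f) k \<partial>count_space UNIV)"
    by (rule sum_paths_eq_T3[OF rate_pos]) measurable
  also have "\<dots> = (\<integral>\<^sup>+v. \<integral>\<^sup>+t. ew l f (t, v) * ennreal (dens c l t v) \<partial>lborel \<partial>lborel)"
    by (rule sum_T3_dens[OF speed_pos rate_pos supp']) measurable
  also have "\<dots> = (\<integral>\<^sup>+v. \<integral>\<^sup>+t. f (t, v) * ennreal (exp (- l * t) * dens c l t v) \<partial>lborel \<partial>lborel)"
    unfolding ew_def fst_conv e by (simp only: mult_ac)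
  finally show ?thesis .
qed

end

section \<open>The density at a fixed time\<close>

definition qdens :: "real \<Rightarrow> real \<Rightarrow> real \<Rightarrow> real ^ 3 \<Rightarrow> real" where
  "qdens c l t v = exp (- l * t) * dens c l t v"

text \<open>The absolute values of the coordinates enter an everywhere convergent series, so
  continuity also holds across the coordinate planes.\<close>

lemma qdens_continuous:
  assumes "0 < l"
  shows "continuous_on U (\<lambda>p. qdens c l (fst p) (snd p))"
proof -
  define hs :: "(pt \<Rightarrow> real) list" where
    "hs = [\<lambda>p. \<bar>snd p $ 1\<bar> / c, \<lambda>p. \<bar>snd p $ 2\<bar> / c, \<lambda>p. \<bar>snd p $ 3\<bar> / c, \<lambda>p. (fst p - tau c (snd p)) / 2]"
  let ?A = "on_list (cf 0 (osm_weight l))"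
  have eq: "(\<lambda>p. qdens c l (fst p) (snd p)) = (\<lambda>p. exp (- l * fst p) * (l\<^sup>2 / (192 * c ^ 3) * mser (map (\<lambda>h. h p) hs) ?A))"
    by (simp add: qdens_def dens_def hs_def)
  have hs: "continuous_on S h" if "h \<in> set hs" for h S
    using that unfolding hs_def tau_def divide_inverse list.set
    by (elim insertE emptyE; hypsubst; intro continuous_intros)
  have len: "length hs = 4" by (simp add: hs_def)
  have m: "continuous_on (cball p 1) (\<lambda>z. mser (map (\<lambda>h. h z) hs) ?A)" for p
    by (rule mser_continuous_on[OF compact_cball _ hs]) (use geo_cf_tame[OF tame_osm_weight[OF assms]] in \<open>simp_all add: len\<close>)
  have *: "continuous_on (cball p 1) (\<lambda>p. qdens c l (fst p) (snd p))" for p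
    unfolding eq by (intro continuous_on_mult m continuous_intros)
  have "isCont (\<lambda>p. qdens c l (fst p) (snd p)) p" for p
    by (rule continuous_on_interior[OF *[of p]]) simp
  then show ?thesis by (simp add: continuous_at_imp_continuous_on)
qed

lemma qdens_slice_continuous:
  assumes "0 < l"
  shows "continuous_on U (qdens c l t)" "continuous_on V (\<lambda>t. qdens c l t v)"
proof -
  have "continuous_on U (\<lambda>v. (t, v))" "continuous_on V (\<lambda>t. (t, v))"
    by (intro continuous_on_Pair continuous_on_const continuous_on_id)+
  from this[THEN continuous_on_compose2[OF qdens_continuous[OF assms, of UNIV c]]]
  show "continuous_on U (qdens c l t)" "continuous_on V (\<lambda>t. qdens c l t v)"
    by simp_all
qed

lemma qdens_measurable [measurable]:
  assumes "0 < l"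
  shows "(\<lambda>p. qdens c l (fst p) (snd p)) \<in> borel_measurable borel" "qdens c l t \<in> borel_measurable borel"
  using qdens_continuous[OF assms] qdens_slice_continuous(1)[OF assms] by (auto intro: borel_measurable_continuous_onI)

text \<open>If b exceeded a at t, then by a fixed gap on a whole window. Windows extend to the right
  because a test function supported in the region at some time stays supported there at later
  times.\<close>

lemma eq_of_window_integrals:
  fixes a b :: "real \<Rightarrow> real"
  assumes a: "(a \<longlongrightarrow> a t) (at t within {t..t+1})" and b: "(b \<longlongrightarrow> b t) (at t within {t..t+1})"
    and nn: "0 \<le> a t"
    and eq: "\<And>h. 0 < h \<Longrightarrow> h \<le> 1 \<Longrightarrow> (\<integral>\<^sup>+s. ennreal (a s) * indicator {t..t+h} s \<partial>lborel) = (\<integral>\<^sup>+s. ennreal (b s) * indicator {t..t+h} s \<partial>lborel)"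
  shows "b t \<le> a t"
proof (rule ccontr)
  assume "\<not> b t \<le> a t"
  then obtain m1 m2 where m: "a t < m1" "m1 < m2" "m2 < b t" by (meson dense not_le)
  have "eventually (\<lambda>s. a s < m1 \<and> m2 < b s) (at t within {t..t+1})"
    using order_tendstoD[OF a] order_tendstoD[OF b] m by (auto intro: eventually_conj)
  then obtain d where d: "0 < d" "\<And>s. s \<in> {t..t+1} \<Longrightarrow> s \<noteq> t \<Longrightarrow> dist s t < d \<Longrightarrow> a s < m1 \<and> m2 < b s"
    unfolding eventually_at by auto
  define h where "h = min (d / 2) 1"
  have h: "0 < h" "h \<le> 1" "h < d" using d(1) by (auto simp: h_def)
  have ab: "a s < m1 \<and> m2 < b s" if "s \<in> {t..t+h}" for s
    using d(2)[of s] m that h by (cases "s = t") (auto simp: dist_real_def)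
  have ab': "a s \<le> m1" "m2 \<le> b s" if "s \<in> {t..t+h}" for s
    using ab[OF that] by auto
  have "ennreal (m2 * h) = (\<integral>\<^sup>+s. ennreal m2 * indicator {t..t+h} s \<partial>lborel)"
    using m nn h by (simp add: nn_integral_cmult_indicator ennreal_mult)
  also have "\<dots> \<le> (\<integral>\<^sup>+s. ennreal (b s) * indicator {t..t+h} s \<partial>lborel)"
    using ab' by (intro nn_integral_mono) (auto simp: indicator_def intro!: ennreal_leI)
  also have "\<dots> = (\<integral>\<^sup>+s. ennreal (a s) * indicator {t..t+h} s \<partial>lborel)"
    using eq[OF h(1,2)] by simp
  also have "\<dots> \<le> (\<integral>\<^sup>+s. ennreal m1 * indicator {t..t+h} s \<partial>lborel)"
    using ab' by (intro nn_integral_mono) (auto simp: indicator_def intro!: ennreal_leI)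
  also have "\<dots> = ennreal (m1 * h)"
    using m nn h by (simp add: nn_integral_cmult_indicator ennreal_mult)
  finally have "m2 * h \<le> m1 * h" using m nn h by (subst (asm) ennreal_le_iff) auto
  then show False using m h by simp
qed

definition slice :: "real \<Rightarrow> real \<Rightarrow> (real ^ 3) set" where
  "slice c t = {v. (t, v) \<in> osm_region c}"

lemma slice_eq:
  assumes "0 < c"
  shows "slice c t = {v. tau c v < t} \<inter> (\<Inter>i. {v. v $ i \<noteq> 0})"
  using mem_osm_region[OF assms] by (auto simp: slice_def)

lemma open_slice: "0 < c \<Longrightarrow> open (slice c t)"
  unfolding slice_eq tau_def divide_inverse
  by (intro open_Int open_INT ballI open_Collect_less open_Collect_neq continuous_intros) auto

lemma slice_norm:
  assumes "0 < c" "v \<in> slice c t"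
  shows "norm v \<le> c * t"
proof -
  have "norm v \<le> (\<Sum>i\<in>UNIV. \<bar>v $ i\<bar>)" by (rule norm_le_l1_cart)
  also have "\<dots> = c * tau c v" using assms by (simp add: sum_3 tau_def)
  also have "\<dots> \<le> c * t" using assms by (simp add: slice_def mem_osm_region)
  finally show ?thesis .
qed

context orthogonal_standard_motion
begin

text \<open>Both sides, as functions of time, have equal integrals over the windows that start at
  t0, by \<open>spacetime_density\<close>. Both are right-continuous at t0, one through the
  continuity of the paths and one through that of the series, so they agree at t0 itself.\<close>

lemma expectation_test_function:
  fixes g :: "real ^ 3 \<Rightarrow> real"
  assumes cont: "continuous_on UNIV g" and g01: "\<And>v. 0 \<le> g v" "\<And>v. g v \<le> 1"
    and supp: "\<And>v. g v \<noteq> 0 \<Longrightarrow> v \<in> slice c t0" and t0: "0 < t0"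
  shows "(\<integral>\<^sup>+\<omega>. ennreal (g (osm_position c W V t0 \<omega>)) \<partial>M) = (\<integral>\<^sup>+v. ennreal (g v * qdens c l t0 v) \<partial>lborel)"
proof -
  have [measurable]: "g \<in> borel_measurable borel" using cont by (rule borel_measurable_continuous_onI)
  note [measurable] = qdens_measurable[OF rate_pos]
  let ?X = "osm_position c W V"
  let ?R = "cball (0 :: real ^ 3) (c * t0)"
  \<comment> \<open>The slices of the region grow with time.\<close>
  have reg: "(t, v) \<in> osm_region c" if "g v \<noteq> 0" "t0 \<le> t" for t v
    using supp[OF that(1)] that(2) by (auto simp: slice_def mem_osm_region[OF speed_pos])
  have q0: "0 \<le> g v * qdens c l t v" if "t0 \<le> t" for t v
    using g01[of v] dens_eq(1)[OF speed_pos rate_pos, of v t] reg[of v t] that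
    by (cases "g v = 0") (auto simp: qdens_def mem_osm_region[OF speed_pos])
  define a where "a t = (\<integral>\<omega>. g (?X t \<omega>) \<partial>M)" for t
  define b where "b t = (\<integral>v. g v * qdens c l t v \<partial>lborel)" for t
  \<comment> \<open>Compactness in time and space gives one dominating function for the whole
    window.\<close>
  have "bounded ((\<lambda>p. qdens c l (fst p) (snd p)) ` ({t0..t0+1} \<times> ?R))"
    by (intro compact_imp_bounded compact_continuous_image qdens_continuous rate_pos compact_Times) auto
  then obtain C where C: "\<And>t v. t \<in> {t0..t0+1} \<Longrightarrow> v \<in> ?R \<Longrightarrow> \<bar>qdens c l t v\<bar> \<le> C"
    by (fastforce simp: bounded_iff)
  have bnd: "norm (g v * qdens c l t v) \<le> C * indicator ?R v" if "t \<in> {t0..t0+1}" for t v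
  proof (cases "g v = 0")
    case True
    have "0 \<le> C" using C[of t0 0] speed_pos t0 by force
    then show ?thesis using True by simp
  next
    case False
    then have v: "v \<in> ?R" using slice_norm[OF speed_pos supp] by simp
    have "\<bar>g v\<bar> * \<bar>qdens c l t v\<bar> \<le> 1 * C"
      using g01[of v] C[OF that v] by (intro mult_mono) auto
    then show ?thesis using v by (simp add: abs_mult)
  qed
  have int_R: "integrable lborel (\<lambda>v. C * indicator ?R v :: real)"
    using emeasure_lborel_cball_finite[of "0 :: real ^ 3" "c * t0"]
    by (intro integrable_mult_right integrable_real_indicator) auto
  have int_b: "integrable lborel (\<lambda>v. g v * qdens c l t v)" if "t \<in> {t0..t0+1}" for t
    by (rule Bochner_Integration.integrable_bound[OF int_R]) (use bnd[OF that] in \<open>auto intro!: AE_I2 order_trans[OF _ abs_ge_self]\<close>)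
  have eb: "ennreal (b t) = (\<integral>\<^sup>+v. ennreal (g v * qdens c l t v) \<partial>lborel)" if "t \<in> {t0..t0+1}" for t
    unfolding b_def using nn_integral_eq_integral[OF int_b[OF that]] q0 that by simp
  have int_a: "integrable M (\<lambda>\<omega>. g (?X t \<omega>))" for t
    by (rule integrable_const_bound[where B = 1]) (use g01 in auto)
  have ea: "ennreal (a t) = (\<integral>\<^sup>+\<omega>. ennreal (g (?X t \<omega>)) \<partial>M)" for t
    unfolding a_def using nn_integral_eq_integral[OF int_a] g01 by simp
  have tend_a: "(a \<longlongrightarrow> a t0) (at t0 within {t0..t0+1})"
    unfolding tendsto_at_iff_sequentially comp_def a_def
  proof (intro allI impI)
    fix T assume T: "\<forall>i. T i \<in> {t0..t0 + 1} - {t0}" "T \<longlonglongrightarrow> t0"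
    show "(\<lambda>i. \<integral>\<omega>. g (?X (T i) \<omega>) \<partial>M) \<longlonglongrightarrow> (\<integral>\<omega>. g (?X t0 \<omega>) \<partial>M)"
    proof (rule integral_dominated_convergence[where w = "\<lambda>_. 1"])
      show "AE \<omega> in M. (\<lambda>i. g (?X (T i) \<omega>)) \<longlonglongrightarrow> g (?X t0 \<omega>)"
      proof (rule AE_I2)
        fix \<omega> assume \<omega>: "\<omega> \<in> space M"
        have "(\<lambda>i. ?X (T i) \<omega>) \<longlonglongrightarrow> ?X t0 \<omega>"
        proof (rule continuous_on_tendsto_compose[OF position_continuous[OF \<omega>, of "t0 + 1"] T(2)])
          show "t0 \<in> {0..t0 + 1}" using t0 by simp
          have "T i \<in> {0..t0 + 1}" for i
            using T(1)[rule_format, of i] t0 by simp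
          then show "\<forall>\<^sub>F i in sequentially. T i \<in> {0..t0 + 1}" by simp
        qed
        then show "(\<lambda>i. g (?X (T i) \<omega>)) \<longlonglongrightarrow> g (?X t0 \<omega>)"
          by (rule continuous_on_tendsto_compose[OF cont]) auto
      qed
    qed (use g01 in auto)
  qed
  have tend_b: "(b \<longlongrightarrow> b t0) (at t0 within {t0..t0+1})"
    unfolding tendsto_at_iff_sequentially comp_def b_def
  proof (intro allI impI)
    fix T assume T: "\<forall>i. T i \<in> {t0..t0 + 1} - {t0}" "T \<longlonglongrightarrow> t0"
    show "(\<lambda>i. \<integral>v. g v * qdens c l (T i) v \<partial>lborel) \<longlonglongrightarrow> (\<integral>v. g v * qdens c l t0 v \<partial>lborel)"
    proof (rule integral_dominated_convergence[OF _ _ int_R])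
      show "AE v in lborel. (\<lambda>i. g v * qdens c l (T i) v) \<longlonglongrightarrow> g v * qdens c l t0 v"
        by (intro AE_I2 tendsto_mult tendsto_const continuous_on_tendsto_compose[OF qdens_slice_continuous(2)[OF rate_pos, of UNIV] T(2)]) auto
      show "AE v in lborel. norm (g v * qdens c l (T i) v) \<le> C * indicator ?R v" for i
        using bnd T(1) by (intro AE_I2) auto
    qed measurable
  qed
  have eq: "(\<integral>\<^sup>+s. ennreal (a s) * indicator {t0..t0+h} s \<partial>lborel) = (\<integral>\<^sup>+s. ennreal (b s) * indicator {t0..t0+h} s \<partial>lborel)"
    if "0 < h" "h \<le> 1" for h
  proof -
    define f where "f p = ennreal (g (snd p)) * indicator {t0..t0+h} (fst p)" for p :: pt
    have [measurable]: "(snd :: pt \<Rightarrow> real ^ 3) \<in> borel_measurable borel"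
      by (intro borel_measurable_continuous_onI continuous_intros)
    have [measurable]: "f \<in> borel_measurable borel" unfolding f_def by measurable
    have rs: "region_supp c f"
      unfolding region_supp_def
    proof (intro allI impI)
      fix t v assume "(t, v) \<notin> osm_region c"
      then have "g v = 0 \<or> t \<notin> {t0..t0+h}" using reg[of v t] by auto
      then show "f (t, v) = 0" unfolding f_def by (elim disjE) simp_all
    qed
    have "(\<integral>\<^sup>+s. ennreal (a s) * indicator {t0..t0+h} s \<partial>lborel)
      = (\<integral>\<^sup>+s. \<integral>\<^sup>+\<omega>. f (s, ?X s \<omega>) * indicator {0..} s \<partial>M \<partial>lborel)"
    proof (rule nn_integral_cong)
      fix s
      show "ennreal (a s) * indicator {t0..t0+h} s = (\<integral>\<^sup>+\<omega>. f (s, ?X s \<omega>) * indicator {0..} s \<partial>M)"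
      proof (cases "s \<in> {t0..t0+h}")
        case True
        then have "s \<in> {0..}" using t0 by simp
        then show ?thesis
          unfolding f_def fst_conv snd_conv indicator_simps(1)[OF True] ea by (simp only: indicator_simps(1) mult_1_right)
      next
        case False
        show ?thesis
          unfolding f_def fst_conv snd_conv indicator_simps(2)[OF False] by simp
      qed
    qed
    also have "\<dots> = (\<integral>\<^sup>+\<omega>. \<integral>\<^sup>+s. f (s, ?X s \<omega>) * indicator {0..} s \<partial>lborel \<partial>M)"
    proof -
      interpret pair_sigma_finite M lborel ..
      have "(\<lambda>p. ?X (snd p) (fst p)) \<in> borel_measurable (M \<Otimes>\<^sub>M borel)"
        using measurable_compose[OF measurable_pair_swap'[of M borel] position_joint_measurable] by (simp add: split_beta)
      moreover have "sets (M \<Otimes>\<^sub>M lborel) = sets (M \<Otimes>\<^sub>M (borel :: real measure))"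
        by (rule sets_pair_measure_cong) simp_all
      ultimately have "(\<lambda>p. ?X (snd p) (fst p)) \<in> borel_measurable (M \<Otimes>\<^sub>M lborel)"
        using measurable_cong_sets by blast
      then have [measurable]: "(\<lambda>(\<omega>, s). f (s, ?X s \<omega>) * indicator {0..} s) \<in> borel_measurable (M \<Otimes>\<^sub>M lborel)"
        by (simp add: split_beta) measurable
      show ?thesis by (rule Fubini') measurable
    qed
    also have "\<dots> = (\<integral>\<^sup>+v. \<integral>\<^sup>+t. f (t, v) * ennreal (qdens c l t v) \<partial>lborel \<partial>lborel)"
      unfolding qdens_def by (rule spacetime_density[OF _ rs]) measurable
    also have "\<dots> = (\<integral>\<^sup>+t. \<integral>\<^sup>+v. f (t, v) * ennreal (qdens c l t v) \<partial>lborel \<partial>lborel)"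
    proof (rule lborel_pair.Fubini')
      have "(\<lambda>p. f p * ennreal (qdens c l (fst p) (snd p))) \<in> borel_measurable borel"
        using qdens_measurable(1)[OF rate_pos, of c]
        by (intro borel_measurable_times_ennreal measurable_compose[OF _ measurable_ennreal]) (simp_all add: \<open>f \<in> borel_measurable borel\<close>)
      then show "(\<lambda>(t, v). f (t, v) * ennreal (qdens c l t v)) \<in> borel_measurable (lborel \<Otimes>\<^sub>M lborel)"
        by (simp add: lborel_prod split_beta)
    qed
    also have "\<dots> = (\<integral>\<^sup>+t. ennreal (b t) * indicator {t0..t0+h} t \<partial>lborel)"
    proof (rule nn_integral_cong)
      fix t
      show "(\<integral>\<^sup>+v. f (t, v) * ennreal (qdens c l t v) \<partial>lborel) = ennreal (b t) * indicator {t0..t0+h} t"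
      proof (cases "t \<in> {t0..t0+h}")
        case True
        then have "t \<in> {t0..t0+1}" using that by auto
        then show ?thesis using True g01 by (simp add: eb f_def ennreal_mult' mult.assoc)
      qed (simp add: f_def)
    qed
    finally show ?thesis .
  qed
  have nn: "0 \<le> a t0" "0 \<le> b t0"
    unfolding a_def b_def using g01 q0 by (auto intro!: Bochner_Integration.integral_nonneg)
  have "a t0 = b t0"
    using eq_of_window_integrals[OF tend_a tend_b nn(1) eq] eq_of_window_integrals[OF tend_b tend_a nn(2) eq[symmetric]] by simp
  then show ?thesis using ea[of t0] eb[of t0] by simp
qed

end

section \<open>The transition density\<close>

lemma null_coordinate_planes: "{v :: real ^ 3. \<exists>i. v $ i = 0} \<in> null_sets lborel"
proof -
  have "{v :: real ^ 3. v $ i = 0} \<in> null_sets lborel" for i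
  proof -
    have "closed {v :: real ^ 3. v $ i = 0}"
      by (intro closed_Collect_eq continuous_intros)
    then have "{v :: real ^ 3. v $ i = 0} \<in> sets lborel" by simp
    moreover have "{v :: real ^ 3. v $ i = 0} \<in> null_sets lebesgue"
      using negligible_standard_hyperplane_cart[of i] by (simp add: negligible_iff_null_sets)
    ultimately show ?thesis by (simp add: null_sets_completion_iff)
  qed
  then have "(\<Union>i. {v :: real ^ 3. v $ i = 0}) \<in> null_sets lborel"
    by (intro null_sets_UN') auto
  also have "(\<Union>i. {v :: real ^ 3. v $ i = 0}) = {v. \<exists>i. v $ i = 0}" by auto
  finally show ?thesis .
qed

text \<open>A strict inequality would persist with a gap on a ball. Without the two exceptional null
  sets this ball still has positive finite measure, and both densities give the mass of the
  remaining set, which contradicts the gap. Exchanging the roles yields equality.\<close>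

lemma ac_density_on_le:
  fixes \<mu> :: "'a::euclidean_space measure"
  assumes f: "ac_density_on \<mu> S f" and g: "ac_density_on \<mu> S g"
    and O: "open Q" "Q \<subseteq> S" "continuous_on Q f" "continuous_on Q g" "x \<in> Q"
  shows "f x \<le> g x"
proof (rule ccontr)
  assume "\<not> f x \<le> g x"
  then obtain m1 m2 where m: "g x < m1" "m1 < m2" "m2 < f x" by (meson dense not_le)
  obtain N1 where N1: "N1 \<in> null_sets lborel"
    and fN: "\<And>A. A \<in> sets borel \<Longrightarrow> A \<subseteq> S - N1 \<Longrightarrow> emeasure \<mu> A = (\<integral>\<^sup>+x\<in>A. ennreal (f x) \<partial>lborel)"
    using f unfolding ac_density_on_def by blast
  obtain N2 where N2: "N2 \<in> null_sets lborel"
    and gN: "\<And>A. A \<in> sets borel \<Longrightarrow> A \<subseteq> S - N2 \<Longrightarrow> emeasure \<mu> A = (\<integral>\<^sup>+x\<in>A. ennreal (g x) \<partial>lborel)"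
    using g unfolding ac_density_on_def by blast
  note N = N1 N2
  have "isCont f x" "isCont g x"
    using O by (auto simp: continuous_on_eq_continuous_at)
  then have "eventually (\<lambda>y. m2 < f y \<and> g y < m1 \<and> y \<in> Q) (nhds x)"
    using m O(1,5) by (intro eventually_conj eventually_nhds_in_open)
      (auto simp: isCont_def tendsto_at_iff_tendsto_nhds intro: order_tendstoD)
  then obtain r where r: "0 < r" "\<And>y. dist y x < r \<Longrightarrow> m2 < f y \<and> g y < m1 \<and> y \<in> Q"
    unfolding eventually_nhds_metric by auto
  define A where "A = ball x r - (N1 \<union> N2)"
  have A: "A \<in> sets borel" "A \<subseteq> S - N1" "A \<subseteq> S - N2"
    using r(2) O(2) N by (auto simp: A_def dist_commute null_sets_def)
  have fg: "m2 \<le> f y" "g y \<le> m1" if "y \<in> A" for y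
    using r(2)[of y] that by (auto simp: A_def dist_commute)
  \<comment> \<open>Negative reals collapse to 0 in \<open>ennreal\<close>, so the final comparison
    requires a nonnegative bound.\<close>
  have m1: "0 \<le> m1"
    using g O m(1) unfolding ac_density_on_def by force
  define L where "L = emeasure lborel A"
  have L: "L = emeasure lborel (ball x r)"
    unfolding L_def A_def using N by (intro emeasure_Diff_null_set) auto
  have "ennreal m2 * L = (\<integral>\<^sup>+y. ennreal m2 * indicator A y \<partial>lborel)"
    using A by (simp add: nn_integral_cmult_indicator L_def)
  also have "\<dots> \<le> (\<integral>\<^sup>+y\<in>A. ennreal (f y) \<partial>lborel)"
    using fg by (intro nn_integral_mono) (auto simp: indicator_def intro!: ennreal_leI)
  also have "\<dots> = (\<integral>\<^sup>+y\<in>A. ennreal (g y) \<partial>lborel)"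
    using fN[OF A(1,2)] gN[OF A(1,3)] by simp
  also have "\<dots> \<le> (\<integral>\<^sup>+y. ennreal m1 * indicator A y \<partial>lborel)"
    using fg by (intro nn_integral_mono) (auto simp: indicator_def intro!: ennreal_leI)
  also have "\<dots> = ennreal m1 * L"
    using A by (simp add: nn_integral_cmult_indicator L_def)
  finally have le: "ennreal m2 * L \<le> ennreal m1 * L" .
  have "L < \<infinity>" unfolding L using emeasure_lborel_ball_finite[of x r] by simp
  moreover have "L \<noteq> 0"
  proof
    assume "L = 0"
    then have "ball x r \<in> null_sets lborel" by (simp add: null_sets_def L)
    then have "negligible (ball x r)" by (simp add: negligible_iff_null_sets null_sets_completionI)
    then show False using open_not_negligible[of "ball x r"] r(1) by simp
  qed
  ultimately have "ennreal m2 \<le> ennreal m1"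
    using le by (simp add: ennreal_mult_le_mult_iff mult.commute)
  then show False using m m1 by (simp add: ennreal_le_iff)
qed

section \<open>Octants and the continuous version of the density\<close>

definition osm_dens :: "real \<Rightarrow> real \<Rightarrow> field" where
  "osm_dens c l t v = (if (t, v) \<in> osm_region c then qdens c l t v else 0)"

definition octant :: "real \<Rightarrow> real ^ 3 \<Rightarrow> (real \<times> (real ^ 3)) set" where
  "octant c e = {(t, v). (t, v) \<in> osm_region c \<and> (\<forall>i. 0 < e $ i * v $ i)}"

definition signs :: "(real ^ 3) set" where
  "signs = {e. \<forall>i. e $ i = 1 \<or> e $ i = - 1}"

lemma open_octant:
  assumes "0 < c"
  shows "open (octant c e)"
proof -
  have "octant c e = {p. tau c (snd p) < fst p} \<inter> (\<Inter>i. {p. snd p $ i \<noteq> 0}) \<inter> (\<Inter>i. {p. 0 < e $ i * snd p $ i})"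
    using mem_osm_region[OF assms] by (auto simp: octant_def)
  moreover have "open {p :: pt. tau c (snd p) < fst p}"
    unfolding tau_def divide_inverse by (intro open_Collect_less continuous_intros)
  moreover have "open {p :: pt. snd p $ i \<noteq> 0}" for i
    by (intro open_Collect_neq continuous_intros)
  moreover have "open {p :: pt. 0 < e $ i * snd p $ i}" for i
    by (intro open_Collect_less continuous_intros)
  ultimately show ?thesis by (auto intro!: open_Int open_INT)
qed

lemma osm_region_octants:
  assumes "0 < c"
  shows "osm_region c = (\<Union>e\<in>signs. octant c e)"
proof (intro equalityI subsetI)
  fix p assume p: "p \<in> osm_region c"
  obtain t v where tv: "p = (t, v)" by (cases p)
  define e :: "real ^ 3" where "e = (\<chi> i. sgn (v $ i))"
  have nz: "v $ i \<noteq> 0" for i using p assms by (simp add: tv mem_osm_region)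
  then have "e \<in> signs" by (auto simp: signs_def e_def sgn_real_def)
  moreover have "e $ i * v $ i = \<bar>v $ i\<bar>" for i
    by (auto simp: e_def sgn_real_def abs_if)
  then have "p \<in> octant c e"
    using p nz by (simp add: octant_def tv)
  ultimately show "p \<in> (\<Union>e\<in>signs. octant c e)" by blast
qed (auto simp: octant_def)

definition octant_field :: "real \<Rightarrow> real \<Rightarrow> real ^ 3 \<Rightarrow> field" where
  "octant_field c l e = kfield l c e (\<lambda>i j k m. l\<^sup>2 / (192 * c ^ 3) * cf 0 (osm_weight l) i j k m)"

text \<open>With fixed signs the absolute values become linear, and the density coincides with a
  field that is smooth on the whole space.\<close>

lemma osm_dens_octant:
  assumes l: "0 < l" and e: "e \<in> signs"
  shows "agree_on (octant c e) (osm_dens c l) (octant_field c l e)"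
proof (rule agree_onI)
  fix t v assume tv: "(t, v) \<in> octant c e"
  have ab: "e $ i * v $ i = \<bar>v $ i\<bar>" for i
    using tv e by (auto simp: octant_def signs_def abs_if dest!: spec[of _ i])
  have w: "wcoord c e t v = [\<bar>v $ 1\<bar> / c, \<bar>v $ 2\<bar> / c, \<bar>v $ 3\<bar> / c, (t - tau c v) / 2]"
    by (simp add: wcoord_def ab tau_def)
  have g: "geo 4 (on_list (cf 0 (osm_weight l)))"
    by (rule geo_cf_tame[OF tame_osm_weight[OF l]])
  have "octant_field c l e t v = l\<^sup>2 / (192 * c ^ 3) * kfield l c e (cf 0 (osm_weight l)) t v"
    using kfield_linear[OF g g, of l c e "l\<^sup>2 / (192 * c ^ 3)" 0 t v] by (simp add: octant_field_def)
  then show "osm_dens c l t v = octant_field c l e t v"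
    using tv by (simp add: osm_dens_def octant_def qdens_def dens_def kfield_def w)
qed

lemma geo_octant_field:
  "0 < l \<Longrightarrow> geo 4 (on_list (\<lambda>i j k m. l\<^sup>2 / (192 * c ^ 3) * cf 0 (osm_weight l) i j k m))"
  using geo_lin[OF geo_cf_tame[OF tame_osm_weight] geo_cf_tame[OF tame_osm_weight], of l l 0 0 "l\<^sup>2 / (192 * c ^ 3)" 0] by simp

context orthogonal_standard_motion
begin

lemma emeasure_position_open:
  assumes t0: "0 < t0" and S: "open S" "S \<subseteq> slice c t0"
  shows "emeasure (distr M borel (osm_position c W V t0)) S = (\<integral>\<^sup>+v\<in>S. ennreal (qdens c l t0 v) \<partial>lborel)"
proof -
  note [measurable] = qdens_measurable[OF rate_pos]
  let ?X = "osm_position c W V t0"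
  \<comment> \<open>Continuous functions that vanish outside S and increase to its
    indicator.\<close>
  define g where "g n v = min 1 (real n * infdist v (- S))" for n v
  \<comment> \<open>The distance to the empty set is 0 by convention, so the complement must be
    nonempty; it contains the origin, which lies on the coordinate planes.\<close>
  have ne: "- S \<noteq> {}"
  proof
    assume "- S = {}"
    then have "(0 :: real ^ 3) \<in> slice c t0" using S(2) by auto
    then show False by (simp add: slice_def mem_osm_region[OF speed_pos])
  qed
  have zero: "infdist v (- S) = 0 \<longleftrightarrow> v \<notin> S" for v
    using in_closed_iff_infdist_zero[OF _ ne, of v] S(1) by (simp add: closed_def)
  have g01: "0 \<le> g n v" "g n v \<le> 1" for n v by (auto simp: g_def infdist_nonneg)
  have cont: "continuous_on UNIV (g n)" for n
    unfolding g_def by (intro continuous_intros)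
  have [measurable]: "g n \<in> borel_measurable borel" for n
    by (rule borel_measurable_continuous_onI[OF cont])
  have mono: "g m v \<le> g n v" if "m \<le> n" for m n v
    unfolding g_def using that by (intro min.mono mult_right_mono) (auto simp: infdist_nonneg)
  have q0: "0 \<le> qdens c l t0 v" if "v \<in> S" for v
    using dens_eq(1)[OF speed_pos rate_pos, of v t0] that S(2) by (auto simp: qdens_def slice_def mem_osm_region[OF speed_pos])
  have lim: "(SUP n. ennreal (g n v)) = indicator S v" for v
  proof (cases "v \<in> S")
    case True
    then have p: "0 < infdist v (- S)" using zero[of v] infdist_nonneg[of v "- S"] by linarith
    obtain n where "1 / infdist v (- S) < real n" using reals_Archimedean2 by blast
    then have n: "g n v = 1" using p by (simp add: g_def field_simps)
    have "(SUP n. ennreal (g n v)) = 1"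
    proof (rule antisym)
      show "(SUP n. ennreal (g n v)) \<le> 1" using g01 by (intro SUP_least) simp
      show "1 \<le> (SUP n. ennreal (g n v))" using SUP_upper[of n UNIV "\<lambda>n. ennreal (g n v)"] n by simp
    qed
    then show ?thesis using True by simp
  next
    case False
    then show ?thesis using zero[of v] by (simp add: g_def)
  qed
  have [measurable]: "S \<in> sets borel" using S(1) by simp
  have "emeasure (distr M borel ?X) S = (\<integral>\<^sup>+v. indicator S v \<partial>distr M borel ?X)"
    by (rule nn_integral_indicator[symmetric]) simp
  also have "\<dots> = (\<integral>\<^sup>+\<omega>. (SUP n. ennreal (g n (?X \<omega>))) \<partial>M)"
    unfolding lim by (rule nn_integral_distr) measurable
  also have "\<dots> = (SUP n. \<integral>\<^sup>+\<omega>. ennreal (g n (?X \<omega>)) \<partial>M)"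
    by (rule nn_integral_monotone_convergence_SUP) (auto simp: incseq_def le_fun_def intro!: ennreal_leI mono)
  also have "\<dots> = (SUP n. \<integral>\<^sup>+v. ennreal (g n v) * ennreal (qdens c l t0 v) \<partial>lborel)"
  proof (rule SUP_cong)
    fix n
    have "v \<in> slice c t0" if "g n v \<noteq> 0" for v
      using that zero[of v] S(2) by (cases "v \<in> S") (auto simp: g_def)
    from expectation_test_function[OF cont g01 this t0]
    show "(\<integral>\<^sup>+\<omega>. ennreal (g n (?X \<omega>)) \<partial>M) = (\<integral>\<^sup>+v. ennreal (g n v) * ennreal (qdens c l t0 v) \<partial>lborel)"
      using g01 by (simp add: ennreal_mult')
  qed simp
  also have "\<dots> = (\<integral>\<^sup>+v. (SUP n. ennreal (g n v) * ennreal (qdens c l t0 v)) \<partial>lborel)"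
    by (rule nn_integral_monotone_convergence_SUP[symmetric])
       (auto simp: incseq_def le_fun_def intro!: mult_right_mono ennreal_leI mono)
  also have "\<dots> = (\<integral>\<^sup>+v\<in>S. ennreal (qdens c l t0 v) \<partial>lborel)"
    by (simp add: SUP_mult_right_ennreal[symmetric] lim mult.commute)
  finally show ?thesis .
qed

lemma emeasure_position:
  assumes t0: "0 < t0" and A: "A \<in> sets borel" "A \<subseteq> slice c t0"
  shows "emeasure (distr M borel (osm_position c W V t0)) A = (\<integral>\<^sup>+v\<in>A. ennreal (qdens c l t0 v) \<partial>lborel)"
proof -
  note [measurable] = qdens_measurable[OF rate_pos]
  let ?D = "distr M borel (osm_position c W V t0)" and ?O = "slice c t0"
  have O [measurable]: "?O \<in> sets borel" using open_slice[OF speed_pos] by simp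
  \<comment> \<open>Restricted to the slice, both sides are measures on the whole space; open sets
    form an intersection-stable generator on which they agree, and the total mass is finite.\<close>
  define N1 where "N1 = density ?D (indicator ?O)"
  define N2 where "N2 = density lborel (\<lambda>v. ennreal (qdens c l t0 v) * indicator ?O v)"
  have e1: "emeasure N1 B = emeasure ?D (B \<inter> ?O)" if "B \<in> sets borel" for B
    unfolding N1_def using that O
    by (subst emeasure_density) (auto simp: indicator_inter_arith[symmetric] Int_commute nn_integral_indicator mult.commute)
  have e2: "emeasure N2 B = (\<integral>\<^sup>+v\<in>B \<inter> ?O. ennreal (qdens c l t0 v) \<partial>lborel)" if "B \<in> sets borel" for B
    unfolding N2_def using that O
    by (subst emeasure_density) (auto simp: indicator_inter_arith mult_ac)
  have "N1 = N2"
  proof (rule measure_eqI_generator_eq[where E = "Collect open" and \<Omega> = UNIV and A = "\<lambda>_. UNIV"])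
    show "Int_stable (Collect open :: (real ^ 3) set set)" by (auto simp: Int_stable_def)
    show "emeasure N1 X = emeasure N2 X" if "X \<in> Collect open" for X
    proof -
      have X: "open X" using that by simp
      show ?thesis
        using emeasure_position_open[OF t0, of "X \<inter> ?O"] X open_slice[OF speed_pos, of t0]
        by (simp add: e1 e2 open_Int)
    qed
    show "sets N1 = sigma_sets UNIV (Collect open)" "sets N2 = sigma_sets UNIV (Collect open)"
      by (simp_all add: N1_def N2_def sets_borel borel_def)
    interpret D: prob_space ?D by (rule prob_space_distr) measurable
    show "emeasure N1 UNIV \<noteq> \<infinity>" for i :: nat
      by (simp add: e1)
  qed auto
  then have "emeasure N1 A = emeasure N2 A" by simp
  then show ?thesis using A by (simp add: e1 e2 Int_absorb2)
qed

text \<open>The coordinate planes serve as the exceptional null set; off them the interior of the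
  octahedron is the slice.\<close>

lemma osm_dens_density: "osm_transition_density M c W V (osm_dens c l)"
  unfolding osm_transition_density_def
proof (intro allI impI)
  fix t :: real assume t: "0 < t"
  note [measurable] = qdens_measurable[OF rate_pos]
  let ?D = "distr M borel (osm_position c W V t)" and ?S = "interior (octahedron (c * t))"
  have dens: "osm_dens c l t = (\<lambda>v. qdens c l t v * indicator (slice c t) v)"
    by (intro ext) (simp add: osm_dens_def slice_def)
  have [measurable]: "slice c t \<in> sets borel" "?S \<in> sets borel" using open_slice[OF speed_pos] by auto
  show "ac_density_on ?D ?S (osm_dens c l t)"
    unfolding ac_density_on_def
  proof (intro conjI)
    show "set_borel_measurable borel ?S (osm_dens c l t)"
      unfolding set_borel_measurable_def dens by measurable
    show "\<forall>x\<in>?S. 0 \<le> osm_dens c l t x"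
      using dens_eq(1)[OF speed_pos rate_pos, of _ t]
      by (auto simp: osm_dens_def qdens_def mem_osm_region[OF speed_pos])
    show "\<exists>N\<in>null_sets lborel. \<forall>A\<in>sets borel. A \<subseteq> ?S - N \<longrightarrow> emeasure ?D A = (\<integral>\<^sup>+x\<in>A. ennreal (osm_dens c l t x) \<partial>lborel)"
    proof (rule bexI[OF _ null_coordinate_planes], intro ballI impI)
      fix A assume A: "A \<in> sets borel" "A \<subseteq> ?S - {v. \<exists>i. v $ i = 0}"
      then have sub: "A \<subseteq> slice c t"
        using t by (auto simp: slice_def osm_region_def)
      show "emeasure ?D A = (\<integral>\<^sup>+x\<in>A. ennreal (osm_dens c l t x) \<partial>lborel)"
        unfolding emeasure_position[OF t A(1) sub] dens
        using sub by (intro nn_integral_cong) (auto simp: indicator_def)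
    qed
  qed
qed

end

section \<open>Regularity and the equation for continuous versions\<close>

lemma osm_dens_Ck:
  assumes "0 < c" "0 < l"
  shows "Ck_on 6 (osm_region c) (osm_dens c l)"
  unfolding osm_region_octants[OF assms(1)]
proof (rule Ck_on_UN)
  fix e assume e: "e \<in> signs"
  show "Ck_on 6 (octant c e) (osm_dens c l)"
    by (rule Ck_on_cong[OF open_octant[OF assms(1)], where u = "octant_field c l e"])
       (use osm_dens_octant[OF assms(2) e] Ck_on_kfield[OF geo_octant_field[OF assms(2)]] in
         \<open>auto simp: agree_on_def octant_field_def\<close>)
qed (rule open_octant[OF assms(1)])

text \<open>The point lies in one open octant, where p agrees with a single field; both sides of the
  equation depend only on p near that point.\<close>

lemma osm_dens_pde:
  assumes c: "0 < c" and l: "0 < l" and p: "agree_on (osm_region c) p (osm_dens c l)" and tv: "(t, v) \<in> osm_region c"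
  shows "(damped_dt l ^^ 6) p t v - 3 * l\<^sup>2 / 4 * (damped_dt l ^^ 4) p t v - l ^ 3 / 4 * (damped_dt l ^^ 3) p t v
     = c ^ 6 * mixed_sixth p t v - c ^ 4 * (damped_dt l ^^ 2) (mixed_fourth p) t v
       + c\<^sup>2 * ((damped_dt l ^^ 4) (laplacian p) t v - l\<^sup>2 / 4 * (damped_dt l ^^ 2) (laplacian p) t v)"
proof -
  obtain e where e: "e \<in> signs" and tve: "(t, v) \<in> octant c e"
    using tv unfolding osm_region_octants[OF c] by auto
  define u where "u = octant_field c l e"
  have O: "open (octant c e)" by (rule open_octant[OF c])
  have ag: "agree_on (octant c e) p u"
    using p osm_dens_octant[OF l e, of c] by (auto simp: agree_on_def octant_def u_def)
  have d: "(damped_dt l ^^ n) w t v = (damped_dt l ^^ n) w' t v" if "agree_on (octant c e) w w'" for n w w'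
    by (rule agree_onD[OF agree_funpow[OF agree_damped[OF O] that] tve])
  have ee: "e $ i * e $ i = 1" for i
    using e by (auto simp: signs_def dest!: spec[of _ i])
  show ?thesis
    unfolding d[OF ag] d[OF agree_mixed_fourth[OF O ag]] d[OF agree_laplacian[OF O ag]] agree_onD[OF agree_mixed_sixth[OF O ag] tve]
    by (rule kfield_pde[OF l _ ee u_def[unfolded octant_field_def]]) (use c in simp)
qed

text \<open>A density is determined up to null sets; continuity on the region singles out one
  version there, so the claim about every such p reduces to \<open>osm_dens\<close>.\<close>

theorem theorem5p1:
  fixes M :: "'a measure" and c l :: real
    and W :: "nat \<Rightarrow> 'a \<Rightarrow> real" and V :: "nat \<Rightarrow> 'a \<Rightarrow> real ^ 3"
  assumes "orthogonal_standard_motion M c l W V"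
  shows "(\<exists>p. osm_transition_density M c W V p \<and>
              continuous_on (osm_region c) (\<lambda>(t, v). p t v)) \<and>
         (\<forall>p. osm_transition_density M c W V p \<and>
              continuous_on (osm_region c) (\<lambda>(t, v). p t v) \<longrightarrow>
            Ck_on 6 (osm_region c) p \<and>
            (\<forall>(t, v)\<in>osm_region c.
               (damped_dt l ^^ 6) p t v
               - 3 * l\<^sup>2 / 4 * (damped_dt l ^^ 4) p t v
               - l ^ 3 / 4 * (damped_dt l ^^ 3) p t v
               = c ^ 6 * mixed_sixth p t v
               - c ^ 4 * (damped_dt l ^^ 2) (mixed_fourth p) t v
               + c\<^sup>2 * ((damped_dt l ^^ 4) (laplacian p) t v
                       - l\<^sup>2 / 4 * (damped_dt l ^^ 2) (laplacian p) t v)))"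
proof -
  interpret orthogonal_standard_motion M c l W V by fact
  let ?R = "osm_region c"
  have Ck: "Ck_on 6 ?R (osm_dens c l)"
    by (rule osm_dens_Ck[OF speed_pos rate_pos])
  \<comment> \<open>Exposes the successor, so that the defining equation of \<open>Ck_on\<close>
    yields plain continuity.\<close>
  moreover have "6 = Suc 5" by simp
  ultimately have cont: "continuous_on ?R (\<lambda>(t, v). osm_dens c l t v)"
    by (simp only: Ck_on.simps(2))
  have openR: "open ?R"
    unfolding osm_region_octants[OF speed_pos] by (intro open_UN ballI open_octant speed_pos)
  have slice_cont: "continuous_on (slice c t) (p t)" if "continuous_on ?R (\<lambda>(t, v). p t v)" for p :: field and t
  proof -
    have "continuous_on (slice c t) (\<lambda>v. (t, v))"
      by (intro continuous_on_Pair continuous_on_const continuous_on_id)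
    from continuous_on_compose2[OF that this] show ?thesis by (auto simp: slice_def)
  qed
  have unique: "agree_on ?R p (osm_dens c l)"
    if p: "osm_transition_density M c W V p" "continuous_on ?R (\<lambda>(t, v). p t v)" for p
  proof (rule agree_onI)
    fix t v assume tv: "(t, v) \<in> ?R"
    then have t: "0 < t" and v: "v \<in> slice c t" by (auto simp: osm_region_def slice_def)
    have sub: "slice c t \<subseteq> interior (octahedron (c * t))" by (auto simp: slice_def osm_region_def)
    note ac = p(1)[unfolded osm_transition_density_def, rule_format, OF t]
      osm_dens_density[unfolded osm_transition_density_def, rule_format, OF t]
    note co = slice_cont[OF p(2), of t] slice_cont[OF cont, of t]
    show "p t v = osm_dens c l t v"
      using ac_density_on_le[OF ac open_slice[OF speed_pos] sub co v]
        ac_density_on_le[OF ac(2,1) open_slice[OF speed_pos] sub co(2,1) v] by simp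
  qed
  have "Ck_on 6 ?R p \<and> (\<forall>(t, v)\<in>?R.
               (damped_dt l ^^ 6) p t v
               - 3 * l\<^sup>2 / 4 * (damped_dt l ^^ 4) p t v
               - l ^ 3 / 4 * (damped_dt l ^^ 3) p t v
               = c ^ 6 * mixed_sixth p t v
               - c ^ 4 * (damped_dt l ^^ 2) (mixed_fourth p) t v
               + c\<^sup>2 * ((damped_dt l ^^ 4) (laplacian p) t v
                       - l\<^sup>2 / 4 * (damped_dt l ^^ 2) (laplacian p) t v))"
    if p: "osm_transition_density M c W V p" "continuous_on ?R (\<lambda>(t, v). p t v)" for p
  proof (intro conjI)
    have ag: "agree_on ?R p (osm_dens c l)" by (rule unique[OF p])
    then show "Ck_on 6 ?R p"
      by (intro Ck_on_cong[OF openR _ Ck]) (auto simp: agree_on_def)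
    show "\<forall>(t, v)\<in>?R.
               (damped_dt l ^^ 6) p t v
               - 3 * l\<^sup>2 / 4 * (damped_dt l ^^ 4) p t v
               - l ^ 3 / 4 * (damped_dt l ^^ 3) p t v
               = c ^ 6 * mixed_sixth p t v
               - c ^ 4 * (damped_dt l ^^ 2) (mixed_fourth p) t v
               + c\<^sup>2 * ((damped_dt l ^^ 4) (laplacian p) t v
                       - l\<^sup>2 / 4 * (damped_dt l ^^ 2) (laplacian p) t v)"
      unfolding split_beta
      by (intro ballI osm_dens_pde[OF speed_pos rate_pos ag]) simp
  qed
  then show ?thesis
    using osm_dens_density cont by blast
qed

end
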